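(* Let $\Omega\subset\mathbb{R}^2$ be a bounded and simply connected domain with smooth boundary. Let $\beta\in(0,1)$, let $0<\alpha<\min\left\{\frac17,\frac{\beta}{2}\right\}$ and let $A\in C^{0,\beta}(\overline\Omega,\mathbb{R}^{2\times2}_{\mathrm{sym}})$. Let $v\in C^1(\overline\Omega)$ and $w\in C^1(\overline\Omega,\mathbb{R}^2)$ be such that, for some constant $c>0$, $$2\,\mathrm{sym}\nabla w+\nabla v\otimes\nabla v\le A-cI\quad\text{on }\Omega$$ in the sense of symmetric matrices, and let $\varepsilon>0$. Then there exist $\overline v\in C^{1,\alpha}(\overline\Omega)$ and $\overline w\in C^{1,\alpha}(\overline\Omega,\mathbb{R}^2)$ with $$\|\overline w-w\|_{C^0(\Omega,\mathbb{R}^2)}+\|\overline v-v\|_{C^0(\Omega)}\le\varepsilon$$ such that $$2\,\mathrm{sym}\nabla\overline w+\nabla\overline v\otimes\nabla\overline v=A\quad\text{on }\Omega.$$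
   Context: $\mathbb{R}^{2\times2}_{\mathrm{sym}}$ is the space of symmetric real $2\times2$ matrices and $I$ is the unit matrix; for symmetric matrices $M\le N$ means that $N-M$ is positive semidefinite. For $v:\Omega\to\mathbb{R}$, $\nabla v\otimes\nabla v$ is the matrix field with entries $\partial_iv\,\partial_jv$. For $w:\Omega\to\mathbb{R}^2$, $\nabla w$ is the Jacobian matrix and $\mathrm{sym}\nabla w=\frac12(\nabla w+(\nabla w)^T)$. $\|\cdot\|_{C^0}$ is the supremum norm. $C^{0,\beta}(\overline\Omega)$ and $C^{1,\alpha}(\overline\Omega)$ are the usual Hölder spaces. *)

theory Defs
  imports "HOL-Analysis.Analysis"
begin

section \<open>Domains with smooth boundary in the plane\<close>

definition smooth_real :: "(real \<Rightarrow> real) \<Rightarrow> bool" where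
  "smooth_real \<gamma> \<longleftrightarrow> (\<forall>k t. ((deriv ^^ k) \<gamma>) field_differentiable (at t))"

text \<open>Near each of its boundary points the set is, in suitable orthonormal coordinates,
  the region strictly above the graph of a smooth function.\<close>

definition smooth_boundary :: "(real^2) set \<Rightarrow> bool" where
  "smooth_boundary \<Omega> \<longleftrightarrow>
     (\<forall>p\<in>frontier \<Omega>. \<exists>r>0. \<exists>T :: real^2 \<Rightarrow> real^2. \<exists>\<gamma>. orthogonal_transformation T \<and> smooth_real \<gamma> \<and>
        \<Omega> \<inter> ball p r = {x \<in> ball p r. \<gamma> (T x $ 1) < T x $ 2})"

definition domain :: "(real^2) set \<Rightarrow> bool" where
  "domain \<Omega> \<longleftrightarrow> open \<Omega> \<and> connected \<Omega> \<and> \<Omega> \<noteq> {}"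


section \<open>Spaces of functions up to the boundary\<close>

definition partial_deriv :: "2 \<Rightarrow> (real^2 \<Rightarrow> 'b::real_normed_vector) \<Rightarrow> real^2 \<Rightarrow> 'b" where
  "partial_deriv i f x = frechet_derivative f (at x) (axis i 1)"

definition C0_Holder :: "real \<Rightarrow> (real^2) set \<Rightarrow> (real^2 \<Rightarrow> 'b::real_normed_vector) \<Rightarrow> bool" where
  "C0_Holder \<alpha> S f \<longleftrightarrow>
     bounded (f ` S) \<and> (\<exists>K. \<forall>x\<in>S. \<forall>y\<in>S. norm (f x - f y) \<le> K * dist x y powr \<alpha>)"

text \<open>The spaces below consist of functions on the closure of the open set \<open>\<Omega>\<close>;
  differentiability is only required in \<open>\<Omega>\<close>, and \<open>g\<close> is the extension of a partial derivative
  to the closure. Values outside the closure are irrelevant.\<close>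

definition C1_closure :: "(real^2) set \<Rightarrow> (real^2 \<Rightarrow> 'b::real_normed_vector) \<Rightarrow> bool" where
  "C1_closure \<Omega> f \<longleftrightarrow>
     continuous_on (closure \<Omega>) f \<and> (\<forall>x\<in>\<Omega>. f differentiable (at x)) \<and>
     (\<forall>i. \<exists>g. continuous_on (closure \<Omega>) g \<and> (\<forall>x\<in>\<Omega>. g x = partial_deriv i f x))"

definition C1_Holder_closure ::
    "real \<Rightarrow> (real^2) set \<Rightarrow> (real^2 \<Rightarrow> 'b::real_normed_vector) \<Rightarrow> bool" where
  "C1_Holder_closure \<alpha> \<Omega> f \<longleftrightarrow>
     C1_closure \<Omega> f \<and>
     (\<forall>i. \<exists>g. C0_Holder \<alpha> (closure \<Omega>) g \<and> (\<forall>x\<in>\<Omega>. g x = partial_deriv i f x))"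

text \<open>Only meaningful for \<open>f\<close> bounded on the nonempty set \<open>S\<close>.\<close>

definition C0_norm :: "(real^2) set \<Rightarrow> (real^2 \<Rightarrow> 'b::real_normed_vector) \<Rightarrow> real" where
  "C0_norm S f = (SUP x\<in>S. norm (f x))"


section \<open>Matrix fields\<close>

definition gradient :: "(real^2 \<Rightarrow> real) \<Rightarrow> real^2 \<Rightarrow> real^2" where
  "gradient v x = (\<chi> i. partial_deriv i v x)"

definition tensor :: "real^2 \<Rightarrow> real^2 \<Rightarrow> real^2^2" where
  "tensor a b = (\<chi> i j. a $ i * b $ j)"

definition sym_gradient :: "(real^2 \<Rightarrow> real^2) \<Rightarrow> real^2 \<Rightarrow> real^2^2" where
  "sym_gradient w x = (1/2) *\<^sub>R (jacobian w (at x) + transpose (jacobian w (at x)))"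

definition pos_semidef :: "real^2^2 \<Rightarrow> bool" where
  "pos_semidef P \<longleftrightarrow> transpose P = P \<and> (\<forall>x. 0 \<le> x \<bullet> (P *v x))"

definition matrix_le :: "real^2^2 \<Rightarrow> real^2^2 \<Rightarrow> bool" where
  "matrix_le M N \<longleftrightarrow> pos_semidef (N - M)"

end

theory Submission
  imports Defs
begin

text \<open>The proof is Nash--Kuiper convex integration. Adding the corrugation
  \<open>b = (sqrt 2 / L) a sin (L n \<bullet> x)\<close> to \<open>v\<close> and \<open>- b \<nabla>v - (a\<^sup>2 / 4L) sin (2L n \<bullet> x) n\<close> to \<open>w\<close> changes
  \<open>2 sym \<nabla>w + \<nabla>v \<otimes> \<nabla>v\<close> by \<open>a\<^sup>2 n \<otimes> n\<close> up to an error of size \<open>(a |\<nabla>\<^sup>2 v| + a |\<nabla>a|) / L\<close>.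
  A stage mollifies \<open>v, w\<close> at scale \<open>l \<sim> sqrt \<delta> / M\<close>, where \<open>\<delta>\<close> is the size of the deficit and \<open>M\<close> bounds the
  second derivatives, and then removes the deficit in the three directions \<open>(1,0), (0,1), (1,1)\<close> with
  frequencies \<open>K/l, K\<^sup>2/l, K\<^sup>3/l\<close>: the deficit drops by a factor of about \<open>K\<close> and \<open>M\<close> grows by \<open>K\<^sup>3\<close>,
  so that interpolation gives every Hoelder exponent below 1/7; mollifying \<open>A\<close> costs \<open>l\<^sup>\<beta>\<close> and
  accounts for the restriction \<open>\<alpha> < \<beta>/2\<close>.

  The boundary plays no role in the iteration: \<open>v, w\<close> are first approximated in C\<open>\<^sup>1\<close> by functions that are
  smooth and bounded on the whole plane, and \<open>A\<close> is extended such that the deficit stays uniformly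
  positive definite.\<close>


section \<open>Partial derivatives and jets\<close>

text \<open>The exponents result from three balances. Let the second derivatives grow like
  \<Lambda>^q and the deficit decay like \<Lambda>^(-s q). A stage that multiplies the former by
  about K^3 and divides the latter by about K allows every s < 1/3. Gradient increments then have
  size \<Lambda>^(-s q / 2) and Lipschitz constant \<Lambda>^q, so interpolation converges for
  \<alpha> < (s / 2) / (1 + s / 2), which tends to (1/6) / (7/6) = 1/7 as s tends to 1/3. The
  mollification length is \<Lambda>^(-(1 + s / 2) q), and its power \<beta> has to stay below the
  deficit: s \<le> \<beta> (1 + s / 2), which turns the same bound into \<alpha> < \<beta>/2. The
  correction of w contains the gradient of v, so every corrugation costs a derivative. Therefore
  only bounds up to second order pass from stage to stage, and mollification recreates the rest.
  Three fixed directions can only remove a deficit close to a fixed combination of their squares. A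
  general positive definite deficit is first brought to this form by finitely many corrugations in
  more directions, and every stage deliberately leaves a remainder of this form.\<close>

definition has_pd :: "2 \<Rightarrow> (real^2 \<Rightarrow> real) \<Rightarrow> (real^2 \<Rightarrow> real) \<Rightarrow> bool" where
  "has_pd i f g \<longleftrightarrow> (\<forall>x. ((\<lambda>s. f (x + s *\<^sub>R axis i 1)) has_real_derivative g x) (at 0))"

text \<open>Meaningful only together with a \<open>has_pd\<close> fact, which then determines it.
  Derivatives along coordinate lines keep the calculus one-dimensional; Frechet derivatives of the
  solution are recovered from the continuity of its \<open>pd\<close>.\<close>

definition pd :: "2 \<Rightarrow> (real^2 \<Rightarrow> real) \<Rightarrow> real^2 \<Rightarrow> real" where
  "pd i f x = deriv (\<lambda>s. f (x + s *\<^sub>R axis i 1)) 0"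

lemma has_pd_imp_pd: "has_pd i f g \<Longrightarrow> pd i f = g"
  by (auto simp: has_pd_def pd_def fun_eq_iff intro!: DERIV_imp_deriv)

lemma has_pd_pd: "has_pd i f g \<Longrightarrow> has_pd i f (pd i f)"
  by (simp add: has_pd_imp_pd)

lemma has_pd_const: "has_pd i (\<lambda>x. c) (\<lambda>x. 0)"
  by (simp add: has_pd_def)

lemma has_pd_add: "has_pd i f f' \<Longrightarrow> has_pd i g g' \<Longrightarrow> has_pd i (\<lambda>x. f x + g x) (\<lambda>x. f' x + g' x)"
  unfolding has_pd_def by (auto intro!: derivative_eq_intros)

lemma has_pd_diff: "has_pd i f f' \<Longrightarrow> has_pd i g g' \<Longrightarrow> has_pd i (\<lambda>x. f x - g x) (\<lambda>x. f' x - g' x)"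
  unfolding has_pd_def by (auto intro!: derivative_eq_intros)

lemma has_pd_cmult: "has_pd i f f' \<Longrightarrow> has_pd i (\<lambda>x. c * f x) (\<lambda>x. c * f' x)"
  unfolding has_pd_def by (auto intro!: derivative_eq_intros)

lemma has_pd_mult:
  assumes "has_pd i f f'" "has_pd i g g'"
  shows "has_pd i (\<lambda>x. f x * g x) (\<lambda>x. f' x * g x + f x * g' x)"
  unfolding has_pd_def
proof
  fix x
  show "((\<lambda>s. f (x + s *\<^sub>R axis i 1) * g (x + s *\<^sub>R axis i 1)) has_real_derivative
          f' x * g x + f x * g' x) (at 0)"
    using DERIV_mult'[OF assms(1)[unfolded has_pd_def, rule_format, of x]
        assms(2)[unfolded has_pd_def, rule_format, of x]] by (simp add: algebra_simps)
qed

lemma has_pd_sum: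
  assumes "\<And>k. k \<in> I \<Longrightarrow> has_pd i (f k) (f' k)"
  shows "has_pd i (\<lambda>x. \<Sum>k\<in>I. f k x) (\<lambda>x. \<Sum>k\<in>I. f' k x)"
  using assms unfolding has_pd_def by (auto intro!: DERIV_sum)

lemma has_pd_compose:
  assumes "has_pd i f f'" "\<And>x. (F has_real_derivative F' (f x)) (at (f x))"
  shows "has_pd i (\<lambda>x. F (f x)) (\<lambda>x. F' (f x) * f' x)"
  unfolding has_pd_def
proof
  fix x
  show "((\<lambda>s. F (f (x + s *\<^sub>R axis i 1))) has_real_derivative F' (f x) * f' x) (at 0)"
    using DERIV_chain2[of F "F' (f x)" "\<lambda>s. f (x + s *\<^sub>R axis i 1)" 0 "f' x" UNIV] assms
    unfolding has_pd_def by simp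
qed

lemma has_pd_shift: "has_pd i f g \<Longrightarrow> has_pd i (\<lambda>x. f (x + c)) (\<lambda>x. g (x + c))"
proof -
  assume *: "has_pd i f g"
  have eq: "x + s *\<^sub>R axis i 1 + c = (x + c) + s *\<^sub>R axis i 1" for x and s :: real by simp
  show "has_pd i (\<lambda>x. f (x + c)) (\<lambda>x. g (x + c))"
    unfolding has_pd_def eq using * unfolding has_pd_def by blast
qed

lemma has_pd_inner: "has_pd i (\<lambda>x. n \<bullet> x) (\<lambda>x. n $ i)"
  unfolding has_pd_def
  by (auto intro!: derivative_eq_intros simp: inner_add_right inner_axis)

lemma has_pd_DERIV:
  assumes "has_pd i f g"
  shows "((\<lambda>s. f (x + s *\<^sub>R axis i 1)) has_real_derivative g (x + t *\<^sub>R axis i 1)) (at t)"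
proof -
  have "((\<lambda>s. f ((x + t *\<^sub>R axis i 1) + s *\<^sub>R axis i 1)) has_real_derivative
      g (x + t *\<^sub>R axis i 1)) (at 0)"
    using assms unfolding has_pd_def by blast
  then show ?thesis
    using DERIV_shift[of "\<lambda>s. f (x + s *\<^sub>R axis i 1)" "g (x + t *\<^sub>R axis i 1)" 0 t]
    by (simp add: algebra_simps)
qed

text \<open>Mean value inequality for \<open>f - c * t\<close>. With \<open>c = 0\<close> it yields
  Lipschitz bounds, with \<open>c\<close> a value of the derivative a first-order expansion. Only a
  segment is involved, so \<open>f\<close> may be differentiable there alone.\<close>

lemma axis_increment_bound:
  assumes "\<And>s. \<bar>s\<bar> \<le> \<bar>t\<bar> \<Longrightarrow> ((\<lambda>u. f (x + u *\<^sub>R axis i 1)) has_real_derivative g s) (at s)"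
    and "\<And>s. \<bar>s\<bar> \<le> \<bar>t\<bar> \<Longrightarrow> \<bar>g s - c\<bar> \<le> \<eta>"
  shows "\<bar>f (x + t *\<^sub>R axis i 1) - f x - c * t\<bar> \<le> \<eta> * \<bar>t\<bar>"
proof -
  let ?S = "{-\<bar>t\<bar>..\<bar>t\<bar>}"
  have "norm ((f (x + t *\<^sub>R axis i 1) - c * t) - (f (x + 0 *\<^sub>R axis i 1) - c * 0)) \<le> \<eta> * norm (t - 0)"
  proof (rule field_differentiable_bound[of ?S _ "\<lambda>s. g s - c"])
    fix s assume "s \<in> ?S"
    then have "\<bar>s\<bar> \<le> \<bar>t\<bar>" by auto
    then show "((\<lambda>s. f (x + s *\<^sub>R axis i 1) - c * s) has_real_derivative g s - c) (at s within ?S)"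
      using assms(1)[of s] by (auto intro!: derivative_eq_intros intro: DERIV_subset)
    show "norm (g s - c) \<le> \<eta>" using assms(2) \<open>\<bar>s\<bar> \<le> \<bar>t\<bar>\<close> by simp
  qed auto
  then show ?thesis by (simp add: algebra_simps)
qed

lemma coordinate_path: "(y::real^2) = (x + (y$1 - x$1) *\<^sub>R axis 1 1) + (y$2 - x$2) *\<^sub>R axis 2 1"
  by (simp add: vec_eq_iff forall_2 axis_def)

lemma dist_axis_path:
  assumes "\<bar>s\<bar> \<le> \<bar>h$2\<bar>"
  shows "norm ((h::real^2)$1 *\<^sub>R axis 1 1 + s *\<^sub>R axis 2 1 :: real^2) \<le> norm h"
  using assms by (simp add: norm_vec_def L2_set_def sum_2 axis_def abs_le_square_iff)

lemma abs_le_split: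
  fixes X Y Z :: real
  assumes "\<bar>X\<bar> \<le> a" "\<bar>Y\<bar> \<le> b" "Z = X + Y" "a + b \<le> c"
  shows "\<bar>Z\<bar> \<le> c"
  using assms by linarith

lemma has_pd_has_derivative:
  assumes f: "\<And>i. has_pd i f (g i)" and g: "\<And>i. continuous_on UNIV (g i)"
  shows "(f has_derivative (\<lambda>h. g 1 x * h $ 1 + g 2 x * h $ 2)) (at x)"
  unfolding has_derivative_at_alt
proof (intro conjI allI impI)
  show "bounded_linear (\<lambda>h. g 1 x * h $ 1 + g 2 x * h $ 2)"
    by (intro bounded_linear_add bounded_linear_const_mult bounded_linear_vec_nth)
next
  fix e :: real assume "e > 0"
  have "\<exists>d>0. \<forall>y. dist y x < d \<longrightarrow> \<bar>g i y - g i x\<bar> < e / 2" for i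
    using g[of i] \<open>e > 0\<close> unfolding continuous_on_iff dist_real_def
    by (metis UNIV_I half_gt_zero)
  then obtain d where d: "\<And>i. d i > 0" "\<And>i y. dist y x < d i \<Longrightarrow> \<bar>g i y - g i x\<bar> < e / 2" by metis
  show "\<exists>d>0. \<forall>y. norm (y - x) < d \<longrightarrow>
      norm (f y - f x - (g 1 x * (y - x) $ 1 + g 2 x * (y - x) $ 2)) \<le> e * norm (y - x)"
  proof (intro exI[of _ "min (d 1) (d 2)"] conjI allI impI)
    show "min (d 1) (d 2) > 0" using d by simp
    fix y assume y: "norm (y - x) < min (d 1) (d 2)"
    define h where "h = y - x"
    \<comment> \<open>The corner \<open>(y$1, x$2)\<close>: the increment is taken along two
      axis-parallel legs, both within distance \<open>norm h\<close> of \<open>x\<close>.\<close>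
    let ?z = "x + h$1 *\<^sub>R axis 1 1"
    have zy: "?z + h$2 *\<^sub>R axis 2 1 = y"
      unfolding h_def by (simp add: coordinate_path[of y x, symmetric])
    have b1: "\<bar>f ?z - f x - g 1 x * h$1\<bar> \<le> e/2 * \<bar>h$1\<bar>"
    proof (rule axis_increment_bound[OF has_pd_DERIV[OF f]])
      fix s assume "\<bar>s\<bar> \<le> \<bar>h$1\<bar>"
      then have "dist (x + s *\<^sub>R axis 1 1) x < d 1"
        using y component_le_norm_cart[of h 1] by (auto simp: dist_norm h_def)
      then show "\<bar>g 1 (x + s *\<^sub>R axis 1 1) - g 1 x\<bar> \<le> e/2" using d(2) by (simp add: less_imp_le)
    qed
    have b2: "\<bar>f (?z + h$2 *\<^sub>R axis 2 1) - f ?z - g 2 x * h$2\<bar> \<le> e/2 * \<bar>h$2\<bar>"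
    proof (rule axis_increment_bound[OF has_pd_DERIV[OF f]])
      fix s assume "\<bar>s\<bar> \<le> \<bar>h$2\<bar>"
      then have "dist (?z + s *\<^sub>R axis 2 1) x < d 2"
        using y dist_axis_path[of s h] by (simp add: dist_norm h_def)
      then show "\<bar>g 2 (?z + s *\<^sub>R axis 2 1) - g 2 x\<bar> \<le> e/2" using d(2) by (simp add: less_imp_le)
    qed
    have b3: "e/2 * \<bar>h$1\<bar> + e/2 * \<bar>h$2\<bar> \<le> e * norm h"
    proof -
      have "e/2 * (\<bar>h$1\<bar> + \<bar>h$2\<bar>) \<le> e/2 * (norm h + norm h)"
        by (intro mult_left_mono add_mono component_le_norm_cart) (use \<open>e > 0\<close> in simp)
      then show ?thesis by (simp only: distrib_left)
    qed
    show "norm (f y - f x - (g 1 x * (y - x) $ 1 + g 2 x * (y - x) $ 2)) \<le> e * norm (y - x)"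
      unfolding h_def[symmetric] real_norm_def
      by (rule abs_le_split[OF b1 b2[unfolded zy] _ b3]) simp
  qed
qed

lemma has_pd_lipschitz:
  assumes f: "\<And>i. has_pd i f (g i)" and g: "\<And>i z. \<bar>g i z\<bar> \<le> C"
  shows "\<bar>f y - f x\<bar> \<le> 2 * C * dist y x"
proof -
  let ?z = "x + (y$1-x$1) *\<^sub>R axis 1 1"
  have C: "C \<ge> 0" using g[of 1 0] by simp
  have "\<bar>f ?z - f x - 0 * (y$1-x$1)\<bar> \<le> C * \<bar>y$1-x$1\<bar>"
    by (rule axis_increment_bound[OF has_pd_DERIV[OF f]]) (use g in auto)
  moreover have "\<bar>f (?z + (y$2-x$2) *\<^sub>R axis 2 1) - f ?z - 0 * (y$2-x$2)\<bar> \<le> C * \<bar>y$2-x$2\<bar>"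
    by (rule axis_increment_bound[OF has_pd_DERIV[OF f]]) (use g in auto)
  moreover have "C * \<bar>y$i-x$i\<bar> \<le> C * dist y x" for i
    using C component_le_norm_cart[of "y - x" i] by (auto intro!: mult_left_mono simp: dist_norm)
  note this[of 1] this[of 2]
  ultimately show ?thesis
    unfolding coordinate_path[of y x, symmetric] by (simp add: mult.assoc)
qed

text \<open>\<open>Jet n X C m f\<close>: \<open>f\<close> is of class C\<open>\<^sup>n\<close> on the plane and its derivatives of order \<open>k \<le> n\<close> are bounded
  by \<open>C m\<^sup>k\<close> on \<open>X\<close>. Smoothness is global even if \<open>X\<close> is a single point.\<close>

primrec Jet :: "nat \<Rightarrow> (real^2) set \<Rightarrow> real \<Rightarrow> real \<Rightarrow> (real^2 \<Rightarrow> real) \<Rightarrow> bool" where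
  "Jet 0 X C m f \<longleftrightarrow> continuous_on UNIV f \<and> (\<forall>x\<in>X. \<bar>f x\<bar> \<le> C)"
| "Jet (Suc n) X C m f \<longleftrightarrow> continuous_on UNIV f \<and> (\<forall>x\<in>X. \<bar>f x\<bar> \<le> C) \<and>
     (\<forall>i. \<exists>g. has_pd i f g \<and> Jet n X (C * m) m g)"

section \<open>Calculus of jet bounds\<close>

lemma Jet_continuous: "Jet n X C m f \<Longrightarrow> continuous_on UNIV f"
  by (cases n) auto

lemma Jet_bound: "Jet n X C m f \<Longrightarrow> x \<in> X \<Longrightarrow> \<bar>f x\<bar> \<le> C"
  by (cases n) auto

lemma Jet_pd:
  assumes "Jet (Suc n) X C m f"
  shows "has_pd i f (pd i f)" "Jet n X (C * m) m (pd i f)"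
  using assms has_pd_imp_pd by (auto, metis+)

lemma Jet_mono:
  "Jet n X C m f \<Longrightarrow> 0 \<le> C \<Longrightarrow> 0 \<le> m \<Longrightarrow> C \<le> C' \<Longrightarrow> m \<le> m' \<Longrightarrow> Jet n X C' m' f"
proof (induction n arbitrary: f C C')
  case 0 then show ?case by force
next
  case (Suc n)
  have "C * m \<le> C' * m'" using Suc.prems by (intro mult_mono) auto
  then show ?case using Suc.prems Suc.IH[of "C * m" _ "C' * m'"] by (simp, metis mult_nonneg_nonneg order_trans)
qed

lemma Jet_Suc_imp: "Jet (Suc n) X C m f \<Longrightarrow> Jet n X C m f"
proof (induction n arbitrary: f C)
  case (Suc n)
  then show ?case by (metis Jet.simps(2))
qed auto

lemma Jet_le: "Jet n X C m f \<Longrightarrow> k \<le> n \<Longrightarrow> Jet k X C m f"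
  by (induction n) (auto simp: le_Suc_eq simp del: Jet.simps dest: Jet_Suc_imp)

lemma Jet_add: "Jet n X C m f \<Longrightarrow> Jet n X C' m g \<Longrightarrow> Jet n X (C + C') m (\<lambda>x. f x + g x)"
proof (induction n arbitrary: f g C C')
  case 0 then show ?case by (force intro: continuous_on_add)
next
  case (Suc n)
  have "\<exists>h. has_pd i (\<lambda>x. f x + g x) h \<and> Jet n X ((C + C') * m) m h" for i
    using has_pd_add Suc.IH Jet_pd[OF Suc.prems(1), of i] Jet_pd[OF Suc.prems(2), of i]
    by (metis distrib_right)
  moreover have "\<forall>x\<in>X. \<bar>f x + g x\<bar> \<le> C + C'"
    using Jet_bound[OF Suc.prems(1)] Jet_bound[OF Suc.prems(2)] by force
  ultimately show ?case using Suc.prems by (auto intro: continuous_on_add)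
qed

lemma Jet_const: "0 \<le> C \<Longrightarrow> 0 \<le> m \<Longrightarrow> \<bar>c\<bar> \<le> C \<Longrightarrow> Jet n X C m (\<lambda>x. c)"
proof (induction n arbitrary: C c)
  case (Suc n)
  have "Jet n X (C * m) m (\<lambda>x. 0)" by (rule Suc.IH) (use Suc.prems in auto)
  then show ?case using Suc.prems has_pd_const by auto
qed auto

text \<open>Leibniz rule: each differentiation splits one product into two, which accounts for
  \<open>2^n\<close>.\<close>

lemma Jet_mult:
  "Jet n X C m f \<Longrightarrow> Jet n X C' m g \<Longrightarrow> 0 \<le> C \<Longrightarrow> 0 \<le> C' \<Longrightarrow> 0 \<le> m \<Longrightarrow>
   Jet n X (2^n * C * C') m (\<lambda>x. f x * g x)"
proof (induction n arbitrary: f g C C')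
  case 0 then show ?case by (auto intro!: continuous_on_mult mult_mono simp: abs_mult)
next
  case (Suc n)
  have "\<exists>h. has_pd i (\<lambda>x. f x * g x) h \<and> Jet n X ((2^Suc n * C * C') * m) m h" for i
  proof (intro exI conjI)
    show "has_pd i (\<lambda>x. f x * g x) (\<lambda>x. pd i f x * g x + f x * pd i g x)"
      by (intro has_pd_mult Jet_pd[OF Suc.prems(1)] Jet_pd[OF Suc.prems(2)])
    have "Jet n X (2^n * (C * m) * C' + 2^n * C * (C' * m)) m (\<lambda>x. pd i f x * g x + f x * pd i g x)"
      by (intro Jet_add Suc.IH Jet_pd[OF Suc.prems(1)] Jet_pd[OF Suc.prems(2)] Jet_Suc_imp[OF Suc.prems(1)]
          Jet_Suc_imp[OF Suc.prems(2)] mult_nonneg_nonneg Suc.prems)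
    then show "Jet n X ((2^Suc n * C * C') * m) m (\<lambda>x. pd i f x * g x + f x * pd i g x)"
      by (simp add: algebra_simps)
  qed
  moreover have "\<bar>f x * g x\<bar> \<le> 2^Suc n * C * C'" if "x \<in> X" for x
  proof -
    have "\<bar>f x * g x\<bar> \<le> C * C'"
      using Jet_bound[OF Suc.prems(1) that] Jet_bound[OF Suc.prems(2) that] Suc.prems
      by (auto simp: abs_mult intro!: mult_mono)
    also have "\<dots> = 1 * (C * C')" by simp
    also have "\<dots> \<le> 2^Suc n * (C * C')"
      by (rule mult_right_mono) (use Suc.prems one_le_power[of "2::real" "Suc n"] in auto)
    finally show ?thesis by (simp add: mult.assoc)
  qed
  ultimately show ?case using Suc.prems by (auto intro: continuous_on_mult)
qed

lemma Jet_cmult: "Jet n X C m f \<Longrightarrow> Jet n X (\<bar>c\<bar> * C) m (\<lambda>x. c * f x)"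
proof (induction n arbitrary: f C)
  case 0 then show ?case by (auto intro!: continuous_intros mult_left_mono simp: abs_mult)
next
  case (Suc n)
  have "\<exists>h. has_pd i (\<lambda>x. c * f x) h \<and> Jet n X (\<bar>c\<bar> * C * m) m h" for i
    using has_pd_cmult Suc.IH Jet_pd[OF Suc.prems, of i] by (metis mult.assoc)
  then show ?case using Suc.prems by (auto intro!: continuous_intros mult_left_mono simp: abs_mult)
qed

lemma Jet_diff: "Jet n X C m f \<Longrightarrow> Jet n X C' m g \<Longrightarrow> Jet n X (C + C') m (\<lambda>x. f x - g x)"
  using Jet_add[of n X C m f C' "\<lambda>x. (-1) * g x"] Jet_cmult[of n X C' m g "-1"] by simp

lemma Jet_shift:
  "Jet n UNIV C m f \<Longrightarrow> Jet n UNIV C m (\<lambda>x. f (x + c))"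
proof (induction n arbitrary: f C)
  case 0 then show ?case by (auto intro!: continuous_on_compose2[of UNIV f] continuous_intros)
next
  case (Suc n)
  then have "\<exists>g. has_pd i (\<lambda>x. f (x + c)) g \<and> Jet n UNIV (C * m) m g" for i
    using has_pd_shift Jet_pd by meson
  then show ?case using Suc.prems by (auto intro!: continuous_on_compose2[of UNIV f] continuous_intros)
qed

text \<open>A frequency too large by the factor \<open>K\<close> is absorbed into the amplitude,
  since a derivative of order k \<le> n costs \<open>K^k\<close>, at most \<open>K^n\<close>. This
  brings jets of different frequencies to a common one.\<close>

lemma Jet_rescale:
  "Jet n X C (K * m) f \<Longrightarrow> 1 \<le> K \<Longrightarrow> 0 \<le> C \<Longrightarrow> 0 \<le> m \<Longrightarrow> Jet n X (K^n * C) m f"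
proof (induction n arbitrary: f C)
  case (Suc n)
  have "\<exists>g. has_pd i f g \<and> Jet n X (K^Suc n * C * m) m g" for i
  proof (intro exI conjI)
    show "has_pd i f (pd i f)" using Jet_pd[OF Suc.prems(1)] by blast
    have "Jet n X (K^n * (C * (K * m))) m (pd i f)"
      by (rule Suc.IH[OF Jet_pd(2)[OF Suc.prems(1)]]) (use Suc.prems in auto)
    then show "Jet n X (K^Suc n * C * m) m (pd i f)" by (simp add: algebra_simps)
  qed
  moreover have "1 * C \<le> K^Suc n * C"
    using Suc.prems one_le_power[of K "Suc n"] by (intro mult_right_mono) auto
  then have "\<forall>x\<in>X. \<bar>f x\<bar> \<le> K^Suc n * C" using Jet_bound[OF Suc.prems(1)] by fastforce
  ultimately show ?case using Suc.prems by auto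
qed auto

text \<open>The phase \<open>c\<close> serves the induction: the derivative is again a sine, shifted
  by pi/2.\<close>

lemma Jet_sin:
  assumes "\<And>i. \<bar>n $ i\<bar> \<le> m" shows "Jet N X \<bar>k\<bar> m (\<lambda>x. k * sin (n \<bullet> x + c))"
proof -
  have cont: "continuous_on UNIV (\<lambda>x. k * sin (n \<bullet> x + c))" for k c
    by (intro continuous_intros)
  have bd: "\<bar>k * sin (n \<bullet> x + c)\<bar> \<le> \<bar>k\<bar>" for k c x
    by (simp add: abs_mult mult_left_le)
  show ?thesis
  proof (induction N arbitrary: k c)
    case 0 show ?case using cont bd by simp
  next
    case (Suc N)
    have m: "m \<ge> 0" using assms[of 1] by simp
    have "\<exists>g. has_pd i (\<lambda>x. k * sin (n \<bullet> x + c)) g \<and> Jet N X (\<bar>k\<bar> * m) m g" for i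
    proof (intro exI conjI)
      show "has_pd i (\<lambda>x. k * sin (n \<bullet> x + c)) (\<lambda>x. (k * n $ i) * sin (n \<bullet> x + (c + pi/2)))"
      proof -
        have "has_pd i (\<lambda>x. k * sin (n \<bullet> x + c)) (\<lambda>x. k * (cos (n \<bullet> x + c) * n $ i))"
          by (intro has_pd_cmult has_pd_compose[OF has_pd_inner, where F = "\<lambda>t. sin (t + c)"])
             (auto intro!: derivative_eq_intros)
        moreover have "sin (n \<bullet> x + (c + pi/2)) = cos (n \<bullet> x + c)" for x
          by (simp add: add.assoc[symmetric] sin_add)
        ultimately show ?thesis by (simp add: algebra_simps)
      qed
      show "Jet N X (\<bar>k\<bar> * m) m (\<lambda>x. (k * n $ i) * sin (n \<bullet> x + (c + pi/2)))"
        by (rule Jet_mono[OF Suc.IH]) (use m assms in \<open>simp_all add: abs_mult mult_left_mono\<close>)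
    qed
    then show ?case using cont bd by simp
  qed
qed

text \<open>The constant precedes \<open>m\<close> and \<open>f\<close>: it depends on
  \<open>n\<close>, \<open>r\<close>, \<open>lo\<close>, \<open>hi\<close> and \<open>G\<close>
  alone. The induction runs over all exponents because the derivative of \<open>f powr r\<close>
  involves \<open>f powr (r - 1)\<close>; \<open>lo\<close> controls the negative ones.\<close>

lemma Jet_powr:
  assumes "0 < lo" "0 \<le> G"
  shows "\<exists>C\<ge>0. \<forall>m f. 0 \<le> m \<longrightarrow> (\<forall>x. lo \<le> f x \<and> f x \<le> hi) \<longrightarrow> Jet n UNIV G m f \<longrightarrow>
           Jet n UNIV C m (\<lambda>x. f x powr r)"
proof -
  have bd: "\<bar>f x powr r\<bar> \<le> lo powr r + hi powr r" if "\<forall>x. lo \<le> f x \<and> f x \<le> hi" for f :: "real^2 \<Rightarrow> real" and x r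
  proof (cases "r \<ge> 0")
    case True
    then have "f x powr r \<le> hi powr r" using that assms by (intro powr_mono2) (auto intro: less_imp_le order_trans)
    then show ?thesis by (simp add: add_increasing)
  next
    case False
    then have "f x powr r \<le> lo powr r" using that assms by (intro powr_mono2') auto
    then show ?thesis by (simp add: add_increasing2)
  qed
  have cont: "continuous_on UNIV (\<lambda>x. f x powr r)" if "\<forall>x. lo \<le> f x \<and> f x \<le> hi" "continuous_on UNIV f"
    for f :: "real^2 \<Rightarrow> real" and r
    using that assms by (intro continuous_on_powr) (auto intro: continuous_on_const, metis not_less)
  show ?thesis
  proof (induction n arbitrary: r)
    case 0
    show ?case using bd cont by (intro exI[of _ "lo powr r + hi powr r"]) auto
  next
    case (Suc n)
    obtain C where C: "C \<ge> 0" "\<And>m f. 0 \<le> m \<Longrightarrow> \<forall>x. lo \<le> f x \<and> f x \<le> hi \<Longrightarrow> Jet n UNIV G m f \<Longrightarrow>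
        Jet n UNIV C m (\<lambda>x. f x powr (r - 1))" using Suc.IH by metis
    let ?C = "max (lo powr r + hi powr r) (\<bar>r\<bar> * (2^n * C * G))"
    show ?case
    proof (intro exI[of _ ?C] conjI allI impI)
      show "0 \<le> ?C" by (simp add: le_max_iff_disj)
      fix m :: real and f :: "real^2 \<Rightarrow> real"
      assume m: "0 \<le> m" and f: "\<forall>x. lo \<le> f x \<and> f x \<le> hi" and J: "Jet (Suc n) UNIV G m f"
      have "\<exists>g. has_pd i (\<lambda>x. f x powr r) g \<and> Jet n UNIV (?C * m) m g" for i
      proof (intro exI conjI)
        have "f x > 0" for x using f assms(1) by (metis less_le_trans)
        then show "has_pd i (\<lambda>x. f x powr r) (\<lambda>x. r * f x powr (r - 1) * pd i f x)"
          by (intro has_pd_compose Jet_pd[OF J] has_real_derivative_powr) auto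
        have "Jet n UNIV (\<bar>r\<bar> * (2^n * C * (G * m))) m (\<lambda>x. r * (f x powr (r - 1) * pd i f x))"
          by (intro Jet_cmult Jet_mult Jet_pd[OF J] C Jet_Suc_imp[OF J] f m mult_nonneg_nonneg assms)
        moreover have "\<bar>r\<bar> * (2^n * C * (G * m)) \<le> ?C * m"
          using m by (simp add: mult.assoc[symmetric] mult_right_mono)
        ultimately show "Jet n UNIV (?C * m) m (\<lambda>x. r * f x powr (r - 1) * pd i f x)"
          using Jet_mono[OF _ _ m] C assms m by (simp add: mult.assoc)
      qed
      then show "Jet (Suc n) UNIV ?C m (\<lambda>x. f x powr r)"
        using bd[OF f, of _ r] cont[OF f Jet_continuous[OF J], of r] by (auto simp: le_max_iff_disj)
    qed
  qed
qed

section \<open>Mollification by iterated box averages\<close>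

text \<open>Averaging over a segment gains one derivative in its direction by the fundamental theorem of
  calculus, which makes a smooth convolution kernel unnecessary.\<close>

definition avg :: "2 \<Rightarrow> real \<Rightarrow> (real^2 \<Rightarrow> real) \<Rightarrow> real^2 \<Rightarrow> real" where
  "avg i l f x = integral {-l..l} (\<lambda>t. f (x + t *\<^sub>R axis i 1)) / (2 * l)"

lemma continuous_on_line:
  "continuous_on UNIV f \<Longrightarrow> continuous_on S (\<lambda>t. f (x + t *\<^sub>R axis i 1 :: real^2) :: real)"
  by (rule continuous_on_compose2[of UNIV f]) (auto intro!: continuous_on_add continuous_on_const
      continuous_on_scaleR continuous_on_id)

lemma integrable_line:
  "continuous_on UNIV f \<Longrightarrow> (\<lambda>t. f (x + t *\<^sub>R axis i 1 :: real^2) :: real) integrable_on {-l..l}"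
  by (intro integrable_continuous_interval continuous_on_line)

lemma continuous_on_avg:
  assumes "continuous_on UNIV f" shows "continuous_on UNIV (avg i l f)"
proof -
  have "continuous_on UNIV (\<lambda>x. integral (cbox (-l) l) (\<lambda>t. f (x + t *\<^sub>R axis i 1)))"
    by (rule integral_continuous_on_param)
       (auto simp: split_beta intro!: continuous_on_compose2[OF assms] continuous_on_add
          continuous_on_scaleR continuous_on_fst continuous_on_snd continuous_on_id continuous_on_const)
  then show ?thesis
    unfolding avg_def[abs_def] divide_inverse cbox_interval by (rule continuous_on_mult_right)
qed

lemma avg_add:
  "continuous_on UNIV f \<Longrightarrow> continuous_on UNIV g \<Longrightarrow> avg i l (\<lambda>x. f x + g x) = (\<lambda>x. avg i l f x + avg i l g x)"
  by (simp add: avg_def integral_add integrable_line add_divide_distrib fun_eq_iff)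

lemma avg_cmult: "avg i l (\<lambda>x. c * f x) = (\<lambda>x. c * avg i l f x)"
  by (simp add: avg_def fun_eq_iff)

lemma avg_const: "0 < l \<Longrightarrow> avg i l (\<lambda>x. c) = (\<lambda>x. c)"
  by (simp add: avg_def fun_eq_iff)

lemma avg_shift: "avg i l (\<lambda>x. f (x + c)) = (\<lambda>x. avg i l f (x + c))"
  by (simp add: avg_def fun_eq_iff add.assoc add.commute[of c])

lemma avg_bound:
  assumes "0 < l" "continuous_on UNIV f" "\<And>t. \<bar>t\<bar> \<le> l \<Longrightarrow> \<bar>f (x + t *\<^sub>R axis i 1)\<bar> \<le> C"
  shows "\<bar>avg i l f x\<bar> \<le> C"
proof -
  have "norm (integral {-l..l} (\<lambda>t. f (x + t *\<^sub>R axis i 1))) \<le> C * (l - - l)"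
    by (rule integral_bound) (use assms in \<open>auto intro: continuous_on_line\<close>)
  then show ?thesis using assms(1) by (simp add: avg_def field_simps)
qed

lemma has_pd_avg:
  assumes "continuous_on UNIV f" "continuous_on UNIV g" "has_pd j f g"
  shows "has_pd j (avg i l f) (avg i l g)"
  unfolding has_pd_def
proof
  fix x
  have "((\<lambda>s. integral (cbox (-l) l) (\<lambda>t. f (x + s *\<^sub>R axis j 1 + t *\<^sub>R axis i 1))) has_real_derivative
        integral (cbox (-l) l) (\<lambda>t. g (x + 0 *\<^sub>R axis j 1 + t *\<^sub>R axis i 1))) (at 0 within UNIV)"
  proof (rule leibniz_rule_field_derivative)
    fix s t :: real
    show "((\<lambda>s. f (x + s *\<^sub>R axis j 1 + t *\<^sub>R axis i 1)) has_real_derivative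
        g (x + s *\<^sub>R axis j 1 + t *\<^sub>R axis i 1)) (at s within UNIV)"
      using has_pd_DERIV[OF assms(3), of "x + t *\<^sub>R axis i 1" s] by (simp add: add_ac)
    show "(\<lambda>t. f (x + s *\<^sub>R axis j 1 + t *\<^sub>R axis i 1)) integrable_on cbox (-l) l"
      using integrable_line[OF assms(1)] by (simp add: cbox_interval)
  next
    show "continuous_on (UNIV \<times> cbox (-l) l) (\<lambda>(s, t). g (x + s *\<^sub>R axis j 1 + t *\<^sub>R axis i 1))"
      by (auto simp: split_beta intro!: continuous_on_compose2[OF assms(2)] continuous_on_add
          continuous_on_scaleR continuous_on_fst continuous_on_snd continuous_on_id continuous_on_const)
  qed auto
  from DERIV_cdivide[OF this, of "2 * l"]
  show "((\<lambda>s. avg i l f (x + s *\<^sub>R axis j 1)) has_real_derivative avg i l g x) (at 0)"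
    by (simp add: avg_def cbox_interval)
qed

lemma has_pd_avg_same:
  assumes f: "continuous_on UNIV f" and l: "0 < l"
  shows "has_pd i (avg i l f) (\<lambda>x. (f (x + l *\<^sub>R axis i 1) - f (x - l *\<^sub>R axis i 1)) / (2 * l))"
  unfolding has_pd_def
proof
  fix x
  define h where "h = (\<lambda>t. f (x + t *\<^sub>R axis i 1))"
  \<comment> \<open>The base point leaves a unit margin: \<open>F\<close> is differentiable at
    \<open>t + s\<close> for all \<open>t\<close> in [-l, l], endpoints included, as long as |s| <
    1.\<close>
  define F where "F = (\<lambda>u. integral {-l-1..u} h)"
  have F: "(F has_real_derivative h t) (at t)" if "-l-1 < t" "t < l+1" for t
  proof -
    have "(F has_real_derivative h t) (at t within {-l-1..l+1})"
      unfolding F_def by (rule integral_has_real_derivative) (use that f in \<open>auto simp: h_def intro: continuous_on_line\<close>)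
    then show ?thesis using that by (simp add: at_within_Icc_at)
  qed
  have eq: "avg i l f (x + s *\<^sub>R axis i 1) = (F (l + s) - F (- l + s)) / (2 * l)" if "\<bar>s\<bar> < 1" for s
  proof -
    have "((\<lambda>t. h (t + s)) has_integral (F (l + s) - F (- l + s))) {-l..l}"
    proof (rule fundamental_theorem_of_calculus)
      fix t assume t: "t \<in> {-l..l}"
      have "((\<lambda>t. F (t + s)) has_real_derivative h (t + s)) (at t)"
        using F[of "t + s"] that t by (subst DERIV_shift[symmetric]) auto
      then show "((\<lambda>t. F (t + s)) has_vector_derivative h (t + s)) (at t within {-l..l})"
        by (simp add: has_real_derivative_iff_has_vector_derivative has_vector_derivative_at_within)
    qed (use l in auto)
    moreover have "h (t + s) = f (x + s *\<^sub>R axis i 1 + t *\<^sub>R axis i 1)" for t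
      by (simp add: h_def algebra_simps)
    ultimately show ?thesis by (simp add: avg_def integral_unique)
  qed
  have "((\<lambda>s. (F (l + s) - F (- l + s)) / (2 * l)) has_real_derivative (h l - h (-l)) / (2 * l)) (at 0)"
  proof (intro DERIV_cdivide DERIV_diff)
    show "((\<lambda>s. F (l + s)) has_real_derivative h l) (at 0)"
      using F[of l] l DERIV_shift[of F "h l" 0 l] by (simp add: add.commute)
    show "((\<lambda>s. F (-l + s)) has_real_derivative h (-l)) (at 0)"
      using F[of "-l"] l DERIV_shift[of F "h (-l)" 0 "-l"] by (simp add: add.commute)
  qed
  then have "((\<lambda>s. avg i l f (x + s *\<^sub>R axis i 1)) has_real_derivative (h l - h (-l)) / (2 * l)) (at 0)"
    by (rule has_field_derivative_transform_within_open[of _ _ _ "{-1<..<1}"]) (use eq in auto)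
  then show "((\<lambda>s. avg i l f (x + s *\<^sub>R axis i 1)) has_real_derivative
      (f (x + l *\<^sub>R axis i 1) - f (x - l *\<^sub>R axis i 1)) / (2 * l)) (at 0)"
    by (simp add: h_def)
qed

text \<open>Sup-norm balls are the domains of dependence of box averages, and their radii add under
  iteration.\<close>

definition cube :: "real^2 \<Rightarrow> real \<Rightarrow> (real^2) set" where
  "cube x r = {y. \<forall>i. \<bar>y $ i - x $ i\<bar> \<le> r}"

lemma cube_trans: "y \<in> cube x r \<Longrightarrow> z \<in> cube y s \<Longrightarrow> z \<in> cube x (r + s)"
  unfolding cube_def by (smt (verit, best) mem_Collect_eq)

lemma cube_refl: "0 \<le> r \<Longrightarrow> x \<in> cube x r"
  by (simp add: cube_def)

lemma cube_dist: "y \<in> cube x r \<Longrightarrow> dist y x \<le> 2 * r"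
  using norm_le_l1_cart[of "y - x"] unfolding cube_def dist_norm
  by (simp add: sum_2 forall_2)

definition avg2 :: "real \<Rightarrow> (real^2 \<Rightarrow> real) \<Rightarrow> real^2 \<Rightarrow> real" where
  "avg2 l f = avg 1 l (avg 2 l f)"

lemma continuous_on_avg2: "continuous_on UNIV f \<Longrightarrow> continuous_on UNIV (avg2 l f)"
  by (simp add: avg2_def continuous_on_avg)

lemma axis2_in_cube: "\<bar>t\<bar> \<le> r \<Longrightarrow> \<bar>s\<bar> \<le> r \<Longrightarrow> x + t *\<^sub>R axis 1 1 + s *\<^sub>R axis 2 1 \<in> cube x r"
  by (auto simp: cube_def axis_def forall_2)

lemma avg2_bound:
  assumes "0 < l" "continuous_on UNIV f" "\<And>y. y \<in> cube x l \<Longrightarrow> \<bar>f y\<bar> \<le> C"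
  shows "\<bar>avg2 l f x\<bar> \<le> C"
  unfolding avg2_def
  by (intro avg_bound continuous_on_avg assms axis2_in_cube)

text \<open>The average in direction \<open>i\<close> becomes a difference quotient of size at most
  \<open>2 * C / (2 * l)\<close>. Direction 1 belongs to the outer average and direction 2 to the
  inner one, hence the case split. \<open>g\<close> is chosen before \<open>x\<close> and
  \<open>C\<close>, so that a single derivative obeys a local bound at every point.\<close>

lemma has_pd_avg2_smooth:
  assumes l: "0 < l" and f: "continuous_on UNIV f"
  shows "\<exists>g. has_pd i (avg2 l f) g \<and> continuous_on UNIV g \<and>
     (\<forall>x C. (\<forall>y\<in>cube x l. \<bar>f y\<bar> \<le> C) \<longrightarrow> \<bar>g x\<bar> \<le> C * (1 / l))"
proof -
  have half: "\<bar>(a - b) / (2 * l)\<bar> \<le> C * (1 / l)" if "\<bar>a\<bar> \<le> C" "\<bar>b\<bar> \<le> C" for a b C :: real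
  proof -
    have "\<bar>a - b\<bar> \<le> 2 * C" using that by linarith
    then show ?thesis using l by (simp add: abs_mult divide_simps mult.commute)
  qed
  have shift: "continuous_on UNIV (\<lambda>x. (h (x + l *\<^sub>R axis k 1) - h (x - l *\<^sub>R axis k 1)) / (2 * l))"
    if "continuous_on UNIV h" for h :: "real^2 \<Rightarrow> real" and k
    unfolding divide_inverse
    by (intro continuous_on_mult_right continuous_on_diff continuous_on_compose2[OF that]
        continuous_on_add continuous_on_id continuous_on_const) auto
  consider "i = 1" | "i = 2" using exhaust_2 by blast
  then show ?thesis
  proof cases
    case 1
    let ?g = "\<lambda>x. (avg 2 l f (x + l *\<^sub>R axis 1 1) - avg 2 l f (x - l *\<^sub>R axis 1 1)) / (2 * l)"
    have "\<bar>?g x\<bar> \<le> C * (1 / l)" if C: "\<forall>y\<in>cube x l. \<bar>f y\<bar> \<le> C" for x C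
    proof (rule half)
      show "\<bar>avg 2 l f (x + l *\<^sub>R axis 1 1)\<bar> \<le> C"
        by (intro avg_bound l f C[rule_format] axis2_in_cube) (use l in auto)
      show "\<bar>avg 2 l f (x - l *\<^sub>R axis 1 1)\<bar> \<le> C"
        using axis2_in_cube[of "-l" l _ x] l by (intro avg_bound l f C[rule_format]) auto
    qed
    then show ?thesis
      unfolding 1 avg2_def
      by (intro exI[of _ ?g] conjI has_pd_avg_same shift continuous_on_avg f l) auto
  next
    case 2
    let ?d = "\<lambda>x. (f (x + l *\<^sub>R axis 2 1) - f (x - l *\<^sub>R axis 2 1)) / (2 * l)"
    have "\<bar>avg 1 l ?d x\<bar> \<le> C * (1 / l)" if C: "\<forall>y\<in>cube x l. \<bar>f y\<bar> \<le> C" for x C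
    proof (intro avg_bound l shift f half C[rule_format])
      fix t assume "\<bar>t\<bar> \<le> l"
      then show "x + t *\<^sub>R axis 1 1 + l *\<^sub>R axis 2 1 \<in> cube x l"
        "x + t *\<^sub>R axis 1 1 - l *\<^sub>R axis 2 1 \<in> cube x l"
        using axis2_in_cube[of t l l x] axis2_in_cube[of t l "-l" x] l by auto
    qed
    then show ?thesis
      unfolding 2 avg2_def
      by (intro exI[of _ "avg 1 l ?d"] conjI has_pd_avg has_pd_avg_same shift continuous_on_avg f l) auto
  qed
qed

text \<open>Convolution with a spline kernel supported in a cube of radius \<open>n * l\<close>;
  \<open>n\<close> is also the number of derivatives gained.\<close>

definition mol :: "nat \<Rightarrow> real \<Rightarrow> (real^2 \<Rightarrow> real) \<Rightarrow> real^2 \<Rightarrow> real" where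
  "mol n l f = (avg2 l ^^ n) f"

lemma mol_0: "mol 0 l f = f"
  by (simp add: mol_def)

lemma mol_Suc: "mol (Suc n) l f = mol n l (avg2 l f)"
  by (simp add: mol_def funpow_swap1)

lemma continuous_on_mol: "continuous_on UNIV f \<Longrightarrow> continuous_on UNIV (mol n l f)"
  by (induction n arbitrary: f) (auto simp: mol_0 mol_Suc continuous_on_avg2)

lemma has_pd_mol:
  "continuous_on UNIV f \<Longrightarrow> continuous_on UNIV g \<Longrightarrow> has_pd j f g \<Longrightarrow> has_pd j (mol n l f) (mol n l g)"
  by (induction n arbitrary: f g)
     (auto simp: mol_0 mol_Suc avg2_def has_pd_avg continuous_on_avg)

lemma mol_add:
  "continuous_on UNIV f \<Longrightarrow> continuous_on UNIV g \<Longrightarrow>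
   mol n l (\<lambda>x. f x + g x) = (\<lambda>x. mol n l f x + mol n l g x)"
proof (induction n arbitrary: f g)
  case (Suc n)
  have "avg2 l (\<lambda>x. f x + g x) = (\<lambda>x. avg2 l f x + avg2 l g x)"
    unfolding avg2_def using Suc.prems by (simp add: avg_add continuous_on_avg)
  then show ?case using Suc continuous_on_avg2 by (simp add: mol_Suc)
qed (simp add: mol_0)

lemma mol_cmult: "mol n l (\<lambda>x. c * f x) = (\<lambda>x. c * mol n l f x)"
proof (induction n arbitrary: f)
  case (Suc n)
  have "avg2 l (\<lambda>x. c * f x) = (\<lambda>x. c * avg2 l f x)"
    unfolding avg2_def by (simp add: avg_cmult)
  then show ?case using Suc by (simp add: mol_Suc)
qed (simp add: mol_0)

lemma mol_const: "0 < l \<Longrightarrow> mol n l (\<lambda>x. c) = (\<lambda>x. c)"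
  by (induction n) (simp_all add: mol_0 mol_Suc avg2_def avg_const)

lemma mol_diff:
  "continuous_on UNIV f \<Longrightarrow> continuous_on UNIV g \<Longrightarrow>
   mol n l (\<lambda>x. f x - g x) = (\<lambda>x. mol n l f x - mol n l g x)"
  using mol_add[of f "\<lambda>x. (-1) * g x" n l] mol_cmult[of n l "-1" g]
  by (simp add: continuous_on_minus)

lemma mol_shift: "mol n l (\<lambda>x. f (x + c)) = (\<lambda>x. mol n l f (x + c))"
proof (induction n arbitrary: f)
  case (Suc n)
  have "avg2 l (\<lambda>x. f (x + c)) = (\<lambda>x. avg2 l f (x + c))"
    unfolding avg2_def by (simp add: avg_shift)
  then show ?case using Suc by (simp add: mol_Suc)
qed (simp add: mol_0)

lemma mol_bound:
  assumes "0 < l"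
  shows "continuous_on UNIV f \<Longrightarrow> (\<And>y. y \<in> cube x (real n * l) \<Longrightarrow> \<bar>f y\<bar> \<le> C) \<Longrightarrow> \<bar>mol n l f x\<bar> \<le> C"
proof (induction n arbitrary: f)
  case 0 then show ?case by (simp add: mol_0 cube_refl)
next
  case (Suc n)
  show ?case unfolding mol_Suc
  proof (rule Suc.IH)
    show "continuous_on UNIV (avg2 l f)" using Suc.prems continuous_on_avg2 by blast
    fix y assume "y \<in> cube x (real n * l)"
    then show "\<bar>avg2 l f y\<bar> \<le> C"
      using Suc.prems assms cube_trans[of y x "real n * l" _ l]
      by (intro avg2_bound) (auto simp: algebra_simps)
  qed
qed

lemma mol_approx:
  assumes "0 < l" "continuous_on UNIV f" "\<And>y. y \<in> cube x (real n * l) \<Longrightarrow> \<bar>f y - c\<bar> \<le> C"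
  shows "\<bar>mol n l f x - c\<bar> \<le> C"
proof -
  have "\<bar>mol n l (\<lambda>y. f y - c) x\<bar> \<le> C"
    by (rule mol_bound) (use assms in \<open>auto intro: continuous_on_diff\<close>)
  then show ?thesis using assms by (simp add: mol_diff mol_const)
qed

text \<open>Each of the \<open>n\<close> averages pays for one derivative, at the price
  \<open>1 / l\<close>. The bound on \<open>X\<close> reads \<open>f\<close> only on cubes around
  \<open>X\<close>; for a single point this allows an \<open>f\<close> normalised at that
  point.\<close>

lemma Jet_mol:
  assumes "0 < l"
  shows "continuous_on UNIV f \<Longrightarrow> (\<And>x y. x \<in> X \<Longrightarrow> y \<in> cube x (real n * l) \<Longrightarrow> \<bar>f y\<bar> \<le> C) \<Longrightarrow>
    Jet n X C (1 / l) (mol n l f)"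
proof (induction n arbitrary: f C)
  case 0 then show ?case by (simp add: mol_0 cube_refl)
next
  case (Suc n)
  have "\<exists>g. has_pd i (mol (Suc n) l f) g \<and> Jet n X (C * (1 / l)) (1 / l) g" for i
  proof -
    obtain g where g: "has_pd i (avg2 l f) g" "continuous_on UNIV g"
      "\<And>x C. (\<forall>y\<in>cube x l. \<bar>f y\<bar> \<le> C) \<Longrightarrow> \<bar>g x\<bar> \<le> C * (1 / l)"
      using has_pd_avg2_smooth[OF assms Suc.prems(1), of i] by metis
    have "Jet n X (C * (1 / l)) (1 / l) (mol n l g)"
    proof (rule Suc.IH[OF g(2)])
      fix x y assume "x \<in> X" "y \<in> cube x (real n * l)"
      then show "\<bar>g y\<bar> \<le> C * (1 / l)"
        using Suc.prems(2)[of x] cube_trans[of y x "real n * l" _ l]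
        by (intro g(3)) (auto simp: algebra_simps)
    qed
    moreover have "has_pd i (mol (Suc n) l f) (mol n l g)"
      unfolding mol_Suc by (intro has_pd_mol continuous_on_avg2 Suc.prems g)
    ultimately show ?thesis by blast
  qed
  moreover have "\<bar>mol (Suc n) l f x\<bar> \<le> C" if "x \<in> X" for x
    using mol_bound[OF assms Suc.prems(1)] Suc.prems(2) that by blast
  ultimately show ?case using continuous_on_mol[OF Suc.prems(1), of "Suc n" l] by simp
qed

text \<open>The bounds in a jet are pointwise, so each point may have its own proof of them. The
  global smoothness comes from any one point, hence \<open>X\<close> is nonempty.\<close>

lemma Jet_pointwise: "(\<And>x. x \<in> X \<Longrightarrow> Jet n {x} C m f) \<Longrightarrow> X \<noteq> {} \<Longrightarrow> Jet n X C m f"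
proof (induction n arbitrary: f C)
  case (Suc n)
  have "has_pd i f (pd i f) \<and> Jet n X (C * m) m (pd i f)" for i
    using Suc Jet_pd by (metis ex_in_conv)
  then show ?case using Suc.prems by (metis Jet.simps(2) all_not_in_conv insertI1)
qed auto

text \<open>The left-hand side does not change when constants are subtracted from \<open>f\<close> and \<open>g\<close>; at a point \<open>z\<close>
  one subtracts \<open>f z\<close> and \<open>g z\<close>, and both factors become small near \<open>z\<close>.\<close>

lemma mol_commutator:
  assumes l: "0 < l" and f: "continuous_on UNIV f" and g: "continuous_on UNIV g"
    and a: "\<And>x y. y \<in> cube x (real n * l) \<Longrightarrow> \<bar>f y - f x\<bar> \<le> a"
    and b: "\<And>x y. y \<in> cube x (real n * l) \<Longrightarrow> \<bar>g y - g x\<bar> \<le> b"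
  shows "Jet n UNIV ((1 + 2^n) * (a * b)) (1 / l) (\<lambda>x. mol n l (\<lambda>y. f y * g y) x - mol n l f x * mol n l g x)"
proof (rule Jet_pointwise)
  fix z
  have ab: "a \<ge> 0" "b \<ge> 0" using a[of 0 0] b[of 0 0] l by (auto simp: cube_refl)
  define f' where "f' = (\<lambda>y. f y - f z)"
  define g' where "g' = (\<lambda>y. g y - g z)"
  have c: "continuous_on UNIV f'" "continuous_on UNIV g'"
    unfolding f'_def g'_def by (intro continuous_on_diff f g continuous_on_const)+
  have J: "Jet n {z} a (1 / l) (mol n l f')" "Jet n {z} b (1 / l) (mol n l g')"
    using a b by (auto intro!: Jet_mol[OF l] c) (auto simp: f'_def g'_def)
  have J1: "Jet n {z} (a * b) (1 / l) (mol n l (\<lambda>y. f' y * g' y))"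
    using a b ab by (intro Jet_mol l continuous_on_mult c) (auto simp: f'_def g'_def abs_mult intro!: mult_mono)
  have "Jet n {z} (a * b + 2^n * a * b) (1 / l) (\<lambda>x. mol n l (\<lambda>y. f' y * g' y) x - mol n l f' x * mol n l g' x)"
    by (intro Jet_diff J1 Jet_mult J ab) (use l in auto)
  moreover have "mol n l (\<lambda>y. f' y * g' y) = (\<lambda>x. mol n l (\<lambda>y. f y * g y) x - f z * mol n l g x - g z * mol n l f x + f z * g z)"
  proof -
    have "(\<lambda>y. f' y * g' y) = (\<lambda>y. (f y * g y - f z * g y - g z * f y) + f z * g z)"
      by (auto simp: f'_def g'_def algebra_simps)
    moreover have "continuous_on UNIV (\<lambda>y. f y * g y)" "continuous_on UNIV (\<lambda>y. f z * g y)"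
      "continuous_on UNIV (\<lambda>y. g z * f y)"
      by (intro continuous_on_mult f g continuous_on_const)+
    ultimately show ?thesis
      by (simp add: mol_add mol_diff mol_cmult mol_const[OF l] continuous_on_diff)
  qed
  moreover have "mol n l f' = (\<lambda>x. mol n l f x - f z)" "mol n l g' = (\<lambda>x. mol n l g x - g z)"
    unfolding f'_def g'_def using f g by (simp_all add: mol_diff mol_const[OF l])
  ultimately show "Jet n {z} ((1 + 2^n) * (a * b)) (1 / l) (\<lambda>x. mol n l (\<lambda>y. f y * g y) x - mol n l f x * mol n l g x)"
    by (simp add: algebra_simps)
qed simp

text \<open>The expansion of \<open>f\<close> is averaged before \<open>h\<close> tends to 0. So the
  derivative of the mollification is controlled by increments of \<open>f\<close> near
  \<open>x\<close> only, which matters where \<open>f\<close> is a merely continuous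
  extension.\<close>

lemma pd_mol_approx:
  assumes l: "0 < l" and f: "continuous_on UNIV f" and "0 < h0"
    and q: "\<And>y h. y \<in> cube x (real n * l) \<Longrightarrow> \<bar>h\<bar> \<le> h0 \<Longrightarrow> \<bar>f (y + h *\<^sub>R axis j 1) - f y - c * h\<bar> \<le> \<eta> * \<bar>h\<bar>"
    and pd: "has_pd j (mol n l f) g"
  shows "\<bar>g x - c\<bar> \<le> \<eta>"
proof -
  have "((\<lambda>h. (mol n l f (x + h *\<^sub>R axis j 1) - mol n l f x) / h) \<longlongrightarrow> g x) (at 0)"
    using pd unfolding has_pd_def DERIV_def by simp
  then have "((\<lambda>h. \<bar>(mol n l f (x + h *\<^sub>R axis j 1) - mol n l f x) / h - c\<bar>) \<longlongrightarrow> \<bar>g x - c\<bar>) (at 0)"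
    by (intro tendsto_rabs tendsto_diff tendsto_const)
  moreover have "\<forall>\<^sub>F h in at 0. \<bar>(mol n l f (x + h *\<^sub>R axis j 1) - mol n l f x) / h - c\<bar> \<le> \<eta>"
    unfolding eventually_at
  proof (intro exI[of _ h0] conjI ballI impI)
    fix h :: real assume h: "h \<noteq> 0 \<and> dist h 0 < h0"
    let ?d = "\<lambda>y. f (y + h *\<^sub>R axis j 1) - f y - c * h"
    have c: "continuous_on UNIV (\<lambda>y. f (y + h *\<^sub>R axis j 1))"
      by (intro continuous_on_compose2[OF f] continuous_on_add continuous_on_id continuous_on_const) auto
    have "\<bar>mol n l ?d x\<bar> \<le> \<eta> * \<bar>h\<bar>"
      using h q by (intro mol_bound l continuous_on_diff c f continuous_on_const) auto
    also have "mol n l ?d x = mol n l f (x + h *\<^sub>R axis j 1) - mol n l f x - c * h"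
      using c f by (simp add: mol_diff mol_const[OF l] mol_shift continuous_on_diff)
    finally have *: "\<bar>mol n l f (x + h *\<^sub>R axis j 1) - mol n l f x - c * h\<bar> \<le> \<eta> * \<bar>h\<bar>" .
    have "(mol n l f (x + h *\<^sub>R axis j 1) - mol n l f x) / h - c = (mol n l f (x + h *\<^sub>R axis j 1) - mol n l f x - c * h) / h"
      using h by (simp add: diff_divide_distrib)
    then show "\<bar>(mol n l f (x + h *\<^sub>R axis j 1) - mol n l f x) / h - c\<bar> \<le> \<eta>"
      using * h by (simp add: abs_divide pos_divide_le_eq)
  qed (fact \<open>0 < h0\<close>)
  ultimately show ?thesis by (rule tendsto_upperbound) simp
qed

section \<open>One corrugation\<close>

text \<open>Entry \<open>(i, j)\<close> of twice the von Karman stretching with out-of-plane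
  displacement \<open>v\<close> and in-plane displacement \<open>w\<close>. Entries are kept as
  scalar fields so that jets and mollification apply to each.\<close>

definition strain :: "(real^2 \<Rightarrow> real) \<Rightarrow> (2 \<Rightarrow> real^2 \<Rightarrow> real) \<Rightarrow> 2 \<Rightarrow> 2 \<Rightarrow> real^2 \<Rightarrow> real" where
  "strain v w i j x = pd i (w j) x + pd j (w i) x + pd i v x * pd j v x"

text \<open>The terms free of derivatives of the amplitude carry the factor
  \<open>2 * Co^2 - (Co^2 - S^2) - 1\<close>, which vanishes; the coefficients sqrt 2 (here
  \<open>s\<close>) and 1/4 are chosen for this. Every surviving term contains a derivative of the
  amplitude and a power of 1/L.\<close>

lemma corrugation_identity:
  fixes S Co a ai aj ni nj s L :: real
  assumes "S^2 + Co^2 = 1" "s^2 = 2" "L \<noteq> 0"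
  shows "(ai * (s / L * S) + a * (s / L * (Co * (L * ni)))) * (aj * (s / L * S) + a * (s / L * (Co * (L * nj))))
      + nj * ((ai * a + a * ai) * (- 1 / (4 * L) * (2 * S * Co)) + (a * a) * (- 1 / (4 * L) * ((Co^2 - S^2) * (2 * L * ni))))
      + ni * ((aj * a + a * aj) * (- 1 / (4 * L) * (2 * S * Co)) + (a * a) * (- 1 / (4 * L) * ((Co^2 - S^2) * (2 * L * nj))))
      - a^2 * ni * nj
    = 2 / L^2 * ai * aj * S^2 + 1 / L * a * S * Co * (nj * ai + ni * aj)" (is "?l = ?r")
proof -
  have 1: "L * (s / L * y) = s * y" "L * (- 1 / (4 * L) * y) = - y / 4" for y
    using assms(3) by (simp_all add: field_simps)
  have "L^2 * ?l = s^2 * (ai * S + a * (Co * (L * ni))) * (aj * S + a * (Co * (L * nj)))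
      - L * nj * (2 * a * ai * (2 * S * Co) + a^2 * (Co^2 - S^2) * (2 * L * ni)) / 4
      - L * ni * (2 * a * aj * (2 * S * Co) + a^2 * (Co^2 - S^2) * (2 * L * nj)) / 4 - L^2 * a^2 * ni * nj"
    using assms(3) by (simp add: field_simps power2_eq_square)
  also have "\<dots> = 2 * ai * aj * S^2 + L * a * S * Co * (nj * ai + ni * aj)
      + L^2 * a^2 * ni * nj * (2 * Co^2 - (Co^2 - S^2) - 1)"
    unfolding assms(2) by (simp add: field_simps power2_eq_square)
  also have "2 * Co^2 - (Co^2 - S^2) - 1 = 0" using assms(1) by simp
  also have "2 * ai * aj * S^2 + L * a * S * Co * (nj * ai + ni * aj) + L^2 * a^2 * ni * nj * 0 = L^2 * ?r"
    using assms(3) by (simp add: field_simps power2_eq_square)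
  finally show ?thesis using assms(3) by simp
qed

lemma abs_le_split3:
  fixes X Y Z :: real
  assumes "\<bar>X\<bar> \<le> a" "\<bar>Y\<bar> \<le> b" "\<bar>Z\<bar> \<le> c" "a + b + c \<le> d"
  shows "\<bar>X + Y - Z\<bar> \<le> d"
  using assms by linarith

text \<open>\<open>\<nu>\<close> admits the long directions of the initial stage, and the crude
  factor \<open>64 * \<nu>^3\<close> serves all bounds at once. The jet of \<open>h\<close> is one
  order shorter than that of \<open>b\<close> because \<open>h\<close> contains the gradient of
  \<open>v\<close>.\<close>

lemma corrugation_step:
  fixes v a :: "real^2 \<Rightarrow> real" and w :: "2 \<Rightarrow> real^2 \<Rightarrow> real" and n :: "real^2"
  assumes n: "\<And>i. \<bar>n $ i\<bar> \<le> \<nu>" and \<nu>: "1 \<le> \<nu>" and \<mu>: "0 < \<mu>" "\<mu> \<le> L" and \<alpha>: "0 \<le> \<alpha>" and G: "0 \<le> G"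
    and a: "Jet 3 UNIV \<alpha> \<mu> a"
    and v: "\<And>j. has_pd j v (pd j v)" "\<And>j. Jet 2 UNIV G L (pd j v)"
    and M2: "\<And>i j x. \<bar>pd i (pd j v) x\<bar> \<le> M2"
    and w: "\<And>i j. has_pd i (w j) (pd i (w j))"
  shows "\<exists>b h. Jet 3 UNIV (64 * \<nu>^3 * \<alpha> / L) L b \<and>
     (\<forall>j. Jet 2 UNIV (64 * \<nu>^3 * (\<alpha> * G + \<alpha>^2) / L) L (h j)) \<and>
     (\<forall>i j x. \<bar>strain (\<lambda>x. v x + b x) (\<lambda>j x. w j x + h j x) i j x - strain v w i j x - (a x)^2 * n $ i * n $ j\<bar>
        \<le> 64 * \<nu>^3 * (\<alpha> * M2 + \<alpha>^2 * \<mu>) / L)"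
proof -
  have L: "0 < L" using \<mu> by simp
  have \<nu>3: "1 \<le> \<nu>^3" using \<nu> by simp
  have \<nu>13: "\<nu> \<le> \<nu>^3" using \<nu> by (simp add: power3_eq_cube mult_le_cancel_left1 mult.assoc) (smt (verit) mult_le_cancel_left1)
  define s where "s = sqrt (2::real)"
  have s: "s^2 = 2" "0 \<le> s" "s \<le> 2" by (simp_all add: s_def real_le_lsqrt)
  define S where "S = (\<lambda>x. sin ((L *\<^sub>R n) \<bullet> x))"
  define Co where "Co = (\<lambda>x. cos ((L *\<^sub>R n) \<bullet> x))"
  define S2 where "S2 = (\<lambda>x. sin ((2 * L) *\<^sub>R n \<bullet> x))"
  define C2 where "C2 = (\<lambda>x. cos ((2 * L) *\<^sub>R n \<bullet> x))"
  have dbl: "S2 x = 2 * S x * Co x" "C2 x = (Co x)^2 - (S x)^2" for x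
  proof -
    have "(2 * L) *\<^sub>R n \<bullet> x = 2 * ((L *\<^sub>R n) \<bullet> x)" by simp
    then show "S2 x = 2 * S x * Co x" "C2 x = (Co x)^2 - (S x)^2"
      unfolding S2_def C2_def S_def Co_def by (simp_all only: sin_double cos_double)
  qed
  define b where "b = (\<lambda>x. a x * (s / L * S x))"
  define c where "c = (\<lambda>x. (a x * a x) * (- 1 / (4 * L) * S2 x))"
  \<comment> \<open>The derivative of \<open>b\<close> in \<open>- b x * pd j v x\<close> cancels
    the mixed products of the gradients of \<open>b\<close> and \<open>v\<close>; what remains of
    this term is \<open>b\<close> times second derivatives of \<open>v\<close>.\<close>
  define h where "h = (\<lambda>j x. n $ j * c x - b x * pd j v x)"
  have Ja: "has_pd i a (pd i a)" "Jet 2 UNIV (\<alpha> * \<mu>) \<mu> (pd i a)" for i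
    using Jet_pd[of 2 UNIV \<alpha> \<mu> a i] a by (auto simp: eval_nat_numeral)
  have aL: "Jet 3 UNIV \<alpha> L a" by (rule Jet_mono[OF a]) (use \<alpha> \<mu> in auto)
  \<comment> \<open>The sine has frequency up to \<open>\<nu> * L\<close>; passing to the frequency
    \<open>L\<close> costs \<open>\<nu>^3\<close>.\<close>
  have JS: "Jet 3 UNIV (\<nu>^3 * (s / L)) L (\<lambda>x. s / L * S x)"
  proof (rule Jet_rescale)
    have "Jet 3 UNIV \<bar>s / L\<bar> (\<nu> * L) (\<lambda>x. s / L * sin ((L *\<^sub>R n) \<bullet> x + 0))"
      by (rule Jet_sin) (use n L in \<open>simp add: abs_mult\<close>)
    then show "Jet 3 UNIV (s / L) (\<nu> * L) (\<lambda>x. s / L * S x)" using s L by (simp add: S_def)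
  qed (use \<nu> s L in auto)
  have JS2: "Jet 2 UNIV ((2 * \<nu>)^2 * (1 / (4 * L))) L (\<lambda>x. - 1 / (4 * L) * S2 x)"
  proof (rule Jet_rescale)
    have "Jet 2 UNIV \<bar>- 1 / (4 * L)\<bar> (2 * \<nu> * L) (\<lambda>x. - 1 / (4 * L) * sin ((2 * L) *\<^sub>R n \<bullet> x + 0))"
      by (rule Jet_sin) (use n L in \<open>simp add: abs_mult\<close>)
    then show "Jet 2 UNIV (1 / (4 * L)) (2 * \<nu> * L) (\<lambda>x. - 1 / (4 * L) * S2 x)" using L by (simp add: S2_def)
  qed (use \<nu> L in auto)
  have Jb: "Jet 3 UNIV (2^3 * \<alpha> * (\<nu>^3 * (s / L))) L b"
    unfolding b_def by (intro Jet_mult aL JS) (use \<alpha> \<nu> s L in auto)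
  have Jb': "Jet 3 UNIV (16 * \<nu>^3 * \<alpha> / L) L b"
  proof (rule Jet_mono[OF Jb])
    have "2 ^ 3 * \<alpha> * (\<nu> ^ 3 * (s / L)) = (8 * \<alpha> * \<nu>^3 / L) * s" by simp
    also have "\<dots> \<le> (8 * \<alpha> * \<nu>^3 / L) * 2" by (rule mult_left_mono) (use \<alpha> \<nu> L s in auto)
    finally show "2 ^ 3 * \<alpha> * (\<nu> ^ 3 * (s / L)) \<le> 16 * \<nu> ^ 3 * \<alpha> / L" by (simp add: mult_ac)
  qed (use \<alpha> \<nu> s L in auto)
  have Jc: "Jet 2 UNIV (2^2 * (2^2 * \<alpha> * \<alpha>) * ((2 * \<nu>)^2 * (1 / (4 * L)))) L c"
    unfolding c_def
    by (intro Jet_mult JS2 Jet_le[OF aL]) (use \<alpha> L in auto)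
  have Jh: "Jet 2 UNIV (64 * \<nu>^3 * (\<alpha> * G + \<alpha>^2) / L) L (h j)" for j
  proof (rule Jet_mono)
    show "Jet 2 UNIV (\<bar>n $ j\<bar> * (2^2 * (2^2 * \<alpha> * \<alpha>) * ((2 * \<nu>)^2 * (1 / (4 * L)))) + 2^2 * (16 * \<nu>^3 * \<alpha> / L) * G) L (h j)"
      unfolding h_def
      by (intro Jet_diff Jet_cmult Jc Jet_mult Jet_le[OF Jb'] v) (use \<alpha> G \<nu> L in auto)
    have "\<bar>n $ j\<bar> * (2^2 * (2^2 * \<alpha> * \<alpha>) * ((2 * \<nu>)^2 * (1 / (4 * L)))) \<le> \<nu> * (2^2 * (2^2 * \<alpha> * \<alpha>) * ((2 * \<nu>)^2 * (1 / (4 * L))))"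
      by (rule mult_right_mono[OF n]) (use \<alpha> L in auto)
    also have "\<dots> = 16 * (\<nu>^3 * \<alpha>^2 / L)" by (simp add: power2_eq_square power3_eq_cube)
    also have "\<dots> \<le> 64 * (\<nu>^3 * \<alpha>^2 / L)" by (rule mult_right_mono) (use \<nu> L in auto)
    finally show "\<bar>n $ j\<bar> * (2^2 * (2^2 * \<alpha> * \<alpha>) * ((2 * \<nu>)^2 * (1 / (4 * L)))) + 2^2 * (16 * \<nu>^3 * \<alpha> / L) * G
        \<le> 64 * \<nu>^3 * (\<alpha> * G + \<alpha>^2) / L"
      by (simp add: distrib_left add_divide_distrib)
  qed (use \<alpha> G \<nu> L in auto)
  have pb: "has_pd i b (\<lambda>x. pd i a x * (s / L * S x) + a x * (s / L * (Co x * (L * n $ i))))" for i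
  proof -
    have "has_pd i S (\<lambda>x. Co x * (L * n $ i))"
      unfolding S_def Co_def using has_pd_compose[OF has_pd_inner, of sin cos "L *\<^sub>R n" i] by (simp add: DERIV_sin)
    then show ?thesis unfolding b_def by (intro has_pd_mult has_pd_cmult Ja)
  qed
  have pc: "has_pd i c (\<lambda>x. (pd i a x * a x + a x * pd i a x) * (- 1 / (4 * L) * S2 x)
      + (a x * a x) * (- 1 / (4 * L) * (C2 x * (2 * L * n $ i))))" for i
  proof -
    have "has_pd i S2 (\<lambda>x. C2 x * (2 * L * n $ i))"
      unfolding S2_def C2_def using has_pd_compose[OF has_pd_inner, of sin cos "(2 * L) *\<^sub>R n" i] by (simp add: DERIV_sin)
    then show ?thesis unfolding c_def by (intro has_pd_mult has_pd_cmult Ja)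
  qed
  have pv: "has_pd i (pd j v) (pd i (pd j v))" for i j
    using Jet_pd[of 1 UNIV G L "pd j v" i] v(2)[of j] by (simp add: numeral_2_eq_2)
  have ph: "has_pd i (h j) (\<lambda>x. n $ j * pd i c x - (pd i b x * pd j v x + b x * pd i (pd j v) x))" for i j
    unfolding h_def
    by (intro has_pd_diff has_pd_cmult has_pd_mult pv has_pd_pd[OF pb] has_pd_pd[OF pc])
  have err: "strain (\<lambda>x. v x + b x) (\<lambda>j x. w j x + h j x) i j x - strain v w i j x - (a x)^2 * n $ i * n $ j
      = 2 / L^2 * pd i a x * pd j a x * (S x)^2 + 1 / L * a x * S x * Co x * (n $ j * pd i a x + n $ i * pd j a x)
        - b x * (pd i (pd j v) x + pd j (pd i v) x)" for i j x
  proof -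
    have "strain (\<lambda>x. v x + b x) (\<lambda>j x. w j x + h j x) i j x - strain v w i j x - (a x)^2 * n $ i * n $ j
      = pd i b x * pd j b x + n $ j * pd i c x + n $ i * pd j c x - (a x)^2 * n $ i * n $ j
        - b x * (pd i (pd j v) x + pd j (pd i v) x)"
      unfolding strain_def
      using has_pd_imp_pd[OF has_pd_add[OF w[of i j] ph[of i j]]] has_pd_imp_pd[OF has_pd_add[OF w[of j i] ph[of j i]]]
        has_pd_imp_pd[OF has_pd_add[OF v(1)[of i] has_pd_pd[OF pb[of i]]]]
        has_pd_imp_pd[OF has_pd_add[OF v(1)[of j] has_pd_pd[OF pb[of j]]]]
      by (simp add: algebra_simps)
    moreover have "pd i b x * pd j b x + n $ j * pd i c x + n $ i * pd j c x - (a x)^2 * n $ i * n $ j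
      = 2 / L^2 * pd i a x * pd j a x * (S x)^2 + 1 / L * a x * S x * Co x * (n $ j * pd i a x + n $ i * pd j a x)"
      unfolding has_pd_imp_pd[OF pb] has_pd_imp_pd[OF pc] dbl
      by (rule corrugation_identity) (use L s in \<open>auto simp: S_def Co_def\<close>)
    ultimately show ?thesis by simp
  qed
  have "\<bar>strain (\<lambda>x. v x + b x) (\<lambda>j x. w j x + h j x) i j x - strain v w i j x - (a x)^2 * n $ i * n $ j\<bar>
        \<le> 64 * \<nu>^3 * (\<alpha> * M2 + \<alpha>^2 * \<mu>) / L" for i j x
  proof -
    have S1: "\<bar>S x\<bar> \<le> 1" "\<bar>Co x\<bar> \<le> 1" by (auto simp: S_def Co_def)
    have ba: "\<bar>a x\<bar> \<le> \<alpha>" using Jet_bound[OF a] by simp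
    have bp: "\<bar>pd i a x\<bar> \<le> \<alpha> * \<mu>" for i using Jet_bound[OF Ja(2)] by simp
    have m2: "0 \<le> M2" using M2[of 1 1 x] by linarith
    have "\<bar>pd i a x * pd j a x * (S x)^2\<bar> \<le> (\<alpha> * \<mu>) * (\<alpha> * \<mu>) * 1"
      unfolding abs_mult using S1 bp \<alpha> \<mu> by (intro mult_mono) (auto simp: abs_square_le_1)
    then have "2 / L^2 * \<bar>pd i a x * pd j a x * (S x)^2\<bar> \<le> 2 / L^2 * (\<alpha>^2 * \<mu>^2)"
      by (intro mult_left_mono) (auto simp: power2_eq_square algebra_simps)
    also have "\<dots> = 2 * \<alpha>^2 * \<mu> / L * (\<mu> / L)" by (simp add: power2_eq_square)
    also have "\<dots> \<le> 2 * \<alpha>^2 * \<mu> / L * 1" using \<mu> L by (intro mult_left_mono) auto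
    finally have e1: "\<bar>2 / L^2 * pd i a x * pd j a x * (S x)^2\<bar> \<le> 2 * \<alpha>^2 * \<mu> / L"
      by (simp add: abs_mult mult.assoc)
    have nn: "\<bar>n $ j * pd i a x + n $ i * pd j a x\<bar> \<le> 2 * \<nu> * (\<alpha> * \<mu>)"
    proof -
      have "\<bar>n $ k * pd l a x\<bar> \<le> \<nu> * (\<alpha> * \<mu>)" for k l
        unfolding abs_mult using n bp \<nu> by (intro mult_mono) auto
      from this[of j i] this[of i j] show ?thesis by linarith
    qed
    have "\<bar>a x * S x * Co x * (n $ j * pd i a x + n $ i * pd j a x)\<bar> \<le> \<alpha> * 1 * 1 * (2 * \<nu> * (\<alpha> * \<mu>))"
      unfolding abs_mult[of "a x * S x * Co x"] abs_mult[of "a x * S x"] abs_mult[of "a x"]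
      using S1 ba nn \<alpha> by (intro mult_mono) auto
    then have "1 / L * \<bar>a x * S x * Co x * (n $ j * pd i a x + n $ i * pd j a x)\<bar> \<le> 1 / L * (2 * \<nu> * \<alpha>^2 * \<mu>)"
      using L by (intro mult_left_mono) (auto simp: power2_eq_square mult_ac)
    moreover have "1 / L * (2 * \<nu> * \<alpha>^2 * \<mu>) = 2 * (\<nu> * (\<alpha>^2 * \<mu> / L))" by simp
    moreover have "2 * (\<nu> * (\<alpha>^2 * \<mu> / L)) \<le> 2 * (\<nu>^3 * (\<alpha>^2 * \<mu> / L))"
      using \<nu>13 \<mu> L by (intro mult_left_mono mult_right_mono) auto
    ultimately have e2: "\<bar>1 / L * a x * S x * Co x * (n $ j * pd i a x + n $ i * pd j a x)\<bar> \<le> 2 * (\<nu>^3 * (\<alpha>^2 * \<mu> / L))"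
      using L by (simp add: abs_mult mult.assoc)
    have "\<bar>b x * (pd i (pd j v) x + pd j (pd i v) x)\<bar> \<le> (16 * \<nu>^3 * \<alpha> / L) * (2 * M2)"
      unfolding abs_mult using M2[of i j x] M2[of j i x] Jet_bound[OF Jb', of x] \<alpha> \<nu> L
      by (intro mult_mono) auto
    then have e3: "\<bar>b x * (pd i (pd j v) x + pd j (pd i v) x)\<bar> \<le> 32 * (\<nu>^3 * (\<alpha> * M2 / L))"
      by simp
    have p: "1 * (\<alpha>^2 * \<mu> / L) \<le> \<nu>^3 * (\<alpha>^2 * \<mu> / L)" "0 \<le> \<nu>^3 * (\<alpha> * M2 / L)" 
      using mult_right_mono[OF \<nu>3, of "\<alpha>^2 * \<mu> / L"] \<mu> L \<alpha> m2 \<nu> by auto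
    have q: "64 * \<nu>^3 * (\<alpha> * M2 + \<alpha>^2 * \<mu>) / L = 64 * (\<nu>^3 * (\<alpha> * M2 / L)) + 64 * (\<nu>^3 * (\<alpha>^2 * \<mu> / L))"
      "2 * \<alpha>^2 * \<mu> / L = 2 * (\<alpha>^2 * \<mu> / L)"
      by (simp_all add: algebra_simps add_divide_distrib)
    have "2 * X + 2 * Z + 32 * Y \<le> 64 * Y + 64 * Z" if "0 \<le> X" "1 * X \<le> Z" "0 \<le> Y" for X Y Z :: real
      using that by linarith
    from this[OF _ p] have "2 * \<alpha>^2 * \<mu> / L + 2 * (\<nu>^3 * (\<alpha>^2 * \<mu> / L)) + 32 * (\<nu>^3 * (\<alpha> * M2 / L))
        \<le> 64 * \<nu>^3 * (\<alpha> * M2 + \<alpha>^2 * \<mu>) / L" unfolding q using \<mu> L by simp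
    then show ?thesis unfolding err by (rule abs_le_split3[OF e1 e2 e3])
  qed
  moreover have "Jet 3 UNIV (64 * \<nu>^3 * \<alpha> / L) L b"
    by (rule Jet_mono[OF Jb']) (use \<alpha> \<nu> L in \<open>auto intro!: divide_right_mono mult_right_mono\<close>)
  ultimately show ?thesis using Jh by blast
qed

section \<open>A stage\<close>

text \<open>The regularity that is carried from stage to stage. Only second derivatives are bounded:
  mollification regenerates the higher ones, and gradient bounds are tracked separately.\<close>

definition C2fun :: "real \<Rightarrow> (real^2 \<Rightarrow> real) \<Rightarrow> bool" where
  "C2fun M f \<longleftrightarrow> continuous_on UNIV f \<and>
     (\<forall>i. has_pd i f (pd i f) \<and> continuous_on UNIV (pd i f) \<and>
        (\<forall>j. has_pd j (pd i f) (pd j (pd i f)) \<and> continuous_on UNIV (pd j (pd i f)) \<and>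
           (\<forall>x. \<bar>pd j (pd i f) x\<bar> \<le> M)))"

lemma C2funI:
  assumes "continuous_on UNIV f" "\<And>i. has_pd i f (g i)" "\<And>i. continuous_on UNIV (g i)"
    "\<And>i j. has_pd j (g i) (k j i)" "\<And>i j. continuous_on UNIV (k j i)" "\<And>i j x. \<bar>k j i x\<bar> \<le> M"
  shows "C2fun M f"
proof -
  have "pd i f = g i" "pd j (g i) = k j i" for i j
    using assms has_pd_imp_pd by blast+
  then show ?thesis using assms by (simp add: C2fun_def)
qed

lemma C2funD:
  assumes "C2fun M f"
  shows "continuous_on UNIV f" "has_pd i f (pd i f)" "continuous_on UNIV (pd i f)"
    "has_pd j (pd i f) (pd j (pd i f))" "continuous_on UNIV (pd j (pd i f))" "\<bar>pd j (pd i f) x\<bar> \<le> M"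
  using assms by (auto simp: C2fun_def)

lemma C2fun_mono: "C2fun M f \<Longrightarrow> M \<le> N \<Longrightarrow> C2fun N f"
  unfolding C2fun_def by (meson order_trans)

lemma C2fun_add:
  assumes f: "C2fun M f" and g: "C2fun N g" shows "C2fun (M + N) (\<lambda>x. f x + g x)"
  by (rule C2funI[where g = "\<lambda>i x. pd i f x + pd i g x" and k = "\<lambda>j i x. pd j (pd i f) x + pd j (pd i g) x"])
     (auto intro!: has_pd_add continuous_on_add C2funD[OF f] C2funD[OF g] order_trans[OF abs_triangle_ineq] add_mono)

lemma Jet_C2fun: "Jet 2 UNIV C m f \<Longrightarrow> C2fun (C * m * m) f"
proof -
  assume "Jet 2 UNIV C m f"
  then have J: "Jet (Suc (Suc 0)) UNIV C m f" by (simp add: numeral_2_eq_2)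
  note J1 = Jet_pd[OF J] and J2 = Jet_pd[OF Jet_pd(2)[OF J]]
  show ?thesis
    by (rule C2funI[OF Jet_continuous[OF J] J1(1) Jet_continuous[OF J1(2)] J2(1) Jet_continuous[OF J2(2)]])
       (rule Jet_bound[OF J2(2) UNIV_I])
qed

lemma has_pd_mol_pd: "C2fun M f \<Longrightarrow> has_pd i (mol n l f) (mol n l (pd i f))"
  by (intro has_pd_mol C2funD)

lemma C2fun_mol:
  assumes "0 < l" and f: "C2fun M f" shows "C2fun M (mol n l f)"
  by (rule C2funI[where g = "\<lambda>i. mol n l (pd i f)" and k = "\<lambda>j i. mol n l (pd j (pd i f))"])
     (auto intro!: has_pd_mol continuous_on_mol mol_bound C2funD[OF f] assms(1))

lemma pd_add: "has_pd i f f' \<Longrightarrow> has_pd i g g' \<Longrightarrow> pd i (\<lambda>x. f x + g x) = (\<lambda>x. pd i f x + pd i g x)"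
  using has_pd_add has_pd_imp_pd by blast

text \<open>The 4 is a 2 from \<open>has_pd_lipschitz\<close> times a 2 from
  \<open>cube_dist\<close>.\<close>

lemma cube_osc:
  assumes f: "\<And>i. has_pd i f (g i)" and g: "\<And>i z. \<bar>g i z\<bar> \<le> C" and "y \<in> cube x r"
  shows "\<bar>f y - f x\<bar> \<le> 4 * C * r"
proof -
  have "C \<ge> 0" using g[of 1 0] by linarith
  have "\<bar>f y - f x\<bar> \<le> 2 * C * dist y x" by (rule has_pd_lipschitz[OF f g])
  also have "\<dots> \<le> 2 * C * (2 * r)" using cube_dist[OF assms(3)] \<open>C \<ge> 0\<close> by (intro mult_left_mono) auto
  finally show ?thesis by simp
qed

text \<open>The root is taken of \<open>f / \<delta>\<close>, whose values lie in [1/2, 2]; this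
  makes \<open>Ca\<close> independent of \<open>\<delta>\<close> and of the frequency.\<close>

lemma sqrt_coefficient:
  "\<exists>Ca\<ge>1. \<forall>\<delta> m f. 0 < \<delta> \<longrightarrow> 0 \<le> m \<longrightarrow> (\<forall>x. \<delta> / 2 \<le> f x \<and> f x \<le> 2 * \<delta>) \<longrightarrow> Jet 3 UNIV (2 * \<delta>) m f \<longrightarrow>
     (\<exists>a. Jet 3 UNIV (Ca * sqrt \<delta>) m a \<and> (\<forall>x. (a x)^2 = f x))"
proof -
  obtain C where C: "C \<ge> 0" "\<And>m f. 0 \<le> m \<Longrightarrow> \<forall>x. 1/2 \<le> f x \<and> f x \<le> 2 \<Longrightarrow> Jet 3 UNIV 2 m f \<Longrightarrow>
      Jet 3 UNIV C m (\<lambda>x. f x powr (1/2))"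
    using Jet_powr[of "1/2" 2 2 3 "1/2"] by auto
  show ?thesis
  proof (intro exI[of _ "C + 1"] conjI allI impI)
    fix \<delta> m :: real and f :: "real^2 \<Rightarrow> real"
    assume \<delta>: "0 < \<delta>" and m: "0 \<le> m" and f: "\<forall>x. \<delta> / 2 \<le> f x \<and> f x \<le> 2 * \<delta>" and J: "Jet 3 UNIV (2 * \<delta>) m f"
    let ?g = "\<lambda>x. 1 / \<delta> * f x"
    have "Jet 3 UNIV (\<bar>1 / \<delta>\<bar> * (2 * \<delta>)) m ?g" by (rule Jet_cmult[OF J])
    then have "Jet 3 UNIV C m (\<lambda>x. ?g x powr (1/2))"
      using \<delta> f by (intro C m) (auto simp: field_simps)
    then have "Jet 3 UNIV (\<bar>sqrt \<delta>\<bar> * C) m (\<lambda>x. sqrt \<delta> * ?g x powr (1/2))" by (rule Jet_cmult)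
    then have "Jet 3 UNIV ((C + 1) * sqrt \<delta>) m (\<lambda>x. sqrt \<delta> * ?g x powr (1/2))"
      by (rule Jet_mono) (use C \<delta> m in \<open>auto simp: algebra_simps\<close>)
    moreover have "(sqrt \<delta> * ?g x powr (1/2))^2 = f x" for x
    proof -
      have "0 \<le> ?g x" using f \<delta> by (smt (verit) divide_nonneg_pos mult_nonneg_nonneg zero_le_divide_1_iff half_gt_zero)
      then have "?g x powr (1/2) = sqrt (?g x)" by (simp add: powr_half_sqrt)
      then show ?thesis using \<delta> \<open>0 \<le> ?g x\<close> by (simp add: power_mult_distrib)
    qed
    ultimately show "\<exists>a. Jet 3 UNIV ((C + 1) * sqrt \<delta>) m a \<and> (\<forall>x. (a x)^2 = f x)" by blast
  qed (use C in auto)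
qed

text \<open>In the intended use \<open>s\<close> is the square root of the size of the deficit, \<open>Ca * s\<close> bounds the amplitude and
  \<open>B * s\<close> times the previous frequency bounds the second derivatives of \<open>v\<close>.\<close>

definition corrugated ::
  "real \<Rightarrow> real \<Rightarrow> real \<Rightarrow> real \<Rightarrow> real \<Rightarrow> real \<Rightarrow> (real^2 \<Rightarrow> real) \<Rightarrow> real^2 \<Rightarrow> (real^2 \<Rightarrow> real) \<Rightarrow>
   (2 \<Rightarrow> real^2 \<Rightarrow> real) \<Rightarrow> (real^2 \<Rightarrow> real) \<Rightarrow> (2 \<Rightarrow> real^2 \<Rightarrow> real) \<Rightarrow> bool" where
  "corrugated K s Ca G B L a n v w b h \<longleftrightarrow>
     Jet 3 UNIV (64 * Ca * s / L) L b \<and>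
     (\<forall>j. Jet 2 UNIV (64 * (Ca * s * G + (Ca * s)^2) / L) L (h j)) \<and>
     (\<forall>i j x. \<bar>strain (\<lambda>x. v x + b x) (\<lambda>j x. w j x + h j x) i j x - strain v w i j x - (a x)^2 * n $ i * n $ j\<bar>
        \<le> 64 * (Ca * B + Ca^2) * s^2 / K) \<and>
     (\<forall>j. has_pd j (\<lambda>x. v x + b x) (pd j (\<lambda>x. v x + b x))) \<and>
     (\<forall>j. Jet 2 UNIV (G + 64 * Ca * s) L (pd j (\<lambda>x. v x + b x))) \<and>
     (\<forall>i j x. \<bar>pd i (pd j (\<lambda>x. v x + b x)) x\<bar> \<le> (B + 64 * Ca) * s * L) \<and>
     (\<forall>i j. has_pd i (\<lambda>x. w j x + h j x) (pd i (\<lambda>x. w j x + h j x)))"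

text \<open>Amplitude times second derivatives over the new frequency is
  \<open>Ca * s * (B * s * L) / (K * L)\<close>, of size \<open>s^2 / K\<close> whatever
  \<open>L\<close> is. The conclusion reproduces the hypotheses with \<open>K * L\<close>,
  \<open>B + 64 * Ca\<close> and \<open>G + 64 * Ca * s\<close> in place of \<open>L\<close>,
  \<open>B\<close> and \<open>G\<close>, so that steps can be chained.\<close>

lemma stage_step:
  fixes v a :: "real^2 \<Rightarrow> real" and w :: "2 \<Rightarrow> real^2 \<Rightarrow> real" and n :: "real^2"
  assumes n: "\<And>i. \<bar>n $ i\<bar> \<le> 1" and l: "0 < l" "1 / l \<le> L" and K: "1 \<le> K" and s: "0 \<le> s"
    and Ca: "0 \<le> Ca" and G: "0 \<le> G" and B: "0 \<le> B"
    and a: "Jet 3 UNIV (Ca * s) (1 / l) a"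
    and v: "\<And>j. has_pd j v (pd j v)" "\<And>j. Jet 2 UNIV G L (pd j v)" "\<And>i j x. \<bar>pd i (pd j v) x\<bar> \<le> B * s * L"
    and w: "\<And>i j. has_pd i (w j) (pd i (w j))"
  shows "\<exists>b h. corrugated K s Ca G B (K * L) a n v w b h"
proof -
  have "0 < 1 / l" using l by simp
  then have L: "0 < L" using l(2) by linarith
  have KL: "L \<le> K * L" using K L mult_right_mono[of 1 K L] by simp
  then have KL: "L \<le> K * L" "1 / l \<le> K * L" "0 < K * L"
    using L l(2) by linarith+
  have vKL: "Jet 2 UNIV G (K * L) (pd j v)" for j
    by (rule Jet_mono[OF v(2)]) (use G L KL in auto)
  have "\<exists>b h. Jet 3 UNIV (64 * 1^3 * (Ca * s) / (K * L)) (K * L) b \<and>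
     (\<forall>j. Jet 2 UNIV (64 * 1^3 * (Ca * s * G + (Ca * s)^2) / (K * L)) (K * L) (h j)) \<and>
     (\<forall>i j x. \<bar>strain (\<lambda>x. v x + b x) (\<lambda>j x. w j x + h j x) i j x - strain v w i j x - (a x)^2 * n $ i * n $ j\<bar>
        \<le> 64 * 1^3 * (Ca * s * (B * s * L) + (Ca * s)^2 * (1 / l)) / (K * L))"
    by (rule corrugation_step[OF n order_refl \<open>0 < 1 / l\<close> KL(2) mult_nonneg_nonneg[OF Ca s] G a v(1) vKL v(3) w])
  then obtain b h where bh: "Jet 3 UNIV (64 * 1^3 * (Ca * s) / (K * L)) (K * L) b"
     "\<forall>j. Jet 2 UNIV (64 * 1^3 * (Ca * s * G + (Ca * s)^2) / (K * L)) (K * L) (h j)"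
     "\<forall>i j x. \<bar>strain (\<lambda>x. v x + b x) (\<lambda>j x. w j x + h j x) i j x - strain v w i j x - (a x)^2 * n $ i * n $ j\<bar>
        \<le> 64 * 1^3 * (Ca * s * (B * s * L) + (Ca * s)^2 * (1 / l)) / (K * L)"
    by (elim exE conjE) (rule that, assumption+)
  have b: "Jet 3 UNIV (64 * Ca * s / (K * L)) (K * L) b" using bh(1) by (simp add: mult.assoc)
  have h: "Jet 2 UNIV (64 * (Ca * s * G + (Ca * s)^2) / (K * L)) (K * L) (h j)" for j
    using bh(2) by simp
  have "Jet (Suc 2) UNIV (64 * Ca * s / (K * L)) (K * L) b" using b by (simp add: eval_nat_numeral)
  note bp = Jet_pd[OF this]
  have bp2: "Jet 2 UNIV (64 * Ca * s) (K * L) (pd j b)" for j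
  proof -
    have "K * L \<noteq> 0" using KL(3) by linarith
    then have "64 * Ca * s / (K * L) * (K * L) = 64 * Ca * s"
      unfolding times_divide_eq_left by (rule nonzero_mult_div_cancel_right)
    then show ?thesis using bp(2)[of j] by simp
  qed
  have pdv: "pd j (\<lambda>x. v x + b x) = (\<lambda>x. pd j v x + pd j b x)" for j
    by (rule pd_add[OF v(1) bp(1)])
  have J: "Jet 2 UNIV (G + 64 * Ca * s) (K * L) (pd j (\<lambda>x. v x + b x))" for j
    unfolding pdv by (intro Jet_add vKL bp2)
  have pp: "\<bar>pd i (pd j (\<lambda>x. v x + b x)) x\<bar> \<le> (B + 64 * Ca) * s * (K * L)" for i j x
  proof -
    have 1: "Jet (Suc 1) UNIV G (K * L) (pd j v)" "Jet (Suc 1) UNIV (64 * Ca * s) (K * L) (pd j b)"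
      using vKL bp2 by (simp_all add: numeral_2_eq_2)
    have "pd i (pd j (\<lambda>x. v x + b x)) x = pd i (pd j v) x + pd i (pd j b) x"
      unfolding pdv by (simp add: pd_add[OF Jet_pd(1)[OF 1(1)] Jet_pd(1)[OF 1(2)]])
    moreover have "\<bar>pd i (pd j b) x\<bar> \<le> 64 * Ca * s * (K * L)" by (rule Jet_bound[OF Jet_pd(2)[OF 1(2)] UNIV_I])
    moreover have "B * s * L \<le> B * s * (K * L)" using B s KL by (intro mult_left_mono) auto
    moreover have "(B + 64 * Ca) * s * (K * L) = B * s * (K * L) + 64 * Ca * s * (K * L)" by (simp add: algebra_simps)
    ultimately show ?thesis
      using v(3)[of i j x] abs_triangle_ineq[of "pd i (pd j v) x" "pd i (pd j b) x"] by linarith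
  qed
  have er: "64 * 1^3 * (Ca * s * (B * s * L) + (Ca * s)^2 * (1 / l)) / (K * L) \<le> 64 * (Ca * B + Ca^2) * s^2 / K"
  proof -
    have "(Ca * s)^2 * (1 / l) \<le> (Ca * s)^2 * L" using l by (intro mult_left_mono) auto
    then have "Ca * s * (B * s * L) + (Ca * s)^2 * (1 / l) \<le> (Ca * B + Ca^2) * s^2 * L"
      by (simp add: power2_eq_square algebra_simps)
    then have "64 * (Ca * s * (B * s * L) + (Ca * s)^2 * (1 / l)) / (K * L) \<le> 64 * ((Ca * B + Ca^2) * s^2 * L) / (K * L)"
      using KL by (intro divide_right_mono mult_left_mono) auto
    also have "\<dots> = 64 * (Ca * B + Ca^2) * s^2 / K" using L by simp
    finally show ?thesis by simp
  qed
  have hw: "has_pd i (\<lambda>x. w j x + h j x) (pd i (\<lambda>x. w j x + h j x))" for i j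
  proof (rule has_pd_pd[OF has_pd_add[OF w]])
    have "Jet (Suc 1) UNIV (64 * (Ca * s * G + (Ca * s)^2) / (K * L)) (K * L) (h j)"
      using h[of j] by (simp only: numeral_2_eq_2 One_nat_def)
    then show "has_pd i (h j) (pd i (h j))" by (rule Jet_pd)
  qed
  show ?thesis
    unfolding corrugated_def
    by (intro exI[of _ b] exI[of _ h] conjI allI b h order_trans[OF bh(3)[rule_format] er] J pp hw
        has_pd_pd[OF has_pd_add[OF v(1) bp(1)]])
qed

text \<open>The deficit is close to \<open>\<delta>\<close> times the sum of the squares of \<open>(1,0), (0,1), (1,1)\<close>. A symmetric matrix \<open>D\<close>
  has the coordinates \<open>D\<^sub>1\<^sub>1 - D\<^sub>1\<^sub>2\<close>, \<open>D\<^sub>2\<^sub>2 - D\<^sub>1\<^sub>2\<close> and \<open>D\<^sub>1\<^sub>2\<close> with respect to these three primitive matrices.\<close>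

definition deficit_near :: "(2 \<Rightarrow> 2 \<Rightarrow> real^2 \<Rightarrow> real) \<Rightarrow> (real^2 \<Rightarrow> real) \<Rightarrow> (2 \<Rightarrow> real^2 \<Rightarrow> real) \<Rightarrow> real \<Rightarrow> bool" where
  "deficit_near A v w \<delta> \<longleftrightarrow> (\<forall>x. \<bar>(A 1 2 x - strain v w 1 2 x) - \<delta>\<bar> \<le> \<delta> / 8 \<and>
     (\<forall>k. \<bar>(A k k x - strain v w k k x) - (A 1 2 x - strain v w 1 2 x) - \<delta>\<bar> \<le> \<delta> / 8))"

lemma continuous_on_strain:
  assumes v: "C2fun M v" and w: "\<And>j. C2fun M' (w j)"
  shows "continuous_on UNIV (strain v w i j)"
  unfolding strain_def[abs_def]
  by (intro continuous_on_add continuous_on_mult C2funD(3)[OF v] C2funD(3)[OF w])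

text \<open>The linear part commutes with mollification; the quadratic part leaves the difference
  bounded in \<open>mol_commutator\<close>.\<close>

lemma mol_strain:
  assumes v: "C2fun M v" and w: "\<And>j. C2fun M (w j)" and A: "continuous_on UNIV (A i j)"
  shows "mol n l (A i j) x - strain (mol n l v) (\<lambda>j. mol n l (w j)) i j x
    = mol n l (\<lambda>x. A i j x - strain v w i j x) x
      + (mol n l (\<lambda>y. pd i v y * pd j v y) x - mol n l (pd i v) x * mol n l (pd j v) x)"
proof -
  have "pd i (mol n l v) = mol n l (pd i v)" "pd i (mol n l (w j)) = mol n l (pd i (w j))" for i j
    using has_pd_imp_pd has_pd_mol_pd v w by blast+
  then show ?thesis
    unfolding strain_def
    by (simp add: mol_diff mol_add A C2funD(3)[OF v] C2funD(3)[OF w] continuous_on_add continuous_on_mult)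
qed

text \<open>The commutator error of the mollification is not left as an error: it is part of the deficit that is
  decomposed, and \<open>l\<close> only has to make it small compared with \<open>\<delta>\<close>. The remainder \<open>\<delta>'\<close> is what the next stage
  starts from.\<close>

lemma stage_coefficients:
  "\<exists>Ca\<ge>1. \<forall>A v w \<delta> \<delta>' M l. 0 < \<delta> \<longrightarrow> 0 < \<delta>' \<longrightarrow> \<delta>' \<le> \<delta> / 4 \<longrightarrow> 0 < M \<longrightarrow> l = sqrt \<delta> / (400 * M) \<longrightarrow>
     C2fun M v \<longrightarrow> (\<forall>j. C2fun M (w j)) \<longrightarrow> (\<forall>i j. continuous_on UNIV (A i j)) \<longrightarrow> deficit_near A v w \<delta> \<longrightarrow>
     (\<exists>a0 a. Jet 3 UNIV (Ca * sqrt \<delta>) (1 / l) a0 \<and> (\<forall>k::2. Jet 3 UNIV (Ca * sqrt \<delta>) (1 / l) (a k)) \<and>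
        (\<forall>x. mol 3 l (A 1 2) x - strain (mol 3 l v) (\<lambda>j. mol 3 l (w j)) 1 2 x = (a0 x)^2 + \<delta>') \<and>
        (\<forall>k x. mol 3 l (A k k) x - strain (mol 3 l v) (\<lambda>j. mol 3 l (w j)) k k x = (a k x)^2 + (a0 x)^2 + 2 * \<delta>'))"
proof -
  obtain Ca where Ca: "Ca \<ge> 1" "\<And>\<delta> m f. 0 < \<delta> \<Longrightarrow> 0 \<le> m \<Longrightarrow> (\<forall>x. \<delta> / 2 \<le> f x \<and> f x \<le> 2 * \<delta>) \<Longrightarrow> Jet 3 UNIV (2 * \<delta>) m f \<Longrightarrow>
     (\<exists>a. Jet 3 UNIV (Ca * sqrt \<delta>) m a \<and> (\<forall>x. (a x)^2 = f x))"
    using sqrt_coefficient by metis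
  show ?thesis
  proof (intro exI[of _ Ca] conjI allI impI)
    fix A :: "2 \<Rightarrow> 2 \<Rightarrow> real^2 \<Rightarrow> real" and v w \<delta> \<delta>' M l
    assume \<delta>: "0 < (\<delta>::real)" and \<delta>': "0 < \<delta>'" "\<delta>' \<le> \<delta> / 4" and M: "0 < (M::real)" and l_def: "l = sqrt \<delta> / (400 * M)"
      and v: "C2fun M v" and "\<forall>j. C2fun M (w j)" and "\<forall>i j. continuous_on UNIV (A i j)"
      and near: "deficit_near A v w \<delta>"
    then have w: "\<And>j. C2fun M (w j)" and A: "\<And>i j. continuous_on UNIV (A i j)" by auto
    have l: "0 < l" using \<delta> M by (simp add: l_def)
    define D where "D = (\<lambda>i j x. A i j x - strain v w i j x)"
    define E where "E = (\<lambda>i j x. mol 3 l (\<lambda>y. pd i v y * pd j v y) x - mol 3 l (pd i v) x * mol 3 l (pd j v) x)"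
    have cD: "continuous_on UNIV (D i j)" for i j
      unfolding D_def by (intro continuous_on_diff A continuous_on_strain[OF v w])
    have mD: "mol 3 l (A i j) x - strain (mol 3 l v) (\<lambda>j. mol 3 l (w j)) i j x = mol 3 l (D i j) x + E i j x" for i j x
      unfolding D_def E_def by (rule mol_strain[OF v w A])
    have "Jet 3 UNIV (\<delta> / 64) (1 / l) (E i j)" for i j
    proof (rule Jet_mono)
      have osc: "\<bar>pd i v y - pd i v x\<bar> \<le> 4 * M * (real 3 * l)" if "y \<in> cube x (real 3 * l)" for i x y
        by (rule cube_osc[OF _ _ that]) (use C2funD[OF v] in auto)
      show "Jet 3 UNIV ((1 + 2^3) * ((4 * M * (real 3 * l)) * (4 * M * (real 3 * l)))) (1 / l) (E i j)"
        unfolding E_def by (rule mol_commutator[OF l _ _ osc osc]) (use C2funD[OF v] in auto)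
      \<comment> \<open>The 400 in \<open>l\<close> is spent here: the commutator bound becomes
        \<open>9 * (3/100)^2 * \<delta>\<close>, below \<open>\<delta> / 64\<close>.\<close>
      have "4 * M * (real 3 * l) = 3 / 100 * sqrt \<delta>" using M by (simp add: l_def)
      then show "(1 + 2^3) * ((4 * M * (real 3 * l)) * (4 * M * (real 3 * l))) \<le> \<delta> / 64"
        using \<delta> real_sqrt_mult_self[of \<delta>] by (simp only:) (simp add: mult_ac)
    qed (use l M in auto)
    then have JE: "Jet 3 UNIV (\<delta> / 64) (1 / l) (E i j)" "\<bar>E i j x\<bar> \<le> \<delta> / 64" for i j x
      using Jet_bound by blast+
    have n0: "\<bar>D 1 2 x - \<delta>\<bar> \<le> \<delta> / 8" and nk: "\<bar>(D k k x - D 1 2 x) - \<delta>\<bar> \<le> \<delta> / 8" for k x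
      using near unfolding deficit_near_def D_def by auto
    have J\<delta>: "Jet 3 UNIV \<delta>' (1 / l) (\<lambda>x. \<delta>')" using \<delta>' l by (intro Jet_const) auto
    have d0: "\<bar>mol 3 l (D 1 2) x - \<delta>\<bar> \<le> \<delta> / 8" for x
      by (rule mol_approx[OF l cD n0])
    have dk: "\<bar>mol 3 l (\<lambda>x. D k k x - D 1 2 x) x - \<delta>\<bar> \<le> \<delta> / 8" for k x
      by (rule mol_approx[OF l continuous_on_diff[OF cD cD] nk])
    have J0: "Jet 3 UNIV (9/8 * \<delta>) (1 / l) (mol 3 l (D 1 2))"
    proof (rule Jet_mol[OF l cD])
      fix x y show "\<bar>D 1 2 y\<bar> \<le> 9/8 * \<delta>" using n0[of y] by linarith
    qed
    have Jk: "Jet 3 UNIV (9/8 * \<delta>) (1 / l) (mol 3 l (\<lambda>x. D k k x - D 1 2 x))" for k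
    proof (rule Jet_mol[OF l continuous_on_diff[OF cD cD]])
      fix x y show "\<bar>D k k y - D 1 2 y\<bar> \<le> 9/8 * \<delta>" using nk[of k y] by linarith
    qed
    \<comment> \<open>\<open>\<delta>'\<close> is held back in each of the three coordinates, so
      that the remainder is \<open>\<delta>'\<close> times the sum of the three primitive squares,
      the normal form required by the next stage. As \<open>\<delta>'\<close> is at most
      \<open>\<delta> / 4\<close>, the radicands stay between \<open>\<delta> / 2\<close> and
      \<open>2 * \<delta>\<close>.\<close>
    have "\<exists>a0. Jet 3 UNIV (Ca * sqrt \<delta>) (1 / l) a0 \<and> (\<forall>x. (a0 x)^2 = mol 3 l (D 1 2) x + E 1 2 x - \<delta>')"
    proof (intro Ca \<delta> allI)
      have "Jet 3 UNIV (9/8 * \<delta> + \<delta> / 64 + \<delta>') (1 / l) (\<lambda>x. mol 3 l (D 1 2) x + E 1 2 x - \<delta>')"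
        by (intro Jet_diff Jet_add J0 JE J\<delta>)
      then show "Jet 3 UNIV (2 * \<delta>) (1 / l) (\<lambda>x. mol 3 l (D 1 2) x + E 1 2 x - \<delta>')"
        by (rule Jet_mono) (use \<delta> \<delta>' l in auto)
      fix x show "\<delta> / 2 \<le> mol 3 l (D 1 2) x + E 1 2 x - \<delta>' \<and> mol 3 l (D 1 2) x + E 1 2 x - \<delta>' \<le> 2 * \<delta>"
        using d0[of x] JE(2)[of 1 2 x] \<delta> \<delta>' by (intro conjI) linarith+
    qed (use l in auto)
    then obtain a0 where a0: "Jet 3 UNIV (Ca * sqrt \<delta>) (1 / l) a0" "\<And>x. (a0 x)^2 = mol 3 l (D 1 2) x + E 1 2 x - \<delta>'"
      by blast
    have "\<exists>a. Jet 3 UNIV (Ca * sqrt \<delta>) (1 / l) a \<and> (\<forall>x. (a x)^2 = mol 3 l (\<lambda>x. D k k x - D 1 2 x) x + E k k x - E 1 2 x - \<delta>')" for k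
    proof (intro Ca \<delta> allI)
      have "Jet 3 UNIV (9/8 * \<delta> + \<delta> / 64 + \<delta> / 64 + \<delta>') (1 / l) (\<lambda>x. mol 3 l (\<lambda>x. D k k x - D 1 2 x) x + E k k x - E 1 2 x - \<delta>')"
        by (intro Jet_diff Jet_add Jk JE J\<delta>)
      then show "Jet 3 UNIV (2 * \<delta>) (1 / l) (\<lambda>x. mol 3 l (\<lambda>x. D k k x - D 1 2 x) x + E k k x - E 1 2 x - \<delta>')"
        by (rule Jet_mono) (use \<delta> \<delta>' l in auto)
      fix x show "\<delta> / 2 \<le> mol 3 l (\<lambda>x. D k k x - D 1 2 x) x + E k k x - E 1 2 x - \<delta>' \<and>
          mol 3 l (\<lambda>x. D k k x - D 1 2 x) x + E k k x - E 1 2 x - \<delta>' \<le> 2 * \<delta>"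
        using dk[of k x] JE(2)[of 1 2 x] JE(2)[of k k x] \<delta> \<delta>' by (intro conjI) linarith+
    qed (use l in auto)
    then obtain a where a: "\<And>k. Jet 3 UNIV (Ca * sqrt \<delta>) (1 / l) (a k)"
      "\<And>k x. (a k x)^2 = mol 3 l (\<lambda>x. D k k x - D 1 2 x) x + E k k x - E 1 2 x - \<delta>'"
      by metis
    have "mol 3 l (\<lambda>x. D k k x - D 1 2 x) x = mol 3 l (D k k) x - mol 3 l (D 1 2) x" for k x
      by (simp add: mol_diff cD)
    then show "\<exists>a0 a. Jet 3 UNIV (Ca * sqrt \<delta>) (1 / l) a0 \<and> (\<forall>k::2. Jet 3 UNIV (Ca * sqrt \<delta>) (1 / l) (a k)) \<and>
        (\<forall>x. mol 3 l (A 1 2) x - strain (mol 3 l v) (\<lambda>j. mol 3 l (w j)) 1 2 x = (a0 x)^2 + \<delta>') \<and>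
        (\<forall>k x. mol 3 l (A k k) x - strain (mol 3 l v) (\<lambda>j. mol 3 l (w j)) k k x = (a k x)^2 + (a0 x)^2 + 2 * \<delta>')"
      using a0 a by (intro exI[of _ a0] exI[of _ a]) (simp add: mD)
  qed (rule Ca)
qed

lemma corrugatedD:
  assumes "corrugated K s Ca G B L a n v w b h"
  shows "Jet 3 UNIV (64 * Ca * s / L) L b"
    "Jet 2 UNIV (64 * (Ca * s * G + (Ca * s)^2) / L) L (h j)"
    "\<bar>strain (\<lambda>x. v x + b x) (\<lambda>j x. w j x + h j x) i j x - strain v w i j x - (a x)^2 * n $ i * n $ j\<bar>
        \<le> 64 * (Ca * B + Ca^2) * s^2 / K"
    "has_pd j (\<lambda>x. v x + b x) (pd j (\<lambda>x. v x + b x))"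
    "Jet 2 UNIV (G + 64 * Ca * s) L (pd j (\<lambda>x. v x + b x))"
    "\<bar>pd i (pd j (\<lambda>x. v x + b x)) x\<bar> \<le> (B + 64 * Ca) * s * L"
    "has_pd i (\<lambda>x. w j x + h j x) (pd i (\<lambda>x. w j x + h j x))"
  using assms unfolding corrugated_def by blast+

text \<open>Each corrugation has the previous one, slower by the factor \<open>K\<close>, as its
  background, and the three errors are of equal order \<open>s^2 / K\<close>. The bounds for
  \<open>b\<close> are free of \<open>G\<close> whereas those for \<open>h\<close> are not; the
  choice of constants in the iteration relies on this.\<close>

lemma three_steps:
  fixes a :: "2 \<Rightarrow> real^2 \<Rightarrow> real"
  assumes l: "0 < l" and K: "1 \<le> K" and s: "0 \<le> s" "s \<le> 1" and Ca: "1 \<le> Ca" and G: "1 \<le> G"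
    and a0: "Jet 3 UNIV (Ca * s) (1 / l) a0" and a: "\<And>k. Jet 3 UNIV (Ca * s) (1 / l) (a k)"
    and v: "\<And>j. has_pd j v (pd j v)" "\<And>j. Jet 2 UNIV G (1 / l) (pd j v)" "\<And>i j x. \<bar>pd i (pd j v) x\<bar> \<le> s * (1 / l)"
    and w: "\<And>i j. has_pd i (w j) (pd i (w j))"
  shows "\<exists>b h. C2fun (192 * Ca * s * (K^3 / l)) b \<and> (\<forall>j. C2fun (192 * (Ca * (G + 128 * Ca) + Ca^2) * s * (K^3 / l)) (h j)) \<and>
     (\<forall>x. \<bar>b x\<bar> \<le> 192 * Ca * l) \<and> (\<forall>j x. \<bar>pd j b x\<bar> \<le> 192 * Ca * s) \<and>
     (\<forall>j x. \<bar>h j x\<bar> \<le> 192 * (Ca * (G + 128 * Ca) + Ca^2) * l) \<and>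
     (\<forall>i j x. \<bar>pd i (h j) x\<bar> \<le> 192 * (Ca * (G + 128 * Ca) + Ca^2) * s) \<and>
     (\<forall>i j x. \<bar>strain (\<lambda>x. v x + b x) (\<lambda>j x. w j x + h j x) i j x - strain v w i j x
          - ((if i = j then (a i x)^2 else 0) + (a0 x)^2)\<bar> \<le> 192 * (Ca * (1 + 128 * Ca) + Ca^2) * s^2 / K)"
proof -
  define H where "H = 64 * (Ca * (G + 128 * Ca) + Ca^2)"
  define Er where "Er = 64 * (Ca * (1 + 128 * Ca) + Ca^2) * s^2 / K"
  define L1 where "L1 = K * (1 / l)"
  define L2 where "L2 = K * L1"
  define L3 where "L3 = K * L2"
  have il: "0 < 1 / l" using l by simp
  have L: "1 / l \<le> L1" "L1 \<le> L2" "L2 \<le> L3"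
    using mult_right_mono[OF K, of "1 / l"] mult_right_mono[OF K, of L1] mult_right_mono[OF K, of L2] K il
    by (auto simp: L1_def L2_def L3_def)
  have L': "1 / l \<le> L2" "1 / l \<le> L3" "L1 \<le> L3" "0 < L1" "0 < L2" "0 < L3" using L il by linarith+
  have L3: "L3 = K^3 / l" by (simp add: L3_def L2_def L1_def power3_eq_cube)
  have Cas: "64 * Ca * s \<le> 64 * Ca" "0 \<le> 64 * Ca * s" using s Ca by auto
  have n: "\<bar>axis k 1 $ i :: real\<bar> \<le> 1" "\<bar>(vec 1 :: real^2) $ i\<bar> \<le> 1" for k i :: 2 by (auto simp: axis_def)
  \<comment> \<open>\<open>G'\<close> stands for the gradient bound before a given corrugation; it
    rises by at most \<open>64 * Ca\<close> each time, hence by \<open>128 * Ca\<close> before the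
    third.\<close>
  have HH: "64 * (Ca * s * G' + (Ca * s)^2) / L \<le> H * s / L" if "0 \<le> G'" "G' \<le> G + 128 * Ca" "0 < L" for G' L
  proof (rule divide_right_mono)
    have "s^2 \<le> s" using s by (simp add: power2_eq_square mult_left_le)
    then have "Ca^2 * s^2 \<le> Ca^2 * s" by (intro mult_left_mono) auto
    moreover have "Ca * s * G' \<le> Ca * s * (G + 128 * Ca)" using that s Ca by (intro mult_left_mono) auto
    ultimately show "64 * (Ca * s * G' + (Ca * s)^2) \<le> H * s"
      unfolding H_def by (simp add: power_mult_distrib algebra_simps)
  qed (use that in auto)
  have EE: "64 * (Ca * B + Ca^2) * s^2 / K \<le> Er" if "B \<le> 1 + 128 * Ca" for B
    unfolding Er_def using that Ca K by (intro divide_right_mono mult_right_mono mult_left_mono add_mono) auto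
  have H3: "192 * (Ca * (G + 128 * Ca) + Ca^2) = 3 * H" by (simp add: H_def)
  have H0: "0 \<le> H" using Ca G by (simp add: H_def)
  have "\<exists>b h. corrugated K s Ca G 1 (K * (1 / l)) (a 1) (axis 1 1) v w b h"
    by (rule stage_step[OF n(1) l order_refl K s(1) _ _ _ a v(1) v(2) _ w]) (use Ca G v(3) in auto)
  then obtain b1 h1 where "corrugated K s Ca G 1 L1 (a 1) (axis 1 1) v w b1 h1"
    unfolding L1_def by blast
  note 1 = corrugatedD[OF this]
  have "\<exists>b h. corrugated K s Ca (G + 64 * Ca * s) (1 + 64 * Ca) (K * L1) (a 2) (axis 2 1)
      (\<lambda>x. v x + b1 x) (\<lambda>j x. w j x + h1 j x) b h"
    by (rule stage_step[OF n(1) l L(1) K s(1) _ _ _ a 1(4) 1(5) 1(6) 1(7)]) (use Ca G Cas in auto)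
  then obtain b2 h2 where "corrugated K s Ca (G + 64 * Ca * s) (1 + 64 * Ca) L2 (a 2) (axis 2 1)
      (\<lambda>x. v x + b1 x) (\<lambda>j x. w j x + h1 j x) b2 h2"
    unfolding L2_def by blast
  note 2 = corrugatedD[OF this]
  have "\<exists>b h. corrugated K s Ca (G + 64 * Ca * s + 64 * Ca * s) (1 + 64 * Ca + 64 * Ca) (K * L2) a0 (vec 1)
      (\<lambda>x. (v x + b1 x) + b2 x) (\<lambda>j x. (w j x + h1 j x) + h2 j x) b h"
    by (rule stage_step[OF n(2) l L'(1) K s(1) _ _ _ a0 2(4) 2(5) 2(6) 2(7)]) (use Ca G Cas in auto)
  then obtain b3 h3 where "corrugated K s Ca (G + 64 * Ca * s + 64 * Ca * s) (1 + 64 * Ca + 64 * Ca) L3 a0 (vec 1)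
      (\<lambda>x. (v x + b1 x) + b2 x) (\<lambda>j x. (w j x + h1 j x) + h2 j x) b3 h3"
    unfolding L3_def by blast
  note 3 = corrugatedD[OF this]
  define b where "b = (\<lambda>x. b1 x + b2 x + b3 x)"
  define h where "h = (\<lambda>j x. h1 j x + h2 j x + h3 j x)"
  have bJ: "C2fun (64 * Ca * s * L3) g \<and> (\<forall>x. \<bar>g x\<bar> \<le> 64 * Ca * l) \<and> (\<forall>j x. \<bar>pd j g x\<bar> \<le> 64 * Ca * s) \<and> (\<forall>j. has_pd j g (pd j g))"
    if g: "Jet 3 UNIV (64 * Ca * s / L) L g" and L: "1 / l \<le> L" "L \<le> L3" for g L
  proof -
    have L0: "0 < L" using L il by linarith
    have J: "Jet (Suc 2) UNIV (64 * Ca * s / L) L g" using g by (simp add: eval_nat_numeral)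
    have "C2fun (64 * Ca * s / L * L * L) g" by (rule Jet_C2fun[OF Jet_le[OF g]]) simp
    then have "C2fun (64 * Ca * s * L3) g"
      by (rule C2fun_mono) (use L0 L Cas in \<open>simp add: mult_left_mono\<close>)
    moreover have "\<bar>g x\<bar> \<le> 64 * Ca * l" for x
    proof -
      have "1 / L \<le> l" using L L0 l by (simp add: field_simps)
      then have "(64 * Ca * s) * (1 / L) \<le> (64 * Ca) * l" using Cas L0 Ca by (intro mult_mono[OF Cas(1)]) auto
      then show ?thesis using Jet_bound[OF g, of x] by simp
    qed
    moreover have "\<bar>pd j g x\<bar> \<le> 64 * Ca * s" for j x
      using Jet_bound[OF Jet_pd(2)[OF J], of x j] L0 by simp
    ultimately show ?thesis using Jet_pd(1)[OF J] by blast
  qed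
  have hJ: "C2fun (H * s * L3) g \<and> (\<forall>x. \<bar>g x\<bar> \<le> H * l) \<and> (\<forall>j x. \<bar>pd j g x\<bar> \<le> H * s) \<and> (\<forall>j. has_pd j g (pd j g))"
    if g: "Jet 2 UNIV (64 * (Ca * s * G' + (Ca * s)^2) / L) L g" and G': "0 \<le> G'" "G' \<le> G + 128 * Ca"
      and L: "1 / l \<le> L" "L \<le> L3" for g L G'
  proof -
    have L0: "0 < L" using L il by linarith
    have J': "Jet 2 UNIV (H * s / L) L g"
      by (rule Jet_mono[OF g _ _ HH]) (use G' L0 s Ca in auto)
    then have J: "Jet (Suc 1) UNIV (H * s / L) L g" by (simp add: numeral_2_eq_2)
    have "C2fun (H * s / L * L * L) g" by (rule Jet_C2fun[OF J'])
    then have "C2fun (H * s * L3) g"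
      by (rule C2fun_mono) (use L0 L H0 s in \<open>simp add: mult_left_mono\<close>)
    moreover have "\<bar>g x\<bar> \<le> H * l" for x
    proof -
      have "1 / L \<le> l" using L L0 l by (simp add: field_simps)
      then have "(H * s) * (1 / L) \<le> (H * 1) * l" using H0 L0 s by (intro mult_mono[OF mult_left_mono]) auto
      then show ?thesis using Jet_bound[OF J', of x] by simp
    qed
    moreover have "\<bar>pd j g x\<bar> \<le> H * s" for j x
      using Jet_bound[OF Jet_pd(2)[OF J], of x j] L0 by simp
    ultimately show ?thesis using Jet_pd(1)[OF J] by blast
  qed
  note b1 = bJ[OF 1(1) L(1) L'(3)] and b2 = bJ[OF 2(1) L'(1) L(3)] and b3 = bJ[OF 3(1) L'(2) order_refl]
  have h1: "C2fun (H * s * L3) (h1 j) \<and> (\<forall>x. \<bar>h1 j x\<bar> \<le> H * l) \<and> (\<forall>i x. \<bar>pd i (h1 j) x\<bar> \<le> H * s) \<and> (\<forall>i. has_pd i (h1 j) (pd i (h1 j)))" for j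
    by (rule hJ[OF 1(2)]) (use G Ca L L' in auto)
  have h2: "C2fun (H * s * L3) (h2 j) \<and> (\<forall>x. \<bar>h2 j x\<bar> \<le> H * l) \<and> (\<forall>i x. \<bar>pd i (h2 j) x\<bar> \<le> H * s) \<and> (\<forall>i. has_pd i (h2 j) (pd i (h2 j)))" for j
    by (rule hJ[OF 2(2)]) (use G Ca L L' Cas in auto)
  have h3: "C2fun (H * s * L3) (h3 j) \<and> (\<forall>x. \<bar>h3 j x\<bar> \<le> H * l) \<and> (\<forall>i x. \<bar>pd i (h3 j) x\<bar> \<le> H * s) \<and> (\<forall>i. has_pd i (h3 j) (pd i (h3 j)))" for j
    by (rule hJ[OF 3(2)]) (use G Ca L L' Cas in auto)
  have sum3: "\<bar>p + q + r\<bar> \<le> 3 * t" if "\<bar>p\<bar> \<le> t" "\<bar>q\<bar> \<le> t" "\<bar>r\<bar> \<le> t" for p q r t :: real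
    using that by linarith
  have pdb: "pd j b x = pd j b1 x + pd j b2 x + pd j b3 x" for j x
    using has_pd_imp_pd[OF has_pd_add[OF has_pd_add]] b1 b2 b3 unfolding b_def by metis
  have pdh: "pd i (h j) x = pd i (h1 j) x + pd i (h2 j) x + pd i (h3 j) x" for i j x
    using has_pd_imp_pd[OF has_pd_add[OF has_pd_add]] h1[of j] h2[of j] h3[of j] unfolding h_def by metis
  have A1: "C2fun (192 * Ca * s * (K^3 / l)) b"
    unfolding b_def by (rule C2fun_mono[OF C2fun_add[OF C2fun_add[OF b1[THEN conjunct1] b2[THEN conjunct1]] b3[THEN conjunct1]]])
       (simp add: L3)
  have A2: "C2fun (192 * (Ca * (G + 128 * Ca) + Ca^2) * s * (K^3 / l)) (h j)" for j
    unfolding h_def by (rule C2fun_mono[OF C2fun_add[OF C2fun_add[OF h1[THEN conjunct1] h2[THEN conjunct1]] h3[THEN conjunct1]]])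
       (simp add: L3 H_def algebra_simps)
  have A3: "\<bar>b x\<bar> \<le> 192 * Ca * l" for x
    unfolding b_def using sum3[of "b1 x" "64 * Ca * l" "b2 x" "b3 x"] b1 b2 b3 by simp
  have A4: "\<bar>pd j b x\<bar> \<le> 192 * Ca * s" for j x
    unfolding pdb using sum3[of "pd j b1 x" "64 * Ca * s" "pd j b2 x" "pd j b3 x"] b1 b2 b3 by simp
  have A5: "\<bar>h j x\<bar> \<le> 192 * (Ca * (G + 128 * Ca) + Ca^2) * l" for j x
    unfolding h_def H3 mult.assoc[of 3] by (rule sum3) (use h1 h2 h3 in auto)
  have A6: "\<bar>pd i (h j) x\<bar> \<le> 192 * (Ca * (G + 128 * Ca) + Ca^2) * s" for i j x
    unfolding pdh H3 mult.assoc[of 3] by (rule sum3) (use h1 h2 h3 in auto)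
  have A7: "\<bar>strain (\<lambda>x. v x + b x) (\<lambda>j x. w j x + h j x) i j x - strain v w i j x
          - ((if i = j then (a i x)^2 else 0) + (a0 x)^2)\<bar> \<le> 192 * (Ca * (1 + 128 * Ca) + Ca^2) * s^2 / K" for i j x
  proof -
    \<comment> \<open>The axis directions touch diagonal entries only, while \<open>vec 1\<close>,
      the direction (1,1), contributes \<open>(a0 x)^2\<close> to every entry.\<close>
    have ax: "(if i = j then (a i x)^2 else 0) = (a 1 x)^2 * axis 1 1 $ i * axis 1 1 $ j + (a 2 x)^2 * axis 2 1 $ i * axis 2 1 $ j"
      using exhaust_2[of i] exhaust_2[of j] by (auto simp: axis_def)
    have "\<bar>strain (\<lambda>x. v x + b1 x) (\<lambda>j x. w j x + h1 j x) i j x - strain v w i j x - (a 1 x)^2 * axis 1 1 $ i * axis 1 1 $ j\<bar> \<le> Er"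
      using order_trans[OF 1(3) EE] Ca by simp
    moreover have "\<bar>strain (\<lambda>x. (v x + b1 x) + b2 x) (\<lambda>j x. (w j x + h1 j x) + h2 j x) i j x
         - strain (\<lambda>x. v x + b1 x) (\<lambda>j x. w j x + h1 j x) i j x - (a 2 x)^2 * axis 2 1 $ i * axis 2 1 $ j\<bar> \<le> Er"
      using order_trans[OF 2(3) EE] Ca by simp
    moreover have "\<bar>strain (\<lambda>x. (v x + b1 x) + b2 x + b3 x) (\<lambda>j x. (w j x + h1 j x) + h2 j x + h3 j x) i j x
         - strain (\<lambda>x. (v x + b1 x) + b2 x) (\<lambda>j x. (w j x + h1 j x) + h2 j x) i j x - (a0 x)^2 * vec 1 $ i * vec 1 $ j\<bar> \<le> Er"
      using order_trans[OF 3(3) EE] Ca by simp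
    ultimately have "\<bar>strain (\<lambda>x. (v x + b1 x) + b2 x + b3 x) (\<lambda>j x. (w j x + h1 j x) + h2 j x + h3 j x) i j x - strain v w i j x
        - ((if i = j then (a i x)^2 else 0) + (a0 x)^2)\<bar> \<le> 3 * Er"
      unfolding ax by simp
    moreover have "192 * (Ca * (1 + 128 * Ca) + Ca^2) * s^2 / K = 3 * Er" by (simp add: Er_def)
    ultimately show ?thesis by (simp only: b_def h_def add.assoc)
  qed
  show ?thesis
    by (intro exI[of _ b] exI[of _ h] conjI allI A1 A2 A3 A4 A5 A6 A7)
qed

definition improved :: "(2 \<Rightarrow> 2 \<Rightarrow> real^2 \<Rightarrow> real) \<Rightarrow> (real^2 \<Rightarrow> real) \<Rightarrow> (2 \<Rightarrow> real^2 \<Rightarrow> real) \<Rightarrow> real \<Rightarrow> real \<Rightarrow>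
    real \<Rightarrow> real \<Rightarrow> real \<Rightarrow> real \<Rightarrow> real \<Rightarrow> (real^2 \<Rightarrow> real) \<Rightarrow> (2 \<Rightarrow> real^2 \<Rightarrow> real) \<Rightarrow> bool" where
  "improved A v w \<delta> \<delta>' M' C0 C Gw l v' w' \<longleftrightarrow>
     C2fun M' v' \<and> (\<forall>j. C2fun M' (w' j)) \<and> deficit_near A v' w' \<delta>' \<and>
     (\<forall>j x. \<bar>pd j v' x - pd j v x\<bar> \<le> C0 * sqrt \<delta>) \<and> (\<forall>i j x. \<bar>pd i (w' j) x - pd i (w j) x\<bar> \<le> C * sqrt \<delta>) \<and>
     (\<forall>x. \<bar>v' x - v x\<bar> \<le> C * l) \<and> (\<forall>j x. \<bar>w' j x - w j x\<bar> \<le> C * (1 + Gw) * l)"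

text \<open>\<open>C * \<delta> / K \<le> \<delta>'\<close> makes the corrugation error fit into the
  next deficit. \<open>Gw\<close> is quantified after \<open>C\<close> and enters only the
  displacement of \<open>w\<close>, so gradients of \<open>w\<close> do not feed back into the
  constants.\<close>

definition stage_possible :: "real \<Rightarrow> real \<Rightarrow> real \<Rightarrow> bool" where
  "stage_possible C0 G C \<longleftrightarrow> (\<forall>A v w \<delta> \<delta>' M K l Gw.
     0 < \<delta> \<longrightarrow> \<delta> \<le> 1 \<longrightarrow> 0 < \<delta>' \<longrightarrow> \<delta>' \<le> \<delta> / 4 \<longrightarrow> 1 \<le> K \<longrightarrow> 0 < M \<longrightarrow> l = sqrt \<delta> / (400 * M) \<longrightarrow>
     C * \<delta> / K \<le> \<delta>' \<longrightarrow> C2fun M v \<longrightarrow> (\<forall>j. C2fun M (w j)) \<longrightarrow> (\<forall>j x. \<bar>pd j v x\<bar> \<le> G) \<longrightarrow>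
     (\<forall>i j x. \<bar>pd i (w j) x\<bar> \<le> Gw) \<longrightarrow> (\<forall>i j. continuous_on UNIV (A i j)) \<longrightarrow>
     (\<forall>i j x y. y \<in> cube x (3 * l) \<longrightarrow> \<bar>A i j y - A i j x\<bar> \<le> \<delta>' / 64) \<longrightarrow> deficit_near A v w \<delta> \<longrightarrow>
     (\<exists>v' w'. improved A v w \<delta> \<delta>' (C * K^3 * M) C0 C Gw l v' w'))"

text \<open>The order of the quantifiers avoids a circle: \<open>C\<close> depends on the gradient
  bound \<open>G\<close>, and \<open>G\<close> has to hold throughout the iteration. As
  \<open>C0\<close> precedes \<open>G\<close>, the total change of the gradient of \<open>v\<close>
  is known before \<open>G\<close> is fixed.\<close>

lemma stage: "\<exists>C0\<ge>1. \<forall>G\<ge>1. \<exists>C\<ge>1. stage_possible C0 G C"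
proof -
  obtain Ca where Ca: "Ca \<ge> 1" and coef: "\<And>A v w \<delta> \<delta>' M l. 0 < \<delta> \<Longrightarrow> 0 < \<delta>' \<Longrightarrow> \<delta>' \<le> \<delta> / 4 \<Longrightarrow> 0 < M \<Longrightarrow>
     l = sqrt \<delta> / (400 * M) \<Longrightarrow>
     C2fun M v \<Longrightarrow> (\<forall>j. C2fun M (w j)) \<Longrightarrow> (\<forall>i j. continuous_on UNIV (A i j)) \<Longrightarrow> deficit_near A v w \<delta> \<Longrightarrow>
     (\<exists>a0 a. Jet 3 UNIV (Ca * sqrt \<delta>) (1 / l) a0 \<and> (\<forall>k::2. Jet 3 UNIV (Ca * sqrt \<delta>) (1 / l) (a k)) \<and>
        (\<forall>x. mol 3 l (A 1 2) x - strain (mol 3 l v) (\<lambda>j. mol 3 l (w j)) 1 2 x = (a0 x)^2 + \<delta>') \<and>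
        (\<forall>k x. mol 3 l (A k k) x - strain (mol 3 l v) (\<lambda>j. mol 3 l (w j)) k k x = (a k x)^2 + (a0 x)^2 + 2 * \<delta>'))"
    using stage_coefficients by (elim exE conjE) (rule that, assumption, blast)
  show ?thesis
  proof (rule exI[of _ "1 + 192 * Ca"], intro conjI allI impI)
    show "1 \<le> 1 + 192 * Ca" using Ca by simp
    fix G :: real assume G: "1 \<le> G"
    define Hc where "Hc = 192 * (Ca * (G + 128 * Ca) + Ca^2)"
    define Ec where "Ec = 192 * (Ca * (1 + 128 * Ca) + Ca^2)"
    \<comment> \<open>One constant dominating all needs: \<open>64 * Ec\<close> brings the error
      below \<open>\<delta>' / 64\<close>; \<open>76800 * Ca\<close> and \<open>400 * Hc\<close>
      come from \<open>s / l = 400 * M\<close>, with 76800 = 400 * 192; \<open>12 * G\<close> is the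
      displacement caused by mollification.\<close>
    define C where "C = 64 * Ec + 76800 * Ca + 400 * Hc + 12 * G + 13"
    have pos: "0 \<le> Hc" "0 \<le> Ec" using Ca G by (simp_all add: Hc_def Ec_def)
    have C1: "1 \<le> C" "64 * Ec \<le> C" "1 + 76800 * Ca \<le> C" "1 + 400 * Hc \<le> C" "1 + Hc \<le> C" "12 * G + 192 * Ca \<le> C" "12 + Hc \<le> C"
      using pos Ca G by (simp_all add: C_def)
    show "\<exists>C\<ge>1. stage_possible (1 + 192 * Ca) G C"
      unfolding stage_possible_def
    proof (rule exI[of _ C], intro conjI allI impI C1)
      fix A :: "2 \<Rightarrow> 2 \<Rightarrow> real^2 \<Rightarrow> real" and v w \<delta> \<delta>' M K l Gw
      assume \<delta>: "0 < (\<delta>::real)" "\<delta> \<le> 1" and \<delta>': "0 < \<delta>'" "\<delta>' \<le> \<delta> / 4" and K: "1 \<le> (K::real)" and M: "0 < M"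
        and l_def: "l = sqrt \<delta> / (400 * M)" and CK: "C * \<delta> / K \<le> \<delta>'"
        and v: "C2fun M v" and w': "\<forall>j. C2fun M (w j)" and Gv: "\<forall>j x. \<bar>pd j v x\<bar> \<le> G"
        and Gw: "\<forall>i j x. \<bar>pd i (w j) x\<bar> \<le> Gw" and A': "\<forall>i j. continuous_on UNIV (A i j)"
        and osc: "\<forall>i j x y. y \<in> cube x (3 * l) \<longrightarrow> \<bar>A i j y - A i j x\<bar> \<le> \<delta>' / 64" and near: "deficit_near A v w \<delta>"
      have w: "\<And>j. C2fun M (w j)" and A: "\<And>i j. continuous_on UNIV (A i j)" using w' A' by auto
      define s where "s = sqrt \<delta>"
      have s: "0 < s" "s \<le> 1" "s^2 = \<delta>" using \<delta> by (auto simp: s_def)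
      have l: "0 < l" using \<delta> M by (simp add: l_def)
      have sl: "s / l = 400 * M" "M * l = s / 400" using s M by (simp_all add: l_def s_def)
      obtain a0 a where a0: "Jet 3 UNIV (Ca * s) (1 / l) a0" and a: "\<And>k::2. Jet 3 UNIV (Ca * s) (1 / l) (a k)"
        and d0: "\<And>x. mol 3 l (A 1 2) x - strain (mol 3 l v) (\<lambda>j. mol 3 l (w j)) 1 2 x = (a0 x)^2 + \<delta>'"
        and dk: "\<And>k x. mol 3 l (A k k) x - strain (mol 3 l v) (\<lambda>j. mol 3 l (w j)) k k x = (a k x)^2 + (a0 x)^2 + 2 * \<delta>'"
        using coef[OF \<delta>(1) \<delta>' M l_def v w' A' near] unfolding s_def by blast
      define v0 where "v0 = mol 3 l v"
      define w0 where "w0 = (\<lambda>j. mol 3 l (w j))"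
      have v0: "C2fun M v0" and w0: "\<And>j. C2fun M (w0 j)"
        unfolding v0_def w0_def by (intro C2fun_mol l v w)+
      have pv0: "pd j v0 = mol 3 l (pd j v)" for j
        unfolding v0_def by (rule has_pd_imp_pd[OF has_pd_mol_pd[OF v]])
      have pw0: "pd i (w0 j) = mol 3 l (pd i (w j))" for i j
        unfolding w0_def by (rule has_pd_imp_pd[OF has_pd_mol_pd[OF w]])
      have Jv0: "Jet 2 UNIV G (1 / l) (pd j v0)" for j
        unfolding pv0 by (rule Jet_le[OF Jet_mol[OF l C2funD(3)[OF v]]]) (use Gv in auto)
      have ddv: "\<bar>pd i (pd j v0) x\<bar> \<le> s * (1 / l)" for i j x
      proof -
        have "\<bar>pd i (pd j v0) x\<bar> \<le> M" by (rule C2funD(6)[OF v0])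
        also have "M \<le> s / l" unfolding sl using M by simp
        finally show ?thesis by simp
      qed
      obtain b h where b: "C2fun (192 * Ca * s * (K^3 / l)) b" "\<forall>x. \<bar>b x\<bar> \<le> 192 * Ca * l" "\<forall>j x. \<bar>pd j b x\<bar> \<le> 192 * Ca * s"
        and h: "\<forall>j. C2fun (Hc * s * (K^3 / l)) (h j)" "\<forall>j x. \<bar>h j x\<bar> \<le> Hc * l" "\<forall>i j x. \<bar>pd i (h j) x\<bar> \<le> Hc * s"
        and er: "\<forall>i j x. \<bar>strain (\<lambda>x. v0 x + b x) (\<lambda>j x. w0 j x + h j x) i j x - strain v0 w0 i j x
          - ((if i = j then (a i x)^2 else 0) + (a0 x)^2)\<bar> \<le> Ec * s^2 / K"
        using three_steps[where a = a and w = w0, OF l K less_imp_le[OF s(1)] s(2) Ca G a0 a C2funD(2)[OF v0] Jv0 ddv C2funD(2)[OF w0]]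
        unfolding Hc_def[symmetric] Ec_def[symmetric] by (elim exE conjE) (rule that; assumption)
      define v1 where "v1 = (\<lambda>x. v0 x + b x)"
      define w1 where "w1 = (\<lambda>j x. w0 j x + h j x)"
      have pv1: "pd j v1 x = pd j v0 x + pd j b x" for j x
        unfolding v1_def by (simp add: pd_add[OF C2funD(2)[OF v0] C2funD(2)[OF b(1)]])
      have pw1: "pd i (w1 j) x = pd i (w0 j) x + pd i (h j) x" for i j x
        unfolding w1_def by (simp add: pd_add[OF C2funD(2)[OF w0] C2funD(2)[OF h(1)[rule_format]]])
      have K3: "1 \<le> K^3" using K by simp
      have scale: "M + c * s * (K^3 / l) \<le> C * K^3 * M" if "1 + 400 * c \<le> C" for c
      proof -
        have "c * s * (K^3 / l) = c * (s / l) * K^3" by simp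
        then have "M + c * s * (K^3 / l) = M + 400 * c * K^3 * M" unfolding sl(1) by simp
        also have "\<dots> \<le> M * K^3 + 400 * c * K^3 * M" using K3 M by simp
        also have "\<dots> = (1 + 400 * c) * (K^3 * M)" by (simp add: algebra_simps)
        also have "\<dots> \<le> C * (K^3 * M)" by (rule mult_right_mono[OF that]) (use K M in auto)
        finally show ?thesis by (simp add: mult.assoc)
      qed
      have r1: "C2fun (C * K^3 * M) v1"
        unfolding v1_def by (rule C2fun_mono[OF C2fun_add[OF v0 b(1)] scale]) (use C1 in simp)
      have r2: "C2fun (C * K^3 * M) (w1 j)" for j
        unfolding w1_def by (rule C2fun_mono[OF C2fun_add[OF w0 h(1)[rule_format]] scale]) (use C1 in simp)
      have osc1: "\<bar>mol 3 l (pd j f) x - pd j f x\<bar> \<le> s / 30" if "C2fun M f" for f j x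
      proof -
        have "\<bar>mol 3 l (pd j f) x - pd j f x\<bar> \<le> 4 * M * (real 3 * l)"
          by (rule mol_approx[OF l C2funD(3)[OF that]])
             (rule cube_osc[OF C2funD(4)[OF that] C2funD(6)[OF that]])
        also have "\<dots> \<le> s / 30" using sl(2) s by simp
        finally show ?thesis .
      qed
      have r4: "\<bar>pd j v1 x - pd j v x\<bar> \<le> (1 + 192 * Ca) * sqrt \<delta>" for j x
        using osc1[OF v, of j x] b(3)[rule_format, of j x] s unfolding pv1 pv0 s_def[symmetric] distrib_right by linarith
      have r5: "\<bar>pd i (w1 j) x - pd i (w j) x\<bar> \<le> C * sqrt \<delta>" for i j x
      proof -
        have "\<bar>pd i (w1 j) x - pd i (w j) x\<bar> \<le> (1 + Hc) * s"
          using osc1[OF w, of i j x] h(3)[rule_format, of i j x] s unfolding pw1 pw0 distrib_right by linarith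
        also have "\<dots> \<le> C * s" using C1 s by (intro mult_right_mono) auto
        finally show ?thesis by (simp add: s_def)
      qed
      have osc0: "\<bar>mol 3 l f x - f x\<bar> \<le> 12 * g * l" if f: "C2fun M f" and g: "\<And>j x. \<bar>pd j f x\<bar> \<le> g" for f g x
      proof -
        have "\<bar>mol 3 l f x - f x\<bar> \<le> 4 * g * (real 3 * l)"
          by (rule mol_approx[OF l C2funD(1)[OF f]]) (rule cube_osc[OF C2funD(2)[OF f] g])
        then show ?thesis by simp
      qed
      have r6: "\<bar>v1 x - v x\<bar> \<le> C * l" for x
      proof -
        have "\<bar>v1 x - v x\<bar> \<le> 12 * G * l + 192 * Ca * l"
          using osc0[OF v Gv[rule_format], of x] b(2)[rule_format, of x] unfolding v1_def v0_def by linarith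
        also have "\<dots> = (12 * G + 192 * Ca) * l" by (simp add: algebra_simps)
        also have "\<dots> \<le> C * l" using C1 l by (intro mult_right_mono) auto
        finally show ?thesis .
      qed
      have r7: "\<bar>w1 j x - w j x\<bar> \<le> C * (1 + Gw) * l" for j x
      proof -
        have Gw0: "0 \<le> Gw" using Gw by (meson abs_ge_zero order_trans)
        have "\<bar>w1 j x - w j x\<bar> \<le> 12 * Gw * l + Hc * l"
          using osc0[OF w[of j] Gw[rule_format, of _ j], of x] h(2)[rule_format, of j x] unfolding w1_def w0_def by linarith
        also have "\<dots> = (12 * Gw + Hc) * l" by (simp add: algebra_simps)
        also have "\<dots> \<le> (C * (1 + Gw)) * l"
        proof (intro mult_right_mono)
          have "12 * Gw \<le> C * Gw" using C1 pos Gw0 by (intro mult_right_mono) auto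
          then show "12 * Gw + Hc \<le> C * (1 + Gw)" using C1 by (simp add: algebra_simps)
        qed (use l in simp)
        finally show ?thesis .
      qed
      have small: "Ec * s^2 / K \<le> \<delta>' / 64"
      proof -
        have "64 * Ec * (\<delta> / K) \<le> C * (\<delta> / K)" using C1 \<delta> K by (intro mult_right_mono) auto
        then have "64 * (Ec * (\<delta> / K)) \<le> \<delta>'" using CK by simp
        moreover have "Ec * s^2 / K = Ec * (\<delta> / K)" using s by simp
        ultimately show ?thesis by linarith
      qed
      have oscA: "\<bar>mol 3 l (A i j) x - A i j x\<bar> \<le> \<delta>' / 64" for i j x
        using osc by (intro mol_approx l A) auto
      have e0: "\<bar>strain v1 w1 1 2 x - strain v0 w0 1 2 x - (a0 x)^2\<bar> \<le> \<delta>' / 64" for x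
        using order_trans[OF er[rule_format, of 1 2 x] small] by (simp add: v1_def w1_def)
      have ek: "\<bar>strain v1 w1 k k x - strain v0 w0 k k x - ((a k x)^2 + (a0 x)^2)\<bar> \<le> \<delta>' / 64" for k x
        using order_trans[OF er[rule_format, of k k x] small] by (simp add: v1_def w1_def)
      \<comment> \<open>Mollifying \<open>A\<close> and corrugating cost
        \<open>\<delta>' / 64\<close> each per entry. The second condition involves two entries, in
        total \<open>4 * \<delta>' / 64\<close>, within the allowed
        \<open>\<delta>' / 8\<close>.\<close>
      have r3: "deficit_near A v1 w1 \<delta>'"
        unfolding deficit_near_def
      proof (intro allI conjI)
        fix x
        show "\<bar>A 1 2 x - strain v1 w1 1 2 x - \<delta>'\<bar> \<le> \<delta>' / 8"
          using oscA[of 1 2 x] e0[of x] d0[of x, folded v0_def w0_def] \<delta>' by linarith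
        fix k
        show "\<bar>A k k x - strain v1 w1 k k x - (A 1 2 x - strain v1 w1 1 2 x) - \<delta>'\<bar> \<le> \<delta>' / 8"
          using oscA[of k k x] ek[of k x] dk[of k x, folded v0_def w0_def]
            oscA[of 1 2 x] e0[of x] d0[of x, folded v0_def w0_def] \<delta>' by linarith
      qed
      show "\<exists>v' w'. improved A v w \<delta> \<delta>' (C * K^3 * M) (1 + 192 * Ca) C Gw l v' w'"
        unfolding improved_def
        by (intro exI[of _ v1] exI[of _ w1] conjI allI r1 r2 r3 r4 r5 r6 r7)
    qed
  qed
qed

section \<open>Iterating stages\<close>

lemma geometric_increments:
  fixes u :: "nat \<Rightarrow> real"
  assumes u: "\<And>q. \<bar>u (Suc q) - u q\<bar> \<le> a * t^q" and t: "0 \<le> t" "t < 1"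
  shows "\<exists>L. u \<longlonglongrightarrow> L \<and> (\<forall>q. \<bar>L - u q\<bar> \<le> a * t^q / (1 - t))"
proof -
  have a: "0 \<le> a" using order_trans[OF abs_ge_zero u[of 0]] by simp
  \<comment> \<open>The exact geometric partial sum, with the factor \<open>1 - t^k\<close>, is the
    bound that reproduces itself in the induction.\<close>
  have fin: "\<bar>u (q + k) - u q\<bar> \<le> a * t^q * (1 - t^k) / (1 - t)" for q k
  proof (induction k)
    case (Suc k)
    have "\<bar>u (q + Suc k) - u q\<bar> \<le> a * t^(q + k) + a * t^q * (1 - t^k) / (1 - t)"
      using u[of "q + k"] Suc by simp
    also have "\<dots> = a * t^q * (1 - t^Suc k) / (1 - t)" using t by (simp add: field_simps power_add)
    finally show ?case .
  qed simp
  have bd: "\<bar>u (q + k) - u q\<bar> \<le> a * t^q / (1 - t)" for q k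
  proof -
    have "a * t^q * (1 - t^k) \<le> a * t^q * 1" using a t by (intro mult_left_mono) auto
    then have "a * t^q * (1 - t^k) / (1 - t) \<le> a * t^q / (1 - t)" using t by (simp add: divide_right_mono)
    then show ?thesis using fin[of q k] by linarith
  qed
  have "summable (\<lambda>q. u (Suc q) - u q)"
    by (rule summable_comparison_test'[of "\<lambda>q. a * t^q" 0]) (use u t in \<open>auto intro!: summable_mult summable_geometric\<close>)
  then have "convergent (\<lambda>n. \<Sum>q<n. u (Suc q) - u q)" by (simp add: summable_iff_convergent)
  then have "convergent (\<lambda>n. u n - u 0)" by (simp add: sum_lessThan_telescope)
  then obtain L' where "(\<lambda>n. u n - u 0) \<longlonglongrightarrow> L'" by (auto simp: convergent_def)
  from tendsto_add[OF this tendsto_const[of "u 0"]] have L: "u \<longlonglongrightarrow> L' + u 0" by simp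
  have "\<bar>L' + u 0 - u q\<bar> \<le> a * t^q / (1 - t)" for q
  proof (rule tendsto_upperbound)
    show "(\<lambda>k. \<bar>u (q + k) - u q\<bar>) \<longlonglongrightarrow> \<bar>L' + u 0 - u q\<bar>"
      using LIMSEQ_ignore_initial_segment[OF L, of q] by (intro tendsto_intros) (simp add: add.commute)
  qed (use bd in auto)
  then show ?thesis using L by blast
qed

lemma interpolate_powr:
  fixes z a b :: real
  assumes "0 \<le> z" "z \<le> a" "z \<le> b" "0 \<le> \<alpha>" "\<alpha> \<le> 1"
  shows "z \<le> a powr (1 - \<alpha>) * b powr \<alpha>"
proof (cases "z = 0")
  case False
  have "z = z powr (1 - \<alpha>) * z powr \<alpha>" using False assms by (simp add: powr_add[symmetric])
  also have "\<dots> \<le> a powr (1 - \<alpha>) * b powr \<alpha>" using assms by (intro mult_mono powr_mono2) auto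
  finally show ?thesis .
qed simp

text \<open>For fixed \<open>x\<close> and \<open>y\<close>, the increment of the gradient
  difference has a sup bound decaying like \<open>r^q\<close> and a Lipschitz bound growing like
  \<open>\<Lambda>^q\<close> times the distance. Interpolating the two gives a geometric series of
  ratio \<open>r powr (1 - \<alpha>) * \<Lambda> powr \<alpha>\<close> times the distance to the
  power \<alpha>.\<close>

lemma C1_Holder_limit:
  fixes f :: "nat \<Rightarrow> real^2 \<Rightarrow> real"
  assumes f: "\<And>q. C2fun (M * \<Lambda>^q) (f q)"
    and sup: "\<And>q x. \<bar>f (Suc q) x - f q x\<bar> \<le> a * t^q" and t: "0 \<le> t" "t < 1"
    and inc: "\<And>q j x. \<bar>pd j (f (Suc q)) x - pd j (f q) x\<bar> \<le> c * r^q" and r: "0 < r" "r < 1"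
    and g0: "\<And>j x. \<bar>pd j (f 0) x\<bar> \<le> g0"
    and \<Lambda>: "1 \<le> \<Lambda>" and M: "0 \<le> M" and \<alpha>: "0 < \<alpha>" "\<alpha> < 1" and \<theta>: "r powr (1 - \<alpha>) * \<Lambda> powr \<alpha> < 1"
  shows "\<exists>F. (\<forall>j. has_pd j F (pd j F)) \<and> (\<forall>x. \<bar>F x - f 0 x\<bar> \<le> a / (1 - t)) \<and>
     (\<forall>j x. (\<lambda>q. pd j (f q) x) \<longlonglongrightarrow> pd j F x) \<and> (\<forall>j x. \<bar>pd j F x\<bar> \<le> g0 + c / (1 - r)) \<and>
     (\<exists>K. \<forall>j x y. \<bar>pd j F x - pd j F y\<bar> \<le> K * dist x y powr \<alpha>)"
proof -
  have "\<exists>L. (\<lambda>q. f q x) \<longlonglongrightarrow> L \<and> (\<forall>q. \<bar>L - f q x\<bar> \<le> a * t^q / (1 - t))" for x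
    by (rule geometric_increments[OF sup t])
  then obtain F where F: "\<And>x. (\<lambda>q. f q x) \<longlonglongrightarrow> F x" "\<And>q x. \<bar>F x - f q x\<bar> \<le> a * t^q / (1 - t)" by metis
  have "\<exists>L. (\<lambda>q. pd j (f q) x) \<longlonglongrightarrow> L \<and> (\<forall>q. \<bar>L - pd j (f q) x\<bar> \<le> c * r^q / (1 - r))" for j x
    by (rule geometric_increments[OF inc]) (use r in auto)
  then obtain g where g: "\<And>j x. (\<lambda>q. pd j (f q) x) \<longlonglongrightarrow> g j x" "\<And>j q x. \<bar>g j x - pd j (f q) x\<bar> \<le> c * r^q / (1 - r)" by metis
  have unif: "\<forall>\<^sub>F q in sequentially. \<forall>j x. \<bar>pd j (f q) x - g j x\<bar> \<le> e" if "e > 0" for e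
  proof -
    have "(\<lambda>q. c * r^q / (1 - r)) \<longlonglongrightarrow> c * 0 / (1 - r)"
      using r by (intro tendsto_intros LIMSEQ_realpow_zero) auto
    then have "\<forall>\<^sub>F q in sequentially. c * r^q / (1 - r) < e"
      using that by (intro order_tendstoD) auto
    then show ?thesis
      by (rule eventually_mono) (use g(2) in \<open>metis abs_minus_commute less_imp_le order_trans\<close>)
  qed
  have pdF: "has_pd j F (g j)" for j
    unfolding has_pd_def
  proof
    fix x
    let ?p = "\<lambda>s. x + s *\<^sub>R axis j 1 :: real^2"
    have "\<exists>G. \<forall>s\<in>UNIV. (\<lambda>q. f q (?p s)) \<longlonglongrightarrow> G s \<and> (G has_derivative (\<lambda>h. g j (?p s) * h)) (at s within UNIV)"
    proof (rule has_derivative_sequence[where f' = "\<lambda>q s h. pd j (f q) (?p s) * h" and ?x0.0 = 0])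
      fix q s
      show "((\<lambda>s. f q (?p s)) has_derivative (\<lambda>h. pd j (f q) (?p s) * h)) (at s within UNIV)"
        using has_pd_DERIV[OF C2funD(2)[OF f]] by (simp add: has_field_derivative_def)
    next
      fix e :: real assume "e > 0"
      show "\<forall>\<^sub>F q in sequentially. \<forall>s\<in>UNIV. \<forall>h. norm (pd j (f q) (?p s) * h - g j (?p s) * h) \<le> e * norm h"
        using unif[OF \<open>e > 0\<close>]
        by (rule eventually_mono) (auto simp: left_diff_distrib[symmetric] abs_mult intro!: mult_right_mono)
    qed (use F(1) in auto)
    then obtain G where G: "\<And>s. (\<lambda>q. f q (?p s)) \<longlonglongrightarrow> G s" "\<And>s. (G has_derivative (\<lambda>h. g j (?p s) * h)) (at s)"
      by auto
    have "G = (\<lambda>s. F (?p s))" using LIMSEQ_unique[OF G(1) F(1)] by auto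
    then show "((\<lambda>s. F (?p s)) has_real_derivative g j x) (at 0)"
      using G(2)[of 0] by (simp add: has_field_derivative_def)
  qed
  have pF: "pd j F = g j" for j using has_pd_imp_pd[OF pdF] .
  define \<theta> where "\<theta> = r powr (1 - \<alpha>) * \<Lambda> powr \<alpha>"
  have c0: "0 \<le> c" using order_trans[OF abs_ge_zero inc[where q = 0]] by simp
  \<comment> \<open>\<open>2 * c\<close> and \<open>2 * M * (1 + \<Lambda>)\<close> are the sup and
    Lipschitz coefficients of an increment; \<open>B0\<close> is the analogue for the starting
    function.\<close>
  define B where "B = (2 * c) powr (1 - \<alpha>) * (2 * M * (1 + \<Lambda>)) powr \<alpha>"
  define B0 where "B0 = (2 * g0) powr (1 - \<alpha>) * (2 * M) powr \<alpha>"
  have \<theta>1: "0 \<le> \<theta>" "\<theta> < 1" using \<theta> by (auto simp: \<theta>_def)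
  have hol: "\<bar>g j x - g j y\<bar> \<le> (B / (1 - \<theta>) + B0) * dist x y powr \<alpha>" for j x y
  proof -
    define d where "d = dist x y"
    have d: "0 \<le> d" by (simp add: d_def)
    have lip: "\<bar>pd j (f q) x - pd j (f q) y\<bar> \<le> 2 * (M * \<Lambda>^q) * d" for q
      unfolding d_def by (rule has_pd_lipschitz[OF C2funD(4)[OF f] C2funD(6)[OF f]])
    let ?D = "\<lambda>q. pd j (f q) x - pd j (f q) y"
    have "\<bar>?D (Suc q) - ?D q\<bar> \<le> (B * d powr \<alpha>) * \<theta>^q" for q
    proof -
      have pr: "r^q = r powr real q" "\<Lambda>^q = \<Lambda> powr real q" using r \<Lambda> by (simp_all add: powr_realpow)
      have "\<bar>?D (Suc q) - ?D q\<bar> \<le> (2 * c * r^q) powr (1 - \<alpha>) * ((2 * M * (1 + \<Lambda>)) * \<Lambda>^q * d) powr \<alpha>"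
      proof (rule interpolate_powr)
        show "\<bar>?D (Suc q) - ?D q\<bar> \<le> 2 * c * r^q" using inc[of j q x] inc[of j q y] by linarith
        have "\<bar>?D (Suc q) - ?D q\<bar> \<le> 2 * (M * \<Lambda>^Suc q) * d + 2 * (M * \<Lambda>^q) * d"
          using lip[of q] lip[of "Suc q"] by linarith
        then show "\<bar>?D (Suc q) - ?D q\<bar> \<le> (2 * M * (1 + \<Lambda>)) * \<Lambda>^q * d" by (simp add: algebra_simps)
      qed (use \<alpha> in auto)
      also have "\<dots> = (B * d powr \<alpha>) * (r powr (real q * (1 - \<alpha>)) * \<Lambda> powr (real q * \<alpha>))"
        unfolding B_def pr using c0 M \<Lambda> d r by (simp add: powr_mult powr_powr)
      also have "r powr (real q * (1 - \<alpha>)) * \<Lambda> powr (real q * \<alpha>) = \<theta>^q"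
        unfolding \<theta>_def using r \<Lambda> by (simp add: power_mult_distrib powr_powr[symmetric] mult.commute[of "real q"] powr_realpow)
      finally show ?thesis .
    qed
    from geometric_increments[OF this \<theta>1] obtain L where L: "?D \<longlonglongrightarrow> L" "\<bar>L - ?D 0\<bar> \<le> B * d powr \<alpha> * \<theta>^0 / (1 - \<theta>)"
      by blast
    have "L = g j x - g j y" using LIMSEQ_unique[OF L(1) tendsto_diff[OF g(1) g(1)]] .
    moreover have "\<bar>?D 0\<bar> \<le> B0 * d powr \<alpha>"
    proof -
      have "\<bar>?D 0\<bar> \<le> (2 * g0) powr (1 - \<alpha>) * ((2 * M) * d) powr \<alpha>"
        by (rule interpolate_powr) (use g0[of j x] g0[of j y] lip[of 0] \<alpha> in auto)
      also have "\<dots> = B0 * d powr \<alpha>" unfolding B0_def using M d by (simp add: powr_mult)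
      finally show ?thesis .
    qed
    ultimately show ?thesis using L(2) unfolding d_def[symmetric] by (simp add: distrib_right)
  qed
  have bd: "\<bar>g j x\<bar> \<le> g0 + c / (1 - r)" for j x using g(2)[of j x 0] g0[of j x] by simp
  show ?thesis
    by (rule exI[of _ F]) (use pdF F(2)[of _ 0] g(1) bd hol in \<open>auto simp: pF\<close>)
qed

section \<open>Parameters and the infinite iteration\<close>

definition C1_Holder_pd :: "real \<Rightarrow> (real^2 \<Rightarrow> real) \<Rightarrow> bool" where
  "C1_Holder_pd \<alpha> F \<longleftrightarrow> (\<forall>j. has_pd j F (pd j F) \<and> (\<exists>B. \<forall>x. \<bar>pd j F x\<bar> \<le> B) \<and>
     (\<exists>K. \<forall>x y. \<bar>pd j F x - pd j F y\<bar> \<le> K * dist x y powr \<alpha>))"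

text \<open>The iteration uses \<open>\<delta>\<^sub>q = \<delta>\<^sub>1 \<Lambda>\<^bsup>-s q\<^esup>\<close> and \<open>M\<^sub>q = M\<^sub>1 \<Lambda>\<^sup>q\<close>. The three conditions on \<open>s\<close> are, in this order: three
  corrugations suffice for one stage, the first derivatives converge in C\<open>\<^sup>\<alpha>\<close>, and the mollification error of
  \<open>A\<close> is of lower order.\<close>

lemma exponent_choice:
  fixes \<alpha> \<beta> :: real
  assumes "0 < \<alpha>" "\<alpha> < 1/7" "\<alpha> < \<beta> / 2"
  shows "\<exists>s>0. s < 1/3 \<and> \<alpha> * (1 + s / 2) < s / 2 \<and> s \<le> \<beta> * (1 + s / 2)"
proof -
  have "2 * \<alpha> < min (2/7) \<beta>" using assms by simp
  then obtain y where y: "2 * \<alpha> < y" "y < min (2/7) \<beta>" using dense by blast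
  \<comment> \<open>The solution of \<open>s = y * (1 + s / 2)\<close>: all conditions bound
    \<open>s / (1 + s / 2)\<close>, which is \<open>y\<close>, and \<open>y < 2/7\<close> is
    equivalent to \<open>s < 1/3\<close>.\<close>
  define s where "s = y / (1 - y / 2)"
  have p: "0 < 1 - y / 2" using y by simp
  have s1: "1 + s / 2 = 1 / (1 - y / 2)" using p by (simp add: s_def field_simps)
  have "s = y * (1 + s / 2)" unfolding s1 by (simp add: s_def)
  moreover have "0 < 1 + s / 2" unfolding s1 using p by simp
  ultimately have "s \<le> \<beta> * (1 + s / 2)" "2 * \<alpha> * (1 + s / 2) < s"
    using y by (metis less_imp_le min_less_iff_conj mult_right_mono, metis mult_strict_right_mono)
  moreover have "0 < s" "s < 1/3" using y assms p by (simp_all add: s_def field_simps)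
  ultimately show ?thesis by (intro exI[of _ s]) auto
qed

lemma powr_large:
  fixes p T K :: real
  assumes "0 < p" "0 < T" "T powr (1 / p) \<le> K"
  shows "T \<le> K powr p"
proof -
  have "T = (T powr (1 / p)) powr p" using assms by (simp add: powr_powr)
  also have "\<dots> \<le> K powr p" by (rule powr_mono2) (use assms in auto)
  finally show ?thesis .
qed

text \<open>With \<Lambda> = \<open>C * K^3\<close>, the first condition reads
  \<open>C powr (1 + s) \<le> K powr (1 - 3 * s)\<close> and holds for large \<open>K\<close>
  because \<open>s < 1/3\<close>; it makes the corrugation error fit into the next deficit. The
  second makes the deficit drop by a factor of at least 4.\<close>

lemma frequency_choice:
  fixes C s :: real
  assumes C: "1 \<le> C" and s: "0 < s" "s < 1/3"
  shows "\<exists>K\<ge>1. C * (C * K^3) powr s \<le> K \<and> 4 \<le> (C * K^3) powr s"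
proof -
  define K where "K = max 1 (max ((C powr (1 + s)) powr (1 / (1 - 3 * s))) (4 powr (1 / s)))"
  have K: "1 \<le> K" "(C powr (1 + s)) powr (1 / (1 - 3 * s)) \<le> K" "4 powr (1 / s) \<le> K" by (auto simp: K_def)
  have 1: "C powr (1 + s) \<le> K powr (1 - 3 * s)" by (rule powr_large) (use K s C in auto)
  have k3: "K^3 = K powr 3" using K by (simp add: powr_numeral)
  have e: "(C * K^3) powr s = C powr s * K powr (3 * s)"
    unfolding k3 using C K by (simp add: powr_mult powr_powr del: powr_numeral)
  have "C * (C * K^3) powr s = C powr (1 + s) * K powr (3 * s)" unfolding e using C by (simp add: powr_add)
  also have "\<dots> \<le> K powr (1 - 3 * s) * K powr (3 * s)" by (rule mult_right_mono[OF 1]) simp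
  also have "\<dots> = K" using K by (simp add: powr_add[symmetric])
  finally have 2: "C * (C * K^3) powr s \<le> K" .
  have "4 \<le> K powr s" by (rule powr_large) (use K s in auto)
  also have "\<dots> \<le> (C * K^3) powr s"
  proof (rule powr_mono2)
    have "1 * K \<le> C * K^3" using C K self_le_power[of K 3] by (intro mult_mono) auto
    then show "K \<le> C * K^3" by simp
  qed (use s K in auto)
  finally show ?thesis using 2 K by blast
qed

text \<open>\<open>6 * l\<close> is the Euclidean reach of three averages. Dividing by
  \<open>H + 1\<close> instead of \<open>H\<close> covers \<open>H = 0\<close>.\<close>

lemma length_choice:
  fixes U E T :: real
  assumes "0 < U" "0 < E" "0 < T" "0 < \<beta>" "0 \<le> H"
  shows "\<exists>l>0. l \<le> U \<and> l \<le> E \<and> H * (6 * l) powr \<beta> \<le> T"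
proof -
  define l where "l = min U (min E ((T / (H + 1)) powr (1 / \<beta>) / 6))"
  have l: "0 < l" "l \<le> U" "l \<le> E" "6 * l \<le> (T / (H + 1)) powr (1 / \<beta>)" using assms by (auto simp: l_def)
  have "(6 * l) powr \<beta> \<le> ((T / (H + 1)) powr (1 / \<beta>)) powr \<beta>" using l assms by (intro powr_mono2) auto
  also have "\<dots> = T / (H + 1)" using assms by (simp add: powr_powr)
  finally have "H * (6 * l) powr \<beta> \<le> H * (T / (H + 1))" using assms by (intro mult_left_mono)
  also have "\<dots> \<le> T" using assms by (simp add: field_simps)
  finally show ?thesis using l by blast
qed

lemma Holder_imp_continuous:
  fixes f :: "real^2 \<Rightarrow> real"
  assumes "\<And>x y. \<bar>f x - f y\<bar> \<le> H * dist x y powr \<beta>" "0 < \<beta>"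
  shows "continuous_on UNIV f"
  unfolding continuous_on_def
proof
  fix x :: "real^2"
  have "((\<lambda>y. H * dist y x powr \<beta>) \<longlongrightarrow> H * 0) (at x within UNIV)"
  proof (intro tendsto_mult tendsto_const)
    have "((\<lambda>y. dist y x) \<longlongrightarrow> dist x x) (at x)" by (intro tendsto_dist tendsto_ident_at tendsto_const)
    then have "((\<lambda>y. dist y x) \<longlongrightarrow> 0) (at x)" by simp
    from tendsto_zero_powrI[OF this tendsto_const[of \<beta>]] show "((\<lambda>y. dist y x powr \<beta>) \<longlongrightarrow> 0) (at x within UNIV)"
      using assms(2) by simp
  qed
  then have lim: "((\<lambda>y. H * dist y x powr \<beta>) \<longlongrightarrow> 0) (at x within UNIV)" by simp
  have "((\<lambda>y. f y - f x) \<longlongrightarrow> 0) (at x within UNIV)"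
    by (rule Lim_null_comparison[OF _ lim]) (use assms(1) in simp)
  then show "(f \<longlongrightarrow> f x) (at x within UNIV)" by (simp add: LIM_zero_iff)
qed

text \<open>The constants are fixed in the order \<open>C0\<close>, \<open>G\<close>,
  \<open>C\<close>, \<open>K\<close>, \<open>l0\<close>, \<open>M1\<close>, each depending only on
  earlier ones and the data. As \<open>strain\<close> is symmetric in its indices, the entry (1,2)
  and the diagonal determine it.\<close>

lemma iteration:
  fixes A :: "2 \<Rightarrow> 2 \<Rightarrow> real^2 \<Rightarrow> real"
  assumes \<alpha>: "0 < \<alpha>" "\<alpha> < 1/7" "\<alpha> < \<beta> / 2" and H: "0 \<le> H"
    and A: "\<And>i j x y. \<bar>A i j x - A i j y\<bar> \<le> H * dist x y powr \<beta>"
    and \<delta>1: "0 < \<delta>1" "\<delta>1 \<le> 1" and v: "C2fun M0 v" and w: "\<And>j. C2fun M0 (w j)"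
    and Gv: "\<And>j x. \<bar>pd j v x\<bar> \<le> G0" and Gw0: "\<And>i j x. \<bar>pd i (w j) x\<bar> \<le> G0"
    and near: "deficit_near A v w \<delta>1" and \<epsilon>: "0 < \<epsilon>"
  shows "\<exists>v' w'. C1_Holder_pd \<alpha> v' \<and> (\<forall>j. C1_Holder_pd \<alpha> (w' j)) \<and> (\<forall>x. \<bar>v' x - v x\<bar> \<le> \<epsilon>) \<and>
     (\<forall>j x. \<bar>w' j x - w j x\<bar> \<le> \<epsilon>) \<and> (\<forall>x. strain v' w' 1 2 x = A 1 2 x) \<and> (\<forall>k x. strain v' w' k k x = A k k x)"
proof -
  have \<beta>: "0 < \<beta>" using \<alpha> by simp
  have cA: "continuous_on UNIV (A i j)" for i j by (rule Holder_imp_continuous[OF A \<beta>])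
  obtain s where s: "0 < s" "s < 1/3" "\<alpha> * (1 + s / 2) < s / 2" "s \<le> \<beta> * (1 + s / 2)"
    using exponent_choice[OF \<alpha>] by blast
  obtain C0 where C0: "1 \<le> C0" and st0: "\<And>G. 1 \<le> G \<Longrightarrow> \<exists>C\<ge>1. stage_possible C0 G C"
    using stage by blast
  \<comment> \<open>Valid at all stages: the gradient of \<open>v\<close> changes by at most
    \<open>C0\<close> times the sum of the \<open>r^k\<close>, and this sum is at most 2.\<close>
  define G where "G = max 1 (G0 + 2 * C0)"
  obtain C where C: "1 \<le> C" and st: "stage_possible C0 G C"
    using st0[of G] by (auto simp: G_def)
  obtain K where K: "1 \<le> K" "C * (C * K^3) powr s \<le> K" "4 \<le> (C * K^3) powr s"
    using frequency_choice[OF C s(1,2)] by blast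
  define \<Lambda> where "\<Lambda> = C * K^3"
  have \<Lambda>: "1 \<le> \<Lambda>" using mult_mono[of 1 C 1 "K^3"] C K by (simp add: \<Lambda>_def)
  have \<Lambda>1: "1 < \<Lambda>"
  proof (rule ccontr)
    assume "\<not> 1 < \<Lambda>"
    then have "\<Lambda> = 1" using \<Lambda> by simp
    then show False using K(3) by (simp add: \<Lambda>_def)
  qed
  define r where "r = \<Lambda> powr (- s / 2)"
  have r0: "0 < r" using \<Lambda> by (simp add: r_def)
  have r2: "r^2 = 1 / \<Lambda> powr s"
    unfolding r_def using \<Lambda> by (simp add: power2_eq_square powr_add[symmetric] powr_minus_divide)
  have "r^2 \<le> 1/4" unfolding r2 using le_imp_inverse_le[OF K(3)] by (simp add: \<Lambda>_def[symmetric] inverse_eq_divide)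
  then have r: "r \<le> 1/2" using power2_le_imp_le[of r "1/2"] by (simp add: power2_eq_square)
  have CK: "C / K \<le> r^2" unfolding r2 using K C \<Lambda> by (simp add: \<Lambda>_def[symmetric] field_simps)
  have \<theta>: "r powr (1 - \<alpha>) * \<Lambda> powr \<alpha> < 1"
  proof -
    have "r powr (1 - \<alpha>) * \<Lambda> powr \<alpha> = \<Lambda> powr (\<alpha> * (1 + s / 2) - s / 2)"
    proof -
      have "- s / 2 * (1 - \<alpha>) + \<alpha> = \<alpha> * (1 + s / 2) - s / 2" by (simp add: field_simps)
      then show ?thesis unfolding r_def using \<Lambda> by (simp only: powr_powr powr_add[symmetric])
    qed
    also have "\<dots> < \<Lambda> powr 0" using s(3) \<Lambda>1 by (intro powr_less_mono) auto
    finally show ?thesis using \<Lambda> by simp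
  qed
  \<comment> \<open>The ratio of consecutive mollification lengths.
    \<open>X powr \<beta> \<le> r^2\<close> will say that the oscillation of \<open>A\<close> at
    these lengths decays at least as fast as the deficit.\<close>
  define X where "X = r / \<Lambda>"
  have X: "0 < X" "X \<le> 1/2" using r0 r \<Lambda> by (auto simp: X_def field_simps)
  have X\<beta>: "X powr \<beta> \<le> r^2"
  proof -
    have "X = \<Lambda> powr (- s / 2 - 1)" unfolding X_def r_def using \<Lambda> by (simp add: powr_diff)
    then have "X powr \<beta> = \<Lambda> powr (- (\<beta> * (1 + s / 2)))" 
    proof -
      have "(- s / 2 - 1) * \<beta> = - (\<beta> * (1 + s / 2))" by (simp add: field_simps)
      then show ?thesis unfolding \<open>X = \<Lambda> powr (- s / 2 - 1)\<close> by (simp only: powr_powr)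
    qed
    also have "\<dots> \<le> \<Lambda> powr (- s)" using s(4) \<Lambda> by (intro powr_mono) auto
    finally show ?thesis unfolding r2 using \<Lambda> by (simp add: powr_minus_divide)
  qed
  have sumr: "(\<Sum>k<q. r^k) \<le> 2" for q
  proof -
    have "(\<Sum>k<q. r^k) = (1 - r^q) / (1 - r)" using r by (simp add: sum_gp_strict)
    also have "\<dots> \<le> 1 / (1 - r)" using r r0 by (intro divide_right_mono) auto
    also have "\<dots> \<le> 2" using r by (simp add: field_simps)
    finally show ?thesis .
  qed
  define Gw where "Gw = G0 + 2 * C"
  have G00: "0 \<le> G0" using order_trans[OF abs_ge_zero Gv] .
  have Gw1: "0 \<le> Gw" using G00 C by (simp add: Gw_def)
  obtain l0 where l0: "0 < l0" "l0 \<le> sqrt \<delta>1 / (400 * (\<bar>M0\<bar> + 1))" "l0 \<le> \<epsilon> / (2 * C * (1 + Gw))"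
    "H * (6 * l0) powr \<beta> \<le> \<delta>1 * r^2 / 64"
    using length_choice[of "sqrt \<delta>1 / (400 * (\<bar>M0\<bar> + 1))" "\<epsilon> / (2 * C * (1 + Gw))" "\<delta>1 * r^2 / 64" \<beta> H] \<delta>1 \<epsilon> C Gw1 \<beta> H r0
    by auto
  \<comment> \<open>Closeness to the data is bought by a large \<open>M1\<close>: it makes the first
    mollification length equal to the small \<open>l0\<close>, and \<open>M0 \<le> M1\<close> lets
    the data pass as \<open>C2fun M1\<close>.\<close>
  define M1 where "M1 = sqrt \<delta>1 / (400 * l0)"
  have M1: "0 < M1" "M0 \<le> M1"
  proof -
    show "0 < M1" using \<delta>1 l0 by (simp add: M1_def)
    have "M0 \<le> \<bar>M0\<bar> + 1" by simp
    also have "\<dots> \<le> M1" using l0(1,2) \<delta>1 unfolding M1_def by (simp add: field_simps)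
    finally show "M0 \<le> M1" .
  qed
  have l0M: "l0 = sqrt \<delta>1 / (400 * M1)" using l0 \<delta>1 by (simp add: M1_def)
  define \<delta> where "\<delta> = (\<lambda>q::nat. \<delta>1 * r^(2*q))"
  define M where "M = (\<lambda>q::nat. M1 * \<Lambda>^q)"
  define l where "l = (\<lambda>q::nat. sqrt (\<delta> q) / (400 * M q))"
  have sq\<delta>: "sqrt (\<delta> q) = sqrt \<delta>1 * r^q" "sqrt (\<delta> q) \<le> r^q" for q
  proof -
    show 1: "sqrt (\<delta> q) = sqrt \<delta>1 * r^q" using r0 by (simp add: \<delta>_def real_sqrt_mult mult.commute[of 2] power_mult)
    show "sqrt (\<delta> q) \<le> r^q" unfolding 1 using \<delta>1 r0 by (simp add: mult_left_le_one_le)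
  qed
  have lq: "l q = l0 * X^q" for q unfolding l_def sq\<delta> M_def l0M X_def using M1 \<Lambda> by (simp add: power_divide)
  have lq0: "0 < l q" "l q \<le> l0 * (1/2)^q" for q
    unfolding lq using l0 X by (auto intro!: mult_left_mono power_mono)
  \<comment> \<open>The last clause pins the start of the sequence produced by dependent
    choice.\<close>
  define Inv where "Inv = (\<lambda>q (p :: (real^2 \<Rightarrow> real) \<times> (2 \<Rightarrow> real^2 \<Rightarrow> real)). C2fun (M q) (fst p) \<and> (\<forall>j. C2fun (M q) (snd p j)) \<and>
     (\<forall>j x. \<bar>pd j (fst p) x\<bar> \<le> G0 + C0 * (\<Sum>k<q. r^k)) \<and> (\<forall>i j x. \<bar>pd i (snd p j) x\<bar> \<le> G0 + C * (\<Sum>k<q. r^k)) \<and>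
     deficit_near A (fst p) (snd p) (\<delta> q) \<and> (q = 0 \<longrightarrow> p = (v, w)))"
  define Stp where "Stp = (\<lambda>q (p :: (real^2 \<Rightarrow> real) \<times> (2 \<Rightarrow> real^2 \<Rightarrow> real)) p'. improved A (fst p) (snd p) (\<delta> q) (\<delta> (Suc q)) (M (Suc q)) C0 C Gw (l q) (fst p') (snd p'))"
  obtain f where f: "\<And>q. Inv q (f q)" "\<And>q. Stp q (f q) (f (Suc q))"
  proof -
    have "\<exists>f. \<forall>q. Inv q (f q) \<and> Stp q (f q) (f (Suc q))"
    proof (rule dependent_nat_choice)
      show "\<exists>p. Inv 0 p"
        by (rule exI[of _ "(v, w)"])
           (use near Gv Gw0 C2fun_mono[OF v M1(2)] C2fun_mono[OF w M1(2)] in \<open>simp add: Inv_def M_def \<delta>_def\<close>)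
    next
      fix p q assume Ip: "Inv q p"
      obtain v w where p: "p = (v, w)" by (cases p)
      have I: "C2fun (M q) v" "\<forall>j. C2fun (M q) (w j)" "\<And>j x. \<bar>pd j v x\<bar> \<le> G0 + C0 * (\<Sum>k<q. r^k)"
        "\<And>i j x. \<bar>pd i (w j) x\<bar> \<le> G0 + C * (\<Sum>k<q. r^k)" "deficit_near A v w (\<delta> q)"
        using Ip unfolding Inv_def p by auto
      have "\<exists>v' w'. improved A v w (\<delta> q) (\<delta> (Suc q)) (C * K^3 * M q) C0 C Gw (l q) v' w'"
      proof (rule st[unfolded stage_possible_def, rule_format])
        show d: "0 < \<delta> q" "0 < \<delta> (Suc q)" using \<delta>1 r0 by (auto simp: \<delta>_def)
        show "\<delta> q \<le> 1" unfolding \<delta>_def using \<delta>1 r0 r by (intro mult_le_one power_le_one) auto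
        have ds: "\<delta> (Suc q) = r^2 * \<delta> q" by (simp add: \<delta>_def power2_eq_square)
        then show "\<delta> (Suc q) \<le> \<delta> q / 4" using mult_right_mono[OF \<open>r^2 \<le> 1/4\<close>, of "\<delta> q"] d by simp
        show "1 \<le> K" by (rule K)
        show "0 < M q" using M1 \<Lambda> by (simp add: M_def)
        show "l q = sqrt (\<delta> q) / (400 * M q)" by (simp add: l_def)
        show "C * \<delta> q / K \<le> \<delta> (Suc q)" using mult_right_mono[OF CK, of "\<delta> q"] d ds by simp
        show "C2fun (M q) v" "C2fun (M q) (w j)" for j using I by auto
        show "continuous_on UNIV (A i j)" for i j by (rule cA)
        show "deficit_near A v w (\<delta> q)" by (rule I)
        fix j x
        have "C0 * (\<Sum>k<q. r^k) \<le> C0 * 2" using C0 sumr by (intro mult_left_mono) auto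
        then show "\<bar>pd j v x\<bar> \<le> G" using I(3)[of j x] by (simp add: G_def)
        have "C * (\<Sum>k<q. r^k) \<le> C * 2" using C sumr by (intro mult_left_mono) auto
        then show "\<bar>pd i (w j) x\<bar> \<le> Gw" for i using I(4)[of i j x] by (simp add: Gw_def)
        fix i y assume y: "y \<in> cube x (3 * l q)"
        have "\<bar>A i j y - A i j x\<bar> \<le> H * dist y x powr \<beta>" by (rule A)
        also have "\<dots> \<le> H * (6 * l q) powr \<beta>"
          using cube_dist[OF y] H \<beta> by (intro mult_left_mono powr_mono2) auto
        also have "(6 * l q) powr \<beta> = (6 * l0) powr \<beta> * (X powr \<beta>)^q"
          unfolding lq using l0 X by (simp add: powr_mult powr_powr powr_realpow[symmetric] mult.commute)
        also have "H * ((6 * l0) powr \<beta> * (X powr \<beta>)^q) \<le> H * ((6 * l0) powr \<beta> * (r^2)^q)"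
          using X\<beta> H by (intro mult_left_mono power_mono) auto
        also have "\<dots> = (H * (6 * l0) powr \<beta>) * (r^2)^q" by simp
        also have "\<dots> \<le> (\<delta>1 * r^2 / 64) * (r^2)^q" by (rule mult_right_mono[OF l0(4)]) simp
        also have "\<dots> = \<delta> (Suc q) / 64" by (simp add: \<delta>_def power_mult)
        finally show "\<bar>A i j y - A i j x\<bar> \<le> \<delta> (Suc q) / 64" .
      qed
      moreover have "C * K^3 * M q = M (Suc q)" by (simp add: M_def \<Lambda>_def)
      ultimately obtain v' w' where im: "improved A v w (\<delta> q) (\<delta> (Suc q)) (M (Suc q)) C0 C Gw (l q) v' w'" by auto
      have "Inv (Suc q) (v', w')"
        unfolding Inv_def fst_conv snd_conv
      proof (intro conjI allI)
        show "C2fun (M (Suc q)) v'" "C2fun (M (Suc q)) (w' j)" "deficit_near A v' w' (\<delta> (Suc q))" for j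
          using im by (auto simp: improved_def)
        fix j x
        have "C0 * sqrt (\<delta> q) \<le> C0 * r^q" "C * sqrt (\<delta> q) \<le> C * r^q" using sq\<delta>(2) C0 C by (auto intro!: mult_left_mono)
        moreover have "\<bar>pd j v' x - pd j v x\<bar> \<le> C0 * sqrt (\<delta> q)" "\<bar>pd i (w' j) x - pd i (w j) x\<bar> \<le> C * sqrt (\<delta> q)" for i
          using im by (auto simp: improved_def)
        ultimately show "\<bar>pd j v' x\<bar> \<le> G0 + C0 * (\<Sum>k<Suc q. r^k)" "\<bar>pd i (w' j) x\<bar> \<le> G0 + C * (\<Sum>k<Suc q. r^k)" for i
          using I(3)[of j x] I(4)[of i j x] unfolding sum.lessThan_Suc distrib_left by (smt (verit))+
      qed simp
      then show "\<exists>p'. Inv (Suc q) p' \<and> Stp q p p'"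
        using im by (intro exI[of _ "(v', w')"]) (simp add: Stp_def p)
    qed
    then show ?thesis using that by blast
  qed
  define V where "V = (\<lambda>q. fst (f q))"
  define W where "W = (\<lambda>q. snd (f q))"
  have V0: "V 0 = v" "W 0 = w" using f(1)[of 0] by (auto simp: Inv_def V_def W_def)
  have cV: "C2fun (M1 * \<Lambda>^q) (V q)" "C2fun (M1 * \<Lambda>^q) (W q j)" "deficit_near A (V q) (W q) (\<delta> q)" for q j
    using f(1)[of q] by (auto simp: Inv_def V_def W_def M_def)
  have im: "\<bar>V (Suc q) x - V q x\<bar> \<le> C * l q" "\<bar>W (Suc q) j x - W q j x\<bar> \<le> C * (1 + Gw) * l q"
    "\<bar>pd j (V (Suc q)) x - pd j (V q) x\<bar> \<le> C0 * sqrt (\<delta> q)"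
    "\<bar>pd i (W (Suc q) j) x - pd i (W q j) x\<bar> \<le> C * sqrt (\<delta> q)" for q i j x
    using f(2)[of q] by (auto simp: Stp_def improved_def V_def W_def)
  have aeps: "C * (1 + Gw) * l0 / (1 - 1/2) \<le> \<epsilon>"
  proof -
    have "0 < 2 * C * (1 + Gw)" using C Gw1 by simp
    then have "l0 * (2 * C * (1 + Gw)) \<le> \<epsilon>" using l0(3) by (simp only: pos_le_divide_eq)
    moreover have "C * (1 + Gw) * l0 / (1 - 1/2) = l0 * (2 * C * (1 + Gw))" by simp
    ultimately show ?thesis by (simp only:)
  qed
  have lb: "C * (1 + Gw) * l q \<le> C * (1 + Gw) * l0 * (1/2)^q" for q
    using mult_left_mono[OF lq0(2)[of q], of "C * (1 + Gw)"] C Gw1 by (simp add: mult.assoc)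
  have cl: "C * l q \<le> C * (1 + Gw) * l q" for q
  proof (rule mult_right_mono)
    show "C \<le> C * (1 + Gw)" using mult_left_mono[of 1 "1 + Gw" C] C Gw1 by simp
  qed (use lq0(1)[of q] in simp)
  have \<alpha>1: "\<alpha> < 1" using \<alpha> by simp
  have r1: "r < 1" using r by simp
  have "\<exists>F. (\<forall>j. has_pd j F (pd j F)) \<and> (\<forall>x. \<bar>F x - V 0 x\<bar> \<le> C * (1 + Gw) * l0 / (1 - 1/2)) \<and>
     (\<forall>j x. (\<lambda>q. pd j (V q) x) \<longlonglongrightarrow> pd j F x) \<and> (\<forall>j x. \<bar>pd j F x\<bar> \<le> G0 + C0 / (1 - r)) \<and>
     (\<exists>K. \<forall>j x y. \<bar>pd j F x - pd j F y\<bar> \<le> K * dist x y powr \<alpha>)"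
  proof (rule C1_Holder_limit[OF cV(1)])
    show "\<bar>V (Suc q) x - V q x\<bar> \<le> C * (1 + Gw) * l0 * (1/2)^q" for q x
      by (rule order_trans[OF im(1) order_trans[OF cl lb]])
    show "\<bar>pd j (V (Suc q)) x - pd j (V q) x\<bar> \<le> C0 * r^q" for q j x
      by (rule order_trans[OF im(3)]) (use sq\<delta>(2) C0 in \<open>simp add: mult_left_mono\<close>)
  qed (use V0 Gv r0 r1 \<Lambda> M1 \<alpha> \<alpha>1 \<theta> in auto)
  then obtain v' where v': "\<forall>j. has_pd j v' (pd j v')" "\<forall>x. \<bar>v' x - V 0 x\<bar> \<le> C * (1 + Gw) * l0 / (1 - 1/2)"
     "\<forall>j x. (\<lambda>q. pd j (V q) x) \<longlonglongrightarrow> pd j v' x" "\<forall>j x. \<bar>pd j v' x\<bar> \<le> G0 + C0 / (1 - r)"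
     "\<exists>K. \<forall>j x y. \<bar>pd j v' x - pd j v' y\<bar> \<le> K * dist x y powr \<alpha>" by blast
  have "\<exists>F. (\<forall>i. has_pd i F (pd i F)) \<and> (\<forall>x. \<bar>F x - W 0 j x\<bar> \<le> C * (1 + Gw) * l0 / (1 - 1/2)) \<and>
     (\<forall>i x. (\<lambda>q. pd i (W q j) x) \<longlonglongrightarrow> pd i F x) \<and> (\<forall>i x. \<bar>pd i F x\<bar> \<le> G0 + C / (1 - r)) \<and>
     (\<exists>K. \<forall>i x y. \<bar>pd i F x - pd i F y\<bar> \<le> K * dist x y powr \<alpha>)" for j
  proof (rule C1_Holder_limit[OF cV(2)])
    show "\<bar>W (Suc q) j x - W q j x\<bar> \<le> C * (1 + Gw) * l0 * (1/2)^q" for q x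
      by (rule order_trans[OF im(2) lb])
    show "\<bar>pd i (W (Suc q) j) x - pd i (W q j) x\<bar> \<le> C * r^q" for q i x
      by (rule order_trans[OF im(4)]) (use sq\<delta>(2) C in \<open>simp add: mult_left_mono\<close>)
  qed (use V0 Gw0 r0 r1 \<Lambda> M1 \<alpha> \<alpha>1 \<theta> in auto)
  then obtain w' where w': "\<And>j. \<forall>i. has_pd i (w' j) (pd i (w' j))" "\<And>j. \<forall>x. \<bar>w' j x - W 0 j x\<bar> \<le> C * (1 + Gw) * l0 / (1 - 1/2)"
     "\<And>j. \<forall>i x. (\<lambda>q. pd i (W q j) x) \<longlonglongrightarrow> pd i (w' j) x" "\<And>j. \<forall>i x. \<bar>pd i (w' j) x\<bar> \<le> G0 + C / (1 - r)"
     "\<And>j. \<exists>K. \<forall>i x y. \<bar>pd i (w' j) x - pd i (w' j) y\<bar> \<le> K * dist x y powr \<alpha>" by metis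
  have sqlim: "(\<lambda>q. strain (V q) (W q) i j x) \<longlonglongrightarrow> strain v' w' i j x" for i j x
    unfolding strain_def using v'(3) w'(3) by (intro tendsto_add tendsto_mult) blast+
  have \<delta>lim: "\<delta> \<longlonglongrightarrow> 0"
  proof -
    have "\<delta> = (\<lambda>q. \<delta>1 * (r^2)^q)" by (simp add: \<delta>_def power_mult)
    moreover have "(\<lambda>q. \<delta>1 * (r^2)^q) \<longlonglongrightarrow> \<delta>1 * 0"
      using \<open>r^2 \<le> 1/4\<close> by (intro tendsto_mult tendsto_const LIMSEQ_realpow_zero) auto
    ultimately show ?thesis by simp
  qed
  have \<delta>0: "0 \<le> \<delta> q" for q using \<delta>1 by (simp add: \<delta>_def power_mult)
  \<comment> \<open>The diagonal entries of the deficit are close to \<open>2 * \<delta> q\<close>,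
    hence the factor 3.\<close>
  have z: "a = 0" if "u \<longlonglongrightarrow> a" "\<And>q. \<bar>u q\<bar> \<le> 3 * \<delta> q" for u :: "nat \<Rightarrow> real" and a
  proof -
    have "u \<longlonglongrightarrow> 0"
      by (rule Lim_null_comparison[of _ "\<lambda>q. 3 * \<delta> q"]) (use that(2) tendsto_mult[OF tendsto_const[of 3] \<delta>lim] in auto)
    then show ?thesis using that(1) LIMSEQ_unique by blast
  qed
  have e12: "A 1 2 x - strain v' w' 1 2 x = 0" for x
  proof (rule z[OF tendsto_diff[OF tendsto_const sqlim]])
    show "\<bar>A 1 2 x - strain (V q) (W q) 1 2 x\<bar> \<le> 3 * \<delta> q" for q
      using cV(3)[of q, unfolded deficit_near_def, rule_format, of x] \<delta>0[of q] by linarith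
  qed
  have ekk: "A k k x - strain v' w' k k x = 0" for k x
  proof (rule z[OF tendsto_diff[OF tendsto_const sqlim]])
    show "\<bar>A k k x - strain (V q) (W q) k k x\<bar> \<le> 3 * \<delta> q" for q
    proof -
      have "\<bar>(A 1 2 x - strain (V q) (W q) 1 2 x) - \<delta> q\<bar> \<le> \<delta> q / 8"
        "\<bar>(A k k x - strain (V q) (W q) k k x) - (A 1 2 x - strain (V q) (W q) 1 2 x) - \<delta> q\<bar> \<le> \<delta> q / 8"
        using cV(3)[of q] unfolding deficit_near_def by blast+
      then show ?thesis using \<delta>0[of q] by linarith
    qed
  qed
  have "\<bar>v' x - v x\<bar> \<le> \<epsilon>" "\<bar>w' j x - w j x\<bar> \<le> \<epsilon>" for j x
    using order_trans[OF v'(2)[rule_format] aeps] order_trans[OF w'(2)[rule_format] aeps] by (auto simp: V0)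
  moreover have "C1_Holder_pd \<alpha> v'" using v' unfolding C1_Holder_pd_def by metis
  moreover have "C1_Holder_pd \<alpha> (w' j)" for j using w'(1,4,5)[of j] unfolding C1_Holder_pd_def by metis
  ultimately show ?thesis using e12 ekk by (intro exI[of _ v'] exI[of _ w']) auto
qed

section \<open>The initial stage\<close>

text \<open>The qualitative form of \<open>Jet\<close>: finitely many preparatory steps need no
  record of frequencies.\<close>

definition Cb :: "nat \<Rightarrow> (real^2 \<Rightarrow> real) \<Rightarrow> bool" where
  "Cb n f \<longleftrightarrow> (\<exists>C\<ge>0. Jet n UNIV C 1 f)"

lemma Jet_imp_Cb: "Jet n UNIV C m f \<Longrightarrow> 0 \<le> C \<Longrightarrow> 0 \<le> m \<Longrightarrow> Cb n f"
  unfolding Cb_def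
  using Jet_rescale[of n UNIV C "max 1 m" 1 f] Jet_mono[of n UNIV C m f C "max 1 m"]
  by (intro exI[of _ "(max 1 m)^n * C"]) auto

lemma Cb_le: "Cb n f \<Longrightarrow> k \<le> n \<Longrightarrow> Cb k f"
  unfolding Cb_def using Jet_le by blast

lemma Cb_bound: "Cb n f \<Longrightarrow> \<exists>C\<ge>0. \<forall>x. \<bar>f x\<bar> \<le> C"
  unfolding Cb_def using Jet_bound by blast

lemma Cb_add:
  assumes "Cb n f" "Cb n g" shows "Cb n (\<lambda>x. f x + g x)"
proof -
  obtain C C' where "C \<ge> 0" "Jet n UNIV C 1 f" "C' \<ge> 0" "Jet n UNIV C' 1 g" using assms by (auto simp: Cb_def)
  then show ?thesis unfolding Cb_def by (intro exI[of _ "C + C'"] conjI Jet_add) auto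
qed

lemma Cb_diff:
  assumes "Cb n f" "Cb n g" shows "Cb n (\<lambda>x. f x - g x)"
proof -
  obtain C C' where "C \<ge> 0" "Jet n UNIV C 1 f" "C' \<ge> 0" "Jet n UNIV C' 1 g" using assms by (auto simp: Cb_def)
  then show ?thesis unfolding Cb_def by (intro exI[of _ "C + C'"] conjI Jet_diff) auto
qed

lemma Cb_mult:
  assumes "Cb n f" "Cb n g" shows "Cb n (\<lambda>x. f x * g x)"
proof -
  obtain C C' where "C \<ge> 0" "Jet n UNIV C 1 f" "C' \<ge> 0" "Jet n UNIV C' 1 g" using assms by (auto simp: Cb_def)
  then show ?thesis unfolding Cb_def by (intro exI[of _ "2^n * C * C'"] conjI Jet_mult) auto
qed

lemma Cb_const: "Cb n (\<lambda>x. c)"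
  unfolding Cb_def by (intro exI[of _ "\<bar>c\<bar>"]) (simp add: Jet_const)

lemma Cb_power: "Cb n f \<Longrightarrow> Cb n (\<lambda>x. f x ^ k)"
  by (induction k) (auto intro: Cb_const Cb_mult)

lemma Cb_sum: "finite I \<Longrightarrow> (\<And>k. k \<in> I \<Longrightarrow> Cb n (f k)) \<Longrightarrow> Cb n (\<lambda>x. \<Sum>k\<in>I. f k x)"
  by (induction I rule: finite_induct) (auto intro: Cb_const Cb_add)

lemma Cb_powr:
  assumes "Cb n f" "0 < lo" "\<And>x. lo \<le> f x" shows "Cb n (\<lambda>x. f x powr r)"
proof -
  obtain C where C: "C \<ge> 0" "Jet n UNIV C 1 f" using assms(1) by (auto simp: Cb_def)
  have "\<forall>x. lo \<le> f x \<and> f x \<le> C" using assms(3) Jet_bound[OF C(2)] by (auto simp: abs_le_iff)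
  then show ?thesis using Jet_powr[OF assms(2) C(1), where n = n and r = r and hi = C] C
    unfolding Cb_def by (metis zero_le_one)
qed

lemma Cb_strainrt:
  assumes "Cb n f" "0 < lo" "\<And>x. lo \<le> f x" shows "\<exists>a. Cb n a \<and> (\<forall>x. (a x)^2 = f x)"
proof (intro exI conjI allI)
  show "Cb n (\<lambda>x. f x powr (1/2))" by (rule Cb_powr[OF assms])
  fix x have "0 < f x" using assms(2) assms(3)[of x] by linarith
  then show "(f x powr (1/2))^2 = f x" by (simp add: powr_half_sqrt)
qed

lemma Cb_pd:
  assumes "Cb (Suc n) f" shows "has_pd i f (pd i f)" "Cb n (pd i f)"
proof -
  obtain C where C: "C \<ge> 0" "Jet (Suc n) UNIV C 1 f" using assms by (auto simp: Cb_def)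
  show "has_pd i f (pd i f)" by (rule Jet_pd[OF C(2)])
  show "Cb n (pd i f)" using Jet_pd(2)[OF C(2), of i] C(1) by (auto simp: Cb_def)
qed

lemma Cb_strain:
  assumes "Cb (Suc n) v" "\<And>j. Cb (Suc n) (w j)" shows "Cb n (strain v w i j)"
  unfolding strain_def[abs_def] by (intro Cb_add Cb_mult Cb_pd assms)

lemma Cb_C2fun: "Cb 2 f \<Longrightarrow> \<exists>M. C2fun M f"
  unfolding Cb_def using Jet_C2fun by blast

text \<open>With smooth data and a given amplitude nothing has to be mollified: the error is a
  constant over \<open>L\<close>, and a single large frequency makes it and the displacements
  smaller than \<open>\<tau>\<close>.\<close>

lemma smooth_step:
  assumes v: "Cb 3 v" and w: "\<And>j. Cb 2 (w j)" and a: "Cb 3 a" and \<tau>: "0 < \<tau>"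
  shows "\<exists>v' w'. Cb 3 v' \<and> (\<forall>j. Cb 2 (w' j)) \<and> (\<forall>x. \<bar>v' x - v x\<bar> \<le> \<tau>) \<and> (\<forall>j x. \<bar>w' j x - w j x\<bar> \<le> \<tau>) \<and>
     (\<forall>i j x. \<bar>strain v' w' i j x - strain v w i j x - (a x)^2 * n $ i * n $ j\<bar> \<le> \<tau>)"
proof -
  obtain \<alpha> where \<alpha>: "0 \<le> \<alpha>" "Jet 3 UNIV \<alpha> 1 a" using a by (auto simp: Cb_def)
  obtain G where G: "0 \<le> G" "Jet (Suc 2) UNIV G 1 v" using v by (auto simp: Cb_def eval_nat_numeral)
  have Gp: "has_pd j v (pd j v)" "Jet (Suc 1) UNIV G 1 (pd j v)" for j
    using Jet_pd[OF G(2), of j] by (simp_all add: numeral_2_eq_2)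
  have Gpp: "\<bar>pd i (pd j v) x\<bar> \<le> G" for i j x using Jet_bound[OF Jet_pd(2)[OF Gp(2)], of x i j] by simp
  have w1: "has_pd i (w j) (pd i (w j))" for i j using Cb_pd(1)[of 1 "w j" i] w by (simp add: numeral_2_eq_2)
  define \<nu> where "\<nu> = max 1 (norm n)"
  have \<nu>: "1 \<le> \<nu>" "\<bar>n $ i\<bar> \<le> \<nu>" for i
    using component_le_norm_cart[of n i] by (auto simp: \<nu>_def)
  define c1 where "c1 = 64 * \<nu>^3 * \<alpha>"
  define c2 where "c2 = 64 * \<nu>^3 * (\<alpha> * G + \<alpha>^2)"
  have c: "0 \<le> c1" "0 \<le> c2" using \<alpha> \<nu> G by (auto simp: c1_def c2_def)
  define L where "L = 1 + (c1 + c2) / \<tau>"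
  have L: "1 \<le> L" "c1 / L \<le> \<tau>" "c2 / L \<le> \<tau>" using c \<tau> by (auto simp: L_def field_simps add_increasing)
  have "\<exists>b h. Jet 3 UNIV (64 * \<nu>^3 * \<alpha> / L) L b \<and>
     (\<forall>j. Jet 2 UNIV (64 * \<nu>^3 * (\<alpha> * G + \<alpha>^2) / L) L (h j)) \<and>
     (\<forall>i j x. \<bar>strain (\<lambda>x. v x + b x) (\<lambda>j x. w j x + h j x) i j x - strain v w i j x - (a x)^2 * n $ i * n $ j\<bar>
        \<le> 64 * \<nu>^3 * (\<alpha> * G + \<alpha>^2 * 1) / L)"
  proof (rule corrugation_step[OF \<nu>(2) \<nu>(1) zero_less_one L(1) \<alpha>(1) G(1) \<alpha>(2) Gp(1) _ Gpp w1])
    show "Jet 2 UNIV G L (pd j v)" for j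
      using Jet_mono[OF Gp(2)[of j] G(1) _ order_refl L(1)] by (simp add: numeral_2_eq_2)
  qed
  then obtain b h where b: "Jet 3 UNIV (c1 / L) L b" and h: "\<And>j. Jet 2 UNIV (c2 / L) L (h j)"
    and e: "\<And>i j x. \<bar>strain (\<lambda>x. v x + b x) (\<lambda>j x. w j x + h j x) i j x - strain v w i j x - (a x)^2 * n $ i * n $ j\<bar> \<le> c2 / L"
    unfolding c1_def c2_def by auto
  have cL: "0 \<le> c1 / L" "0 \<le> c2 / L" "0 \<le> L" using c L by auto
  show ?thesis
  proof (intro exI[of _ "\<lambda>x. v x + b x"] exI[of _ "\<lambda>j x. w j x + h j x"] conjI allI)
    show "Cb 3 (\<lambda>x. v x + b x)" by (intro Cb_add v Jet_imp_Cb[OF b cL(1,3)])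
    show "Cb 2 (\<lambda>x. w j x + h j x)" for j by (intro Cb_add w Jet_imp_Cb[OF h cL(2,3)])
    show "\<bar>v x + b x - v x\<bar> \<le> \<tau>" for x using Jet_bound[OF b, of x] L by simp
    show "\<bar>w j x + h j x - w j x\<bar> \<le> \<tau>" for j x using Jet_bound[OF h, of x j] L by simp
    show "\<bar>strain (\<lambda>x. v x + b x) (\<lambda>j x. w j x + h j x) i j x - strain v w i j x - (a x)^2 * n $ i * n $ j\<bar> \<le> \<tau>" for i j x
      using order_trans[OF e L(3)] .
  qed
qed

text \<open>The amplitudes are prescribed in advance, so no derivatives are lost from one direction
  to the next; the increments of the strain simply add up.\<close>

lemma smooth_steps:
  fixes N :: nat
  assumes v: "Cb 3 v" and w: "\<And>j. Cb 2 (w j)"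
  shows "\<forall>k<N. Cb 3 (a k) \<Longrightarrow> 0 < \<tau> \<Longrightarrow> \<exists>v' w'. Cb 3 v' \<and> (\<forall>j. Cb 2 (w' j)) \<and> (\<forall>x. \<bar>v' x - v x\<bar> \<le> \<tau>) \<and> (\<forall>j x. \<bar>w' j x - w j x\<bar> \<le> \<tau>) \<and>
     (\<forall>i j x. \<bar>strain v' w' i j x - strain v w i j x - (\<Sum>k<N. (a k x)^2 * n k $ i * n k $ j)\<bar> \<le> \<tau>)"
proof (induction N arbitrary: \<tau>)
  case 0 then show ?case using v w by (intro exI[of _ v] exI[of _ w]) auto
next
  case (Suc N)
  have "0 < \<tau> / 2" using Suc.prems by simp
  have "\<exists>v' w'. Cb 3 v' \<and> (\<forall>j. Cb 2 (w' j)) \<and> (\<forall>x. \<bar>v' x - v x\<bar> \<le> \<tau> / 2) \<and> (\<forall>j x. \<bar>w' j x - w j x\<bar> \<le> \<tau> / 2) \<and>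
     (\<forall>i j x. \<bar>strain v' w' i j x - strain v w i j x - (\<Sum>k<N. (a k x)^2 * n k $ i * n k $ j)\<bar> \<le> \<tau> / 2)"
    by (rule Suc.IH[OF _ \<open>0 < \<tau> / 2\<close>]) (use Suc.prems(1) in simp)
  then obtain v1 w1 where 1: "Cb 3 v1" "\<forall>j. Cb 2 (w1 j)" "\<forall>x. \<bar>v1 x - v x\<bar> \<le> \<tau> / 2" "\<forall>j x. \<bar>w1 j x - w j x\<bar> \<le> \<tau> / 2"
     "\<forall>i j x. \<bar>strain v1 w1 i j x - strain v w i j x - (\<Sum>k<N. (a k x)^2 * n k $ i * n k $ j)\<bar> \<le> \<tau> / 2"
    by (elim exE conjE) (rule that; assumption)
  obtain v2 w2 where 2: "Cb 3 v2" "\<forall>j. Cb 2 (w2 j)" "\<forall>x. \<bar>v2 x - v1 x\<bar> \<le> \<tau> / 2" "\<forall>j x. \<bar>w2 j x - w1 j x\<bar> \<le> \<tau> / 2"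
     "\<forall>i j x. \<bar>strain v2 w2 i j x - strain v1 w1 i j x - (a N x)^2 * n N $ i * n N $ j\<bar> \<le> \<tau> / 2"
    using smooth_step[where w = w1 and n = "n N", OF 1(1) 1(2)[rule_format] Suc.prems(1)[rule_format, OF lessI] \<open>0 < \<tau> / 2\<close>]
    by (elim exE conjE) (rule that; assumption)
  have half: "\<bar>p - r\<bar> \<le> \<tau>" if "\<bar>p - q\<bar> \<le> \<tau> / 2" "\<bar>q - r\<bar> \<le> \<tau> / 2" for p q r
    using that by linarith
  have half': "\<bar>p - r - (s + t)\<bar> \<le> \<tau>" if "\<bar>p - q - t\<bar> \<le> \<tau> / 2" "\<bar>q - r - s\<bar> \<le> \<tau> / 2" for p q r s t
    using that by linarith
  show ?case
    using 2(1,2) half[OF 2(3)[rule_format] 1(3)[rule_format]] half[OF 2(4)[rule_format] 1(4)[rule_format]]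
      half'[OF 2(5)[rule_format] 1(5)[rule_format]]
    by (intro exI[of _ v2] exI[of _ w2]) simp
qed

text \<open>Mean and second moment of the binomial distribution, transported from [0, 1] to the
  nodes \<open>T * (2 * k / n - 1)\<close> in [-T, T].\<close>

lemma Bernstein_moments:
  fixes s :: real
  assumes "0 < n"
  shows "(\<Sum>k\<le>n. T * (2 * real k / real n - 1) * Bernstein n k s) = T * (2 * s - 1)"
    and "(\<Sum>k\<le>n. (T * (2 * real k / real n - 1))^2 * Bernstein n k s) = (T * (2 * s - 1))^2 + 4 * T^2 * s * (1 - s) / real n"
proof -
  have kk: "(\<Sum>k\<le>n. (real k)^2 * Bernstein n k s) = real n * (real n - 1) * s^2 + real n * s"
    using sum_kk_Bernstein[of n s] sum_k_Bernstein[of n s]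
    by (simp add: algebra_simps sum.distrib sum_subtractf power2_eq_square)
  have "(\<Sum>k\<le>n. T * (2 * real k / real n - 1) * Bernstein n k s)
      = 2 * T / real n * (\<Sum>k\<le>n. real k * Bernstein n k s) - T * (\<Sum>k\<le>n. Bernstein n k s)"
    unfolding sum_distrib_left sum_subtractf[symmetric]
    by (intro sum.cong refl) (simp add: field_simps)
  then show "(\<Sum>k\<le>n. T * (2 * real k / real n - 1) * Bernstein n k s) = T * (2 * s - 1)"
    using assms by (simp add: sum_k_Bernstein algebra_simps)
  have "(\<Sum>k\<le>n. (T * (2 * real k / real n - 1))^2 * Bernstein n k s)
      = 4 * T^2 / (real n)^2 * (\<Sum>k\<le>n. (real k)^2 * Bernstein n k s) - 4 * T^2 / real n * (\<Sum>k\<le>n. real k * Bernstein n k s)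
        + T^2 * (\<Sum>k\<le>n. Bernstein n k s)"
    unfolding sum_distrib_left sum_subtractf[symmetric] sum.distrib[symmetric]
    using assms by (intro sum.cong refl) (simp add: field_simps power2_eq_square)
  also have "\<dots> = (T * (2 * s - 1))^2 + 4 * T^2 * s * (1 - s) / real n"
    unfolding kk sum_k_Bernstein sum_Bernstein using assms by (simp add: field_simps power2_eq_square)
  finally show "(\<Sum>k\<le>n. (T * (2 * real k / real n - 1))^2 * Bernstein n k s) = (T * (2 * s - 1))^2 + 4 * T^2 * s * (1 - s) / real n" .
qed

text \<open>With \<open>m = q / p\<close>, the Bernstein weights of \<open>(m / T + 1) / 2\<close> are positive, have mean \<open>m\<close> with respect to the
  nodes \<open>t\<^sub>k\<close> in \<open>[-T, T]\<close> and arbitrarily small variance. So \<open>p\<close> times them, with the directions \<open>(1, t\<^sub>k)\<close>,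
  matches \<open>p\<close> and \<open>q\<close> exactly and leaves a positive multiple of the square of \<open>(0, 1)\<close>.\<close>

lemma positive_decomposition:
  fixes p q r :: "real^2 \<Rightarrow> real"
  assumes B: "Cb m p" "Cb m q" "Cb m r" and \<kappa>: "0 < \<kappa>"
    and pos: "\<And>x y z. \<kappa> * (y^2 + z^2) \<le> p x * y^2 + 2 * q x * y * z + r x * z^2"
  shows "\<exists>(N::nat) a (n :: nat \<Rightarrow> real^2). (\<forall>k<N. Cb m (a k)) \<and> (\<forall>x. (\<Sum>k<N. (a k x)^2 * n k $ 1 * n k $ 1) = p x \<and>
     (\<Sum>k<N. (a k x)^2 * n k $ 1 * n k $ 2) = q x \<and> (\<Sum>k<N. (a k x)^2 * n k $ 2 * n k $ 2) = r x)"
proof -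
  have p: "\<kappa> \<le> p x" for x using pos[of 1 0 x] by simp
  have p0: "0 < p x" for x using p[of x] \<kappa> by linarith
  obtain P Q where P: "0 \<le> P" "\<And>x. \<bar>p x\<bar> \<le> P" and Q: "0 \<le> Q" "\<And>x. \<bar>q x\<bar> \<le> Q"
    using Cb_bound[OF B(1)] Cb_bound[OF B(2)] by blast
  \<comment> \<open>The quotient of \<open>q\<close> and \<open>p\<close>, written with
    \<open>powr\<close> so that \<open>Cb_powr\<close> applies.\<close>
  define mm where "mm = (\<lambda>x. q x * p x powr (-1))"
  have mm: "mm x = q x / p x" for x using p0[of x] by (simp add: mm_def powr_minus_divide)
  \<comment> \<open>One more than a bound for |\<open>mm\<close>|. The margin keeps \<open>s\<close>
    below in [s0, 1 - s0], so that every Bernstein weight has a positive lower bound and a smooth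
    root.\<close>
  define T where "T = Q / \<kappa> + 1"
  have T: "1 \<le> T" using Q \<kappa> by (simp add: T_def)
  have mT: "\<bar>mm x\<bar> \<le> T - 1" for x
  proof -
    have "\<bar>q x\<bar> / p x \<le> Q / \<kappa>" using Q(2)[of x] p[of x] p0[of x] \<kappa> by (intro frac_le) auto
    then show ?thesis using p0[of x] by (simp add: mm T_def abs_divide)
  qed
  have qm: "q x = p x * mm x" for x using p0[of x] by (simp add: mm)
  \<comment> \<open>The Schur complement, bounded below by testing the quadratic form at
    \<open>(- mm x, 1)\<close>.\<close>
  have rm: "\<kappa> \<le> r x - p x * (mm x)^2" for x
  proof -
    have "\<kappa> * 1 \<le> \<kappa> * ((mm x)^2 + 1^2)" using \<kappa> by (intro mult_left_mono) auto
    also have "\<dots> \<le> r x - p x * (mm x)^2" using pos[of "- mm x" 1 x] by (simp add: qm power2_eq_square algebra_simps)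
    finally show ?thesis by simp
  qed
  define s where "s = (\<lambda>x. (mm x / T + 1) / 2)"
  define s0 where "s0 = 1 / (2 * T)"
  have s0: "0 < s0" using T by (simp add: s0_def)
  have s: "s0 \<le> s x" "s0 \<le> 1 - s x" for x
    using mT[of x] T by (auto simp: s_def s0_def field_simps abs_le_iff)
  have Ts: "T * (2 * s x - 1) = mm x" for x using T by (simp add: s_def field_simps)
  \<comment> \<open>The variance of the nodes is at most \<open>T^2 / n\<close>; times
    \<open>P\<close> it must not exceed half of the Schur complement bound
    \<open>\<kappa>\<close>.\<close>
  obtain n :: nat where n: "2 * P * T^2 / \<kappa> < real n" using reals_Archimedean2 by blast
  have "0 \<le> 2 * P * T^2 / \<kappa>" using P T \<kappa> by simp
  then have n0: "0 < n" using n by linarith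
  define v where "v = (\<lambda>x. 4 * T^2 * s x * (1 - s x) / real n)"
  have v: "p x * v x \<le> \<kappa> / 2" for x
  proof -
    have "4 * (s x * (1 - s x)) \<le> 1" using zero_le_square[of "2 * s x - 1"] by (simp add: algebra_simps power2_eq_square)
    then have "T^2 * (4 * (s x * (1 - s x))) \<le> T^2 * 1" by (intro mult_left_mono) auto
    then have "v x \<le> T^2 / real n" unfolding v_def by (intro divide_right_mono) (auto simp: algebra_simps)
    moreover have "0 \<le> v x" using s[of x] s0 by (simp add: v_def)
    ultimately have "p x * v x \<le> P * (T^2 / real n)" using P(2)[of x] P(1) by (intro mult_mono) auto
    also have "\<dots> \<le> \<kappa> / 2" using n n0 \<kappa> by (simp add: field_simps)
    finally show ?thesis .
  qed
  have Bm: "Cb m mm" unfolding mm_def by (intro Cb_mult B Cb_powr[OF B(1) \<kappa> p])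
  have Bs: "Cb m s"
  proof -
    have eq: "s = (\<lambda>x. (1 / (2 * T)) * mm x + 1 / 2)" by (auto simp: s_def add_divide_distrib)
    show ?thesis unfolding eq by (intro Cb_add Cb_mult Cb_const Bm)
  qed
  have Bv: "Cb m v"
  proof -
    have eq: "v = (\<lambda>x. (4 * T^2 / real n) * (s x * (1 - s x)))" by (auto simp: v_def)
    show ?thesis unfolding eq by (intro Cb_mult Cb_diff Cb_const Bs)
  qed
  have "\<exists>a. Cb m a \<and> (\<forall>x. (a x)^2 = p x * Bernstein n k (s x))" if "k \<le> n" for k
  proof (rule Cb_strainrt)
    show "Cb m (\<lambda>x. p x * Bernstein n k (s x))"
      unfolding Bernstein_def by (intro Cb_mult B Cb_const Cb_power Cb_diff Bs)
    show "0 < \<kappa> * (1 * s0^k * s0^(n - k))" using \<kappa> s0 by simp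
    show "\<kappa> * (1 * s0^k * s0^(n - k)) \<le> p x * Bernstein n k (s x)" for x
    proof -
      have "1 \<le> real (n choose k)" using that by (simp add: Suc_leI)
      then show ?thesis
        unfolding Bernstein_def using p[of x] s[of x] s0 \<kappa> by (intro mult_mono power_mono) auto
    qed
  qed
  then obtain a where a: "\<And>k. k \<le> n \<Longrightarrow> Cb m (a k)" "\<And>k x. k \<le> n \<Longrightarrow> (a k x)^2 = p x * Bernstein n k (s x)"
    by metis
  have "\<exists>e. Cb m e \<and> (\<forall>x. (e x)^2 = r x - p x * ((mm x)^2 + v x))"
  proof (rule Cb_strainrt)
    show "Cb m (\<lambda>x. r x - p x * ((mm x)^2 + v x))" by (intro Cb_diff Cb_mult Cb_add Cb_power B Bm Bv)
    show "0 < \<kappa> / 2" using \<kappa> by simp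
    show "\<kappa> / 2 \<le> r x - p x * ((mm x)^2 + v x)" for x using rm[of x] v[of x] by (simp add: distrib_left)
  qed
  then obtain e where e: "Cb m e" "\<And>x. (e x)^2 = r x - p x * ((mm x)^2 + v x)" by blast
  define t where "t = (\<lambda>k. T * (2 * real k / real n - 1))"
  \<comment> \<open>Index \<open>n + 1\<close> carries the vertical direction, which takes what mean
    and variance leave of \<open>r\<close>.\<close>
  define d where "d = (\<lambda>k. if k \<le> n then vector [1, t k] else vector [0, 1] :: real^2)"
  define b where "b = (\<lambda>k. if k \<le> n then a k else e)"
  have split: "(\<Sum>k<Suc (Suc n). (b k x)^2 * d k $ i * d k $ j)
      = p x * (\<Sum>k\<le>n. (vector [1, t k] :: real^2) $ i * (vector [1, t k] :: real^2) $ j * Bernstein n k (s x))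
        + (e x)^2 * (vector [0, 1] :: real^2) $ i * (vector [0, 1] :: real^2) $ j" for i j x
  proof -
    have "(\<Sum>k<Suc n. (b k x)^2 * d k $ i * d k $ j)
        = (\<Sum>k\<le>n. p x * ((vector [1, t k] :: real^2) $ i * (vector [1, t k] :: real^2) $ j * Bernstein n k (s x)))"
      unfolding lessThan_Suc_atMost by (intro sum.cong) (auto simp: b_def d_def a(2))
    then show ?thesis unfolding sum_distrib_left by (subst sum.lessThan_Suc) (simp add: b_def d_def)
  qed
  have "\<forall>x. (\<Sum>k<Suc (Suc n). (b k x)^2 * d k $ 1 * d k $ 1) = p x \<and>
     (\<Sum>k<Suc (Suc n). (b k x)^2 * d k $ 1 * d k $ 2) = q x \<and> (\<Sum>k<Suc (Suc n). (b k x)^2 * d k $ 2 * d k $ 2) = r x"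
  proof (intro allI conjI)
    fix x
    show "(\<Sum>k<Suc (Suc n). (b k x)^2 * d k $ 1 * d k $ 1) = p x" unfolding split by (simp add: sum_Bernstein)
    show "(\<Sum>k<Suc (Suc n). (b k x)^2 * d k $ 1 * d k $ 2) = q x"
      unfolding split using Bernstein_moments(1)[OF n0, of T "s x"] by (simp add: t_def Ts qm)
    show "(\<Sum>k<Suc (Suc n). (b k x)^2 * d k $ 2 * d k $ 2) = r x"
      unfolding split using Bernstein_moments(2)[OF n0, of T "s x"]
      by (simp add: t_def Ts e(2)[unfolded power2_eq_square] v_def power2_eq_square)
  qed
  moreover have "\<forall>k<Suc (Suc n). Cb m (b k)" using a(1) e(1) by (auto simp: b_def)
  ultimately show ?thesis by blast
qed

lemma quadratic_perturbation:
  fixes e1 e2 e3 y z \<tau> :: real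
  assumes "\<bar>e1\<bar> \<le> \<tau>" "\<bar>e2\<bar> \<le> \<tau>" "\<bar>e3\<bar> \<le> \<tau>"
  shows "- (2 * \<tau> * (y^2 + z^2)) \<le> e1 * y^2 + 2 * e2 * y * z + e3 * z^2"
proof -
  have \<tau>: "0 \<le> \<tau>" using assms(1) by linarith
  have yz: "\<bar>y * z\<bar> \<le> (y^2 + z^2) / 2"
    using zero_le_square[of "\<bar>y\<bar> - \<bar>z\<bar>"] by (simp add: abs_mult power2_eq_square algebra_simps)
  have a: "- (\<tau> * U) \<le> e * u" if "\<bar>e\<bar> \<le> \<tau>" "\<bar>u\<bar> \<le> U" for e u U :: real
  proof -
    have "\<bar>e * u\<bar> \<le> \<tau> * U" unfolding abs_mult using that \<tau> by (intro mult_mono) auto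
    then show ?thesis by linarith
  qed
  have "- (\<tau> * y^2) \<le> e1 * y^2" "- (\<tau> * z^2) \<le> e3 * z^2" "- (\<tau> * ((y^2 + z^2) / 2)) \<le> e2 * (y * z)"
    using a[OF assms(1), of "y^2" "y^2"] a[OF assms(3), of "z^2" "z^2"] a[OF assms(2) yz] by auto
  moreover have "2 * e2 * y * z = 2 * (e2 * (y * z))"
    "2 * \<tau> * (y^2 + z^2) = \<tau> * y^2 + \<tau> * z^2 + 2 * (\<tau> * ((y^2 + z^2) / 2))" by (simp_all add: algebra_simps)
  ultimately show ?thesis by linarith
qed

text \<open>Subtracting the normal form from the deficit leaves a positive definite field; removing
  this field with as many directions as it needs leaves the normal form up to small errors.\<close>

lemma initial_stage:
  fixes A :: "2 \<Rightarrow> 2 \<Rightarrow> real^2 \<Rightarrow> real"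
  assumes v: "Cb 4 v" and w: "\<And>j. Cb 4 (w j)" and H: "0 \<le> H" and \<beta>: "0 < \<beta>"
    and A: "\<And>i j x y. \<bar>A i j x - A i j y\<bar> \<le> H * dist x y powr \<beta>" and bA: "\<And>i j x. \<bar>A i j x\<bar> \<le> HA"
    and \<kappa>: "0 < \<kappa>" and pos: "\<And>x y z. \<kappa> * (y^2 + z^2) \<le> (A 1 1 x - strain v w 1 1 x) * y^2
        + 2 * (A 1 2 x - strain v w 1 2 x) * y * z + (A 2 2 x - strain v w 2 2 x) * z^2"
    and \<tau>: "0 < \<tau>"
  shows "\<exists>\<delta> v' w'. 0 < \<delta> \<and> \<delta> \<le> 1 \<and> Cb 3 v' \<and> (\<forall>j. Cb 2 (w' j)) \<and> (\<forall>x. \<bar>v' x - v x\<bar> \<le> \<tau>) \<and>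
     (\<forall>j x. \<bar>w' j x - w j x\<bar> \<le> \<tau>) \<and> deficit_near A v' w' \<delta>"
proof -
  have cA: "continuous_on UNIV (A i j)" for i j by (rule Holder_imp_continuous[OF A \<beta>])
  \<comment> \<open>The normal form has entries \<open>2 * \<delta>\<close> on and
    \<open>\<delta>\<close> off the diagonal, so its largest eigenvalue is
    \<open>3 * \<delta>\<close>, here at most \<open>\<kappa> / 2\<close>.\<close>
  define \<delta> where "\<delta> = min 1 (\<kappa> / 6)"
  have \<delta>: "0 < \<delta>" "\<delta> \<le> 1" "6 * \<delta> \<le> \<kappa>" using \<kappa> by (auto simp: \<delta>_def)
  \<comment> \<open>\<open>A\<close> is only Hoelder continuous but the amplitudes must be smooth,
    so a mollification of \<open>A\<close> is decomposed.\<close>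
  obtain l where l: "0 < l" "H * (6 * l) powr \<beta> \<le> \<delta> / 40"
    using length_choice[of 1 1 "\<delta> / 40" \<beta> H] \<delta> \<beta> H by auto
  define Al where "Al = (\<lambda>i j. mol 3 l (A i j))"
  have osc: "\<bar>Al i j x - A i j x\<bar> \<le> \<delta> / 40" for i j x
    unfolding Al_def
  proof (rule mol_approx[OF l(1) cA])
    fix y assume y: "y \<in> cube x (real 3 * l)"
    have "\<bar>A i j y - A i j x\<bar> \<le> H * dist y x powr \<beta>" by (rule A)
    also have "\<dots> \<le> H * (6 * l) powr \<beta>"
      using cube_dist[OF y] H \<beta> by (intro mult_left_mono powr_mono2) auto
    finally show "\<bar>A i j y - A i j x\<bar> \<le> \<delta> / 40" using l by linarith
  qed
  have BA: "Cb 3 (Al i j)" for i j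
    unfolding Al_def
  proof (rule Jet_imp_Cb[OF Jet_mol[OF l(1) cA]])
    show "\<bar>A i j y\<bar> \<le> HA" for y by (rule bA)
    show "0 \<le> HA" using order_trans[OF abs_ge_zero bA] .
  qed (use l in auto)
  define p where "p = (\<lambda>x. Al 1 1 x - strain v w 1 1 x - 2 * \<delta>)"
  define q where "q = (\<lambda>x. Al 1 2 x - strain v w 1 2 x - \<delta>)"
  define r where "r = (\<lambda>x. Al 2 2 x - strain v w 2 2 x - 2 * \<delta>)"
  have Bsq: "Cb 3 (strain v w i j)" for i j by (rule Cb_strain) (use v w in \<open>simp_all add: eval_nat_numeral\<close>)
  have B: "Cb 3 p" "Cb 3 q" "Cb 3 r" unfolding p_def q_def r_def by (intro Cb_diff BA Bsq Cb_const)+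
  have "\<kappa> / 4 * (y^2 + z^2) \<le> p x * y^2 + 2 * q x * y * z + r x * z^2" for x y z
  proof -
    define E where "E = (\<lambda>i j. Al i j x - A i j x)"
    have "- (2 * (\<delta> / 40) * (y^2 + z^2)) \<le> E 1 1 * y^2 + 2 * E 1 2 * y * z + E 2 2 * z^2"
      by (rule quadratic_perturbation) (use osc in \<open>auto simp: E_def\<close>)
    then have e: "- (\<delta> / 20 * (y^2 + z^2)) \<le> E 1 1 * y^2 + 2 * (E 1 2 * (y * z)) + E 2 2 * z^2"
      by (simp add: mult.assoc)
    have "\<delta> * (2 * y * z) \<le> \<delta> * (y^2 + z^2)" using sum_squares_bound[of y z] \<delta> by (intro mult_left_mono) auto
    then have "2 * \<delta> * y^2 + 2 * \<delta> * (y * z) + 2 * \<delta> * z^2 \<le> 3 * \<delta> * (y^2 + z^2)" by (simp add: algebra_simps)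
    moreover have "p x * y^2 + 2 * q x * y * z + r x * z^2 = ((A 1 1 x - strain v w 1 1 x) * y^2
        + 2 * (A 1 2 x - strain v w 1 2 x) * y * z + (A 2 2 x - strain v w 2 2 x) * z^2)
        + (E 1 1 * y^2 + 2 * (E 1 2 * (y * z)) + E 2 2 * z^2) - (2 * \<delta> * y^2 + 2 * \<delta> * (y * z) + 2 * \<delta> * z^2)"
      by (simp add: p_def q_def r_def E_def algebra_simps)
    ultimately have "\<kappa> * (y^2 + z^2) - \<delta> / 20 * (y^2 + z^2) - 3 * \<delta> * (y^2 + z^2) \<le> p x * y^2 + 2 * q x * y * z + r x * z^2"
      using pos[where x = x and y = y and z = z] e by linarith
    moreover have "\<kappa> / 4 * (y^2 + z^2) \<le> (\<kappa> - \<delta> / 20 - 3 * \<delta>) * (y^2 + z^2)"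
      using \<delta> by (intro mult_right_mono) auto
    ultimately show ?thesis by (simp add: left_diff_distrib)
  qed
  note quad = this
  have "0 < \<kappa> / 4" using \<kappa> by simp
  from positive_decomposition[OF B this quad] obtain N :: nat and a and n :: "nat \<Rightarrow> real^2" where a: "\<forall>k<N. Cb 3 (a k)"
    and dec0: "\<forall>x. (\<Sum>k<N. (a k x)^2 * n k $ 1 * n k $ 1) = p x \<and>
     (\<Sum>k<N. (a k x)^2 * n k $ 1 * n k $ 2) = q x \<and> (\<Sum>k<N. (a k x)^2 * n k $ 2 * n k $ 2) = r x"
    by (elim exE conjE) (rule that)
  note dec = dec0[rule_format, THEN conjunct1] dec0[rule_format, THEN conjunct2, THEN conjunct1]
    dec0[rule_format, THEN conjunct2, THEN conjunct2]
  have v3: "Cb 3 v" and w2: "\<And>j. Cb 2 (w j)" using Cb_le[OF v] Cb_le[OF w] by auto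
  have \<tau>': "0 < min \<tau> (\<delta> / 40)" using \<tau> \<delta> by simp
  obtain v' w' where vw: "Cb 3 v'" "\<forall>j. Cb 2 (w' j)" "\<forall>x. \<bar>v' x - v x\<bar> \<le> min \<tau> (\<delta> / 40)"
     "\<forall>j x. \<bar>w' j x - w j x\<bar> \<le> min \<tau> (\<delta> / 40)"
     "\<forall>i j x. \<bar>strain v' w' i j x - strain v w i j x - (\<Sum>k<N. (a k x)^2 * n k $ i * n k $ j)\<bar> \<le> min \<tau> (\<delta> / 40)"
    using smooth_steps[where w = w and n = n, OF v3 w2 a \<tau>'] by (elim exE conjE) (rule that; assumption)
  \<comment> \<open>Mollification and corrugations cost \<open>\<delta> / 40\<close> each; a
    difference of two entries then costs \<open>\<delta> / 10\<close>, below
    \<open>\<delta> / 8\<close>.\<close>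
  have f: "\<bar>A 1 1 x - strain v' w' 1 1 x - 2 * \<delta>\<bar> \<le> \<delta> / 20" "\<bar>A 1 2 x - strain v' w' 1 2 x - \<delta>\<bar> \<le> \<delta> / 20"
    "\<bar>A 2 2 x - strain v' w' 2 2 x - 2 * \<delta>\<bar> \<le> \<delta> / 20" for x
    using osc[of 1 1 x] osc[of 1 2 x] osc[of 2 2 x] vw(5)[rule_format, of 1 1 x] vw(5)[rule_format, of 1 2 x] vw(5)[rule_format, of 2 2 x]
    unfolding dec p_def q_def r_def by linarith+
  have "deficit_near A v' w' \<delta>"
    unfolding deficit_near_def
  proof (intro allI conjI)
    fix x show "\<bar>A 1 2 x - strain v' w' 1 2 x - \<delta>\<bar> \<le> \<delta> / 8" using f(2)[of x] \<delta> by linarith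
    fix k :: 2 consider "k = 1" | "k = 2" using exhaust_2 by blast
    then show "\<bar>A k k x - strain v' w' k k x - (A 1 2 x - strain v' w' 1 2 x) - \<delta>\<bar> \<le> \<delta> / 8"
    proof cases
      case 1 show ?thesis unfolding 1 using f[of x] \<delta> by linarith
    next
      case 2 show ?thesis unfolding 2 using f[of x] \<delta> by linarith
    qed
  qed
  then show ?thesis using \<delta> vw by (intro exI[of _ \<delta>] exI[of _ v'] exI[of _ w']) auto
qed

section \<open>Approximation up to the boundary\<close>

lemma Cb_shift: "Cb n f \<Longrightarrow> Cb n (\<lambda>x. f (x + c))"
  unfolding Cb_def using Jet_shift by blast

lemma mol_sum:
  "finite I \<Longrightarrow> 0 < l \<Longrightarrow> (\<And>k. k \<in> I \<Longrightarrow> continuous_on UNIV (f k)) \<Longrightarrow>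
    mol n l (\<lambda>x. \<Sum>k\<in>I. f k x) = (\<lambda>x. \<Sum>k\<in>I. mol n l (f k) x)"
  by (induction I rule: finite_induct) (simp_all add: mol_const mol_add continuous_on_sum)

definition inward_at :: "(real^2) set \<Rightarrow> real^2 \<Rightarrow> real \<Rightarrow> real^2 \<Rightarrow> bool" where
  "inward_at \<Omega> p \<rho> e \<longleftrightarrow> 0 < \<rho> \<and> norm e \<le> 1 \<and> (\<forall>x\<in>closure \<Omega> \<inter> ball p \<rho>. \<forall>t. 0 < t \<and> t < \<rho> \<longrightarrow> x + t *\<^sub>R e \<in> \<Omega>)"

text \<open>At a boundary point \<open>e\<close> is the preimage under \<open>T\<close> of the
  upward unit vector: closure points lie weakly above the graph, and an upward shift makes the
  inequality strict. The radius \<open>r / 2\<close> keeps shifted points in the chart.\<close>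

lemma smooth_boundary_inward:
  assumes \<Omega>: "open \<Omega>" and sm: "smooth_boundary \<Omega>" and p: "p \<in> closure \<Omega>"
  shows "\<exists>\<rho> e. inward_at \<Omega> p \<rho> e"
proof (cases "p \<in> \<Omega>")
  case True
  then obtain \<rho> where "0 < \<rho>" "ball p \<rho> \<subseteq> \<Omega>" using \<Omega> open_contains_ball by blast
  then show ?thesis by (intro exI[of _ \<rho>] exI[of _ 0]) (auto simp: inward_at_def)
next
  case False
  then have "p \<in> frontier \<Omega>" using p \<Omega> by (simp add: frontier_def interior_open)
  then obtain r and T :: "real^2 \<Rightarrow> real^2" and \<gamma> where r: "0 < r" and T: "orthogonal_transformation T" and \<gamma>: "smooth_real \<gamma>"
    and eq: "\<Omega> \<inter> ball p r = {x \<in> ball p r. \<gamma> (T x $ 1) < T x $ 2}"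
    using sm unfolding smooth_boundary_def by blast
  have lin: "linear T" using T by (simp add: orthogonal_transformation_linear)
  have "surj T" using T by (simp add: orthogonal_transformation_surj)
  then obtain e where e: "T e = axis 2 1" by (metis surjD)
  have "norm (T e) = norm e" using T by (simp add: orthogonal_transformation_norm)
  then have ne: "norm e = 1" unfolding e by simp
  have c\<gamma>: "isCont \<gamma> s" for s
  proof -
    have "\<gamma> field_differentiable (at s)" using \<gamma> unfolding smooth_real_def by (metis funpow_0)
    then show ?thesis by (rule field_differentiable_imp_continuous_at)
  qed
  have cT: "continuous_on UNIV (\<lambda>x. T x $ i)" for i
    using linear_continuous_on[OF lin[unfolded linear_conv_bounded_linear]] by (intro continuous_on_component)
  have "closed {x. \<gamma> (T x $ 1) \<le> T x $ 2}"
  proof (rule closed_Collect_le[OF _ cT])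
    have "continuous_on UNIV \<gamma>" by (rule continuous_at_imp_continuous_on) (simp add: c\<gamma>)
    from continuous_on_compose2[OF this cT subset_UNIV] show "continuous_on UNIV (\<lambda>x. \<gamma> (T x $ 1))" .
  qed
  moreover have "ball p r \<inter> \<Omega> \<subseteq> {x. \<gamma> (T x $ 1) \<le> T x $ 2}" using eq by force
  ultimately have "closure (ball p r \<inter> \<Omega>) \<subseteq> {x. \<gamma> (T x $ 1) \<le> T x $ 2}" by (rule closure_minimal[rotated])
  then have le: "\<gamma> (T x $ 1) \<le> T x $ 2" if "x \<in> ball p r" "x \<in> closure \<Omega>" for x
    using open_Int_closure_subset[of "ball p r" \<Omega>] that by auto
  have "x + t *\<^sub>R e \<in> \<Omega>" if x: "x \<in> closure \<Omega> \<inter> ball p (r / 2)" and t: "0 < t" "t < r / 2" for x t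
  proof -
    have "dist p (x + t *\<^sub>R e) \<le> dist p x + norm (t *\<^sub>R e)"
      using dist_triangle[of p "x + t *\<^sub>R e" x] by (simp add: dist_norm)
    then have b: "x + t *\<^sub>R e \<in> ball p r" using x t ne by simp
    have "T (x + t *\<^sub>R e) = T x + t *\<^sub>R axis 2 1" using lin by (simp add: linear_add linear_scale e)
    then have "T (x + t *\<^sub>R e) $ 1 = T x $ 1" "T (x + t *\<^sub>R e) $ 2 = T x $ 2 + t" by (simp_all add: axis_def)
    then have "\<gamma> (T (x + t *\<^sub>R e) $ 1) < T (x + t *\<^sub>R e) $ 2" using le[of x] x t r by simp
    then show ?thesis using b eq by blast
  qed
  then show ?thesis using r ne by (intro exI[of _ "r / 2"] exI[of _ e]) (auto simp: inward_at_def)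
qed

text \<open>Tent functions are normalised first and mollified afterwards. Averaging is linear and
  reproduces constants, so a sum that equals 1 in a neighbourhood of \<open>K\<close> still equals 1
  on \<open>K\<close>.\<close>

lemma tent_partition:
  fixes K :: "(real^2) set" and \<rho> :: "real^2 \<Rightarrow> real"
  assumes K: "compact K" and ne: "K \<noteq> {}" and F: "finite F" "F \<subseteq> K" and \<rho>: "\<And>p. p \<in> F \<Longrightarrow> 0 < \<rho> p"
    and cov: "K \<subseteq> (\<Union>p\<in>F. ball p (\<rho> p / 2))"
  shows "\<exists>\<theta> l. 0 < l \<and> (\<forall>p\<in>F. Cb 4 (\<theta> p) \<and> (\<forall>x. \<bar>\<theta> p x\<bar> \<le> 1 \<and> (\<forall>j. \<bar>pd j (\<theta> p) x\<bar> \<le> 1 / l)) \<and>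
      (\<forall>x. 3/4 * \<rho> p \<le> dist x p \<longrightarrow> \<theta> p x = 0 \<and> (\<forall>j. pd j (\<theta> p) x = 0))) \<and>
      (\<forall>x\<in>K. (\<Sum>p\<in>F. \<theta> p x) = 1 \<and> (\<forall>j. (\<Sum>p\<in>F. pd j (\<theta> p) x) = 0))"
proof -
  have "open (\<Union>p\<in>F. ball p (\<rho> p / 2))" by auto
  from compact_subset_open_imp_ball_epsilon_subset[OF K this cov]
  obtain e0 where e0: "0 < e0" "(\<Union>x\<in>K. ball x e0) \<subseteq> (\<Union>p\<in>F. ball p (\<rho> p / 2))" by blast
  define tau where "tau = (\<lambda>p x. max 0 (\<rho> p / 2 - dist x p))"
  \<comment> \<open>An additional tent that vanishes near \<open>K\<close> and is positive away from
    it: it makes the denominator \<open>sg\<close> positive on the whole plane without affecting the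
    sum near \<open>K\<close>.\<close>
  define tau0 where "tau0 = (\<lambda>x. max 0 (infdist x K - e0 / 2))"
  define sg where "sg = (\<lambda>x. tau0 x + (\<Sum>p\<in>F. tau p x))"
  have nn: "0 \<le> tau p x" "0 \<le> tau0 x" for p x by (auto simp: tau_def tau0_def)
  have sg0: "0 < sg x" for x
  proof (cases "e0 / 2 < infdist x K")
    case True
    then have "0 < tau0 x" by (simp add: tau0_def)
    then show ?thesis unfolding sg_def using nn by (intro add_pos_nonneg sum_nonneg) auto
  next
    case False
    obtain y where y: "y \<in> K" "infdist x K = dist x y"
      using infdist_attains_inf[OF compact_imp_closed[OF K] ne] by blast
    then have "x \<in> (\<Union>x\<in>K. ball x e0)" using False e0(1) by (force simp: dist_commute)
    then obtain p where p: "p \<in> F" "x \<in> ball p (\<rho> p / 2)" using e0(2) by blast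
    then have "0 < tau p x" by (simp add: tau_def dist_commute)
    then have "0 < (\<Sum>p\<in>F. tau p x)" using F p nn by (intro sum_pos2[of F p]) auto
    then show ?thesis unfolding sg_def using nn by (intro add_nonneg_pos) auto
  qed
  have ct: "continuous_on UNIV (tau p)" for p unfolding tau_def by (intro continuous_intros)
  have ct0: "continuous_on UNIV tau0" unfolding tau0_def by (intro continuous_intros)
  have csg: "continuous_on UNIV sg" unfolding sg_def by (intro continuous_on_add continuous_on_sum ct ct0)
  define f where "f = (\<lambda>p x. tau p x / sg x)"
  have cf: "continuous_on UNIV (f p)" for p
    unfolding f_def by (intro continuous_on_divide ct csg) (use sg0 less_irrefl in metis)
  have f1: "\<bar>f p x\<bar> \<le> 1" if "p \<in> F" for p x
  proof -
    have "tau p x \<le> (\<Sum>p\<in>F. tau p x)" using F that nn by (intro member_le_sum) auto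
    then have "tau p x \<le> sg x" using nn(2)[of x] by (simp add: sg_def)
    then show ?thesis using nn(1)[of p x] sg0[of x] by (simp add: f_def)
  qed
  \<comment> \<open>Four averages reach the distance \<open>8 * l\<close>. This is at most
    \<open>\<rho> p / 4\<close>, widening the supports from \<open>\<rho> p / 2\<close> to
    \<open>3/4 * \<rho> p\<close>, and less than \<open>e0 / 2\<close>, within which
    \<open>tau0\<close> vanishes.\<close>
  define l where "l = Min (insert e0 (\<rho> ` F)) / 32"
  have l: "0 < l" "l \<le> e0 / 32" "\<And>p. p \<in> F \<Longrightarrow> l \<le> \<rho> p / 32"
    unfolding l_def using F e0 \<rho> by (auto intro!: divide_right_mono)
  define \<theta> where "\<theta> = (\<lambda>p. mol 4 l (f p))"
  have J: "Jet 4 UNIV 1 (1 / l) (\<theta> p)" if "p \<in> F" for p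
    unfolding \<theta>_def by (rule Jet_mol[OF l(1) cf]) (use f1 that in auto)
  have Jp: "has_pd j (\<theta> p) (pd j (\<theta> p))" "\<bar>pd j (\<theta> p) x\<bar> \<le> 1 / l" if "p \<in> F" for p j x
  proof -
    have "Jet (Suc 3) UNIV 1 (1 / l) (\<theta> p)" using J[OF that] by (simp add: eval_nat_numeral)
    note Jet_pd[OF this, of j]
    then show "has_pd j (\<theta> p) (pd j (\<theta> p))" "\<bar>pd j (\<theta> p) x\<bar> \<le> 1 / l" using Jet_bound[of 3 UNIV _ _ "pd j (\<theta> p)" x] by auto
  qed
  \<comment> \<open>A jet at the single point \<open>x\<close> with bound 0: vanishing on the cube
    kills the value and the derivatives of the mollification at its centre.\<close>
  have zero: "mol 4 l h x = 0 \<and> (\<forall>j. pd j (mol 4 l h) x = 0)"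
    if "continuous_on UNIV h" "\<And>y. y \<in> cube x (4 * l) \<Longrightarrow> h y = 0" for h x
  proof -
    have "Jet (Suc 3) {x} 0 (1 / l) (mol (Suc 3) l h)" by (rule Jet_mol[OF l(1) that(1)]) (use that(2) in auto)
    then have J: "Jet (Suc 3) {x} 0 (1 / l) (mol 4 l h)" by (simp add: eval_nat_numeral)
    have "\<bar>pd j (mol 4 l h) x\<bar> \<le> 0" for j using Jet_bound[OF Jet_pd(2)[OF J, of j], of x] by simp
    then show ?thesis using Jet_bound[OF J, of x] by simp
  qed
  have near: "\<theta> p x = 0 \<and> (\<forall>j. pd j (\<theta> p) x = 0)" if "p \<in> F" "3/4 * \<rho> p \<le> dist x p" for p x
    unfolding \<theta>_def
  proof (rule zero[OF cf])
    fix y assume "y \<in> cube x (4 * l)"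
    then have "dist y x \<le> \<rho> p / 4" using cube_dist[of y x "4 * l"] l(3)[OF that(1)] by simp
    then have "\<rho> p / 2 \<le> dist y p" using that(2) dist_triangle[of x p y] by (simp add: dist_commute)
    then show "f p y = 0" by (simp add: f_def tau_def)
  qed
  have one: "(\<Sum>p\<in>F. \<theta> p x) = 1 \<and> (\<forall>j. (\<Sum>p\<in>F. pd j (\<theta> p) x) = 0)" if "x \<in> K" for x
  proof -
    let ?h = "\<lambda>y. (\<Sum>p\<in>F. f p y) - 1"
    have ch: "continuous_on UNIV (\<lambda>y. \<Sum>p\<in>F. f p y)" by (intro continuous_on_sum cf)
    have mh: "mol 4 l ?h = (\<lambda>y. (\<Sum>p\<in>F. \<theta> p y) - 1)"
      using ch l(1) by (simp add: mol_diff mol_sum F cf mol_const \<theta>_def)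
    have "has_pd j (\<lambda>y. (\<Sum>p\<in>F. \<theta> p y) - 1) (\<lambda>y. (\<Sum>p\<in>F. pd j (\<theta> p) y) - 0)" for j
      by (intro has_pd_diff has_pd_sum has_pd_const Jp)
    from has_pd_imp_pd[OF this] have ph: "pd j (\<lambda>y. (\<Sum>p\<in>F. \<theta> p y) - 1) x = (\<Sum>p\<in>F. pd j (\<theta> p) x)" for j by simp
    have "mol 4 l ?h x = 0 \<and> (\<forall>j. pd j (mol 4 l ?h) x = 0)"
    proof (rule zero)
      fix y assume y: "y \<in> cube x (4 * l)"
      have "infdist y K \<le> dist y x" using that by (rule infdist_le)
      then have "tau0 y = 0" using cube_dist[OF y] l(2) e0(1) by (simp add: tau0_def)
      then have "(\<Sum>p\<in>F. tau p y) = sg y" by (simp add: sg_def)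
      then show "(\<Sum>p\<in>F. f p y) - 1 = 0" using sg0[of y] by (simp add: f_def sum_divide_distrib[symmetric])
    qed (intro continuous_on_diff ch continuous_on_const)
    then show ?thesis unfolding mh ph by simp
  qed
  show ?thesis
  proof (intro exI[of _ \<theta>] exI[of _ l] conjI ballI allI impI l(1))
    fix p assume p: "p \<in> F"
    show "Cb 4 (\<theta> p)" by (rule Jet_imp_Cb[OF J[OF p]]) (use l in auto)
    show "\<bar>\<theta> p x\<bar> \<le> 1" for x using Jet_bound[OF J[OF p]] by simp
    show "\<bar>pd j (\<theta> p) x\<bar> \<le> 1 / l" for j x by (rule Jp[OF p])
  qed (use near one in auto)
qed

text \<open>Near a point of the closure, \<open>u\<close> is translated inwards by a small vector and then mollified; the pieces
  are glued with a partition of unity that is fixed before the translation length is chosen.\<close>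

lemma C1_approximation:
  fixes u :: "real^2 \<Rightarrow> real"
  assumes \<Omega>: "open \<Omega>" "bounded \<Omega>" "\<Omega> \<noteq> {}" and inw: "\<And>p. p \<in> closure \<Omega> \<Longrightarrow> \<exists>\<rho> e. inward_at \<Omega> p \<rho> e"
    and u: "continuous_on (closure \<Omega>) u" and g: "\<And>j. continuous_on (closure \<Omega>) (g j)"
    and du: "\<And>x. x \<in> \<Omega> \<Longrightarrow> \<exists>u'. (u has_derivative u') (at x) \<and> (\<forall>j. u' (axis j 1) = g j x)"
    and \<eta>: "0 < \<eta>"
  shows "\<exists>U. Cb 4 U \<and> (\<forall>x\<in>closure \<Omega>. \<bar>U x - u x\<bar> \<le> \<eta> \<and> (\<forall>j. \<bar>pd j U x - g j x\<bar> \<le> \<eta>))"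
proof -
  define K where "K = closure \<Omega>"
  have K: "compact K" "closed K" "K \<noteq> {}" "\<Omega> \<subseteq> K" using \<Omega> by (auto simp: K_def closure_subset)
  obtain \<rho> e where inward: "\<And>p. p \<in> K \<Longrightarrow> inward_at \<Omega> p (\<rho> p) (e p)" using inw unfolding K_def by metis
  have \<rho>: "0 < \<rho> p" "norm (e p) \<le> 1" if "p \<in> K" for p using inward[OF that] by (auto simp: inward_at_def)
  have "K \<subseteq> (\<Union>p\<in>K. ball p (\<rho> p / 2))" using \<rho> by force
  then obtain F where F: "F \<subseteq> K" "finite F" "K \<subseteq> (\<Union>p\<in>F. ball p (\<rho> p / 2))"
    by (rule compactE_image[OF K(1) open_ball])
  have Fne: "F \<noteq> {}" using F K by auto
  have "\<exists>\<theta> l. 0 < l \<and> (\<forall>p\<in>F. Cb 4 (\<theta> p) \<and> (\<forall>x. \<bar>\<theta> p x\<bar> \<le> 1 \<and> (\<forall>j. \<bar>pd j (\<theta> p) x\<bar> \<le> 1 / l)) \<and>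
      (\<forall>x. 3/4 * \<rho> p \<le> dist x p \<longrightarrow> \<theta> p x = 0 \<and> (\<forall>j. pd j (\<theta> p) x = 0))) \<and>
      (\<forall>x\<in>K. (\<Sum>p\<in>F. \<theta> p x) = 1 \<and> (\<forall>j. (\<Sum>p\<in>F. pd j (\<theta> p) x) = 0))"
    by (rule tent_partition[OF K(1,3) F(2,1) _ F(3)]) (use \<rho> F(1) in auto)
  then obtain \<theta> l where l: "0 < l" and \<theta>0: "\<forall>p\<in>F. Cb 4 (\<theta> p) \<and> (\<forall>x. \<bar>\<theta> p x\<bar> \<le> 1 \<and> (\<forall>j. \<bar>pd j (\<theta> p) x\<bar> \<le> 1 / l)) \<and>
      (\<forall>x. 3/4 * \<rho> p \<le> dist x p \<longrightarrow> \<theta> p x = 0 \<and> (\<forall>j. pd j (\<theta> p) x = 0))"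
    "\<forall>x\<in>K. (\<Sum>p\<in>F. \<theta> p x) = 1 \<and> (\<forall>j. (\<Sum>p\<in>F. pd j (\<theta> p) x) = 0)"
    by (elim exE conjE) (rule that)
  have \<theta>: "\<And>p. p \<in> F \<Longrightarrow> Cb 4 (\<theta> p)" "\<And>p x. p \<in> F \<Longrightarrow> \<bar>\<theta> p x\<bar> \<le> 1"
      "\<And>p x j. p \<in> F \<Longrightarrow> \<bar>pd j (\<theta> p) x\<bar> \<le> 1 / l"
      "\<And>p x. p \<in> F \<Longrightarrow> 3/4 * \<rho> p \<le> dist x p \<Longrightarrow> \<theta> p x = 0"
      "\<And>p x j. p \<in> F \<Longrightarrow> 3/4 * \<rho> p \<le> dist x p \<Longrightarrow> pd j (\<theta> p) x = 0"
      "\<And>x. x \<in> K \<Longrightarrow> (\<Sum>p\<in>F. \<theta> p x) = 1" "\<And>x j. x \<in> K \<Longrightarrow> (\<Sum>p\<in>F. pd j (\<theta> p) x) = 0"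
    using \<theta>0 by blast+
  define N where "N = real (card F)"
  have N: "1 \<le> N" using Fne F(2) by (simp add: N_def Suc_le_eq card_gt_0_iff)
  \<comment> \<open>Each of the \<open>N\<close> pieces contributes \<open>\<eta>'\<close> from the
    derivative of \<open>S\<close> and \<open>\<eta>' / l\<close> from the derivative of the
    partition.\<close>
  define \<eta>' where "\<eta>' = \<eta> / (N * (1 / l + 1))"
  have \<eta>': "0 < \<eta>'" "N * (1 / l * \<eta>' + \<eta>') = \<eta>"
  proof -
    have "0 < N * (1 / l + 1)" using N l by (simp add: add_pos_pos)
    then show "0 < \<eta>'" "N * (1 / l * \<eta>' + \<eta>') = \<eta>"
    proof -
      assume pos: "0 < N * (1 / l + 1)"
      then show "0 < \<eta>'" using \<eta> by (simp add: \<eta>'_def)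
      have "N * (1 / l * \<eta>' + \<eta>') = (N * (1 / l + 1)) * \<eta>'" by (simp add: algebra_simps)
      also have "\<dots> = \<eta>" unfolding \<eta>'_def using pos by (metis less_irrefl nonzero_mult_div_cancel_left times_divide_eq_right)
      finally show "N * (1 / l * \<eta>' + \<eta>') = \<eta>" .
    qed
  qed
  have unif: "\<exists>d>0. \<forall>x\<in>K. \<forall>y\<in>K. dist y x < d \<longrightarrow> \<bar>h y - h x\<bar> \<le> \<eta>'" if hc: "continuous_on K h" for h :: "real^2 \<Rightarrow> real"
  proof -
    obtain d where "0 < d" "\<forall>x\<in>K. \<forall>y\<in>K. dist y x < d \<longrightarrow> dist (h y) (h x) < \<eta>'"
      using compact_uniformly_continuous[OF hc K(1)] \<eta>'(1) unfolding uniformly_continuous_on_def by blast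
    then show ?thesis by (intro exI[of _ d]) (auto simp: dist_real_def less_imp_le)
  qed
  obtain d0 where d0: "0 < d0" "\<And>x y. x \<in> K \<Longrightarrow> y \<in> K \<Longrightarrow> dist y x < d0 \<Longrightarrow> \<bar>u y - u x\<bar> \<le> \<eta>'"
    using unif[OF u[folded K_def]] by blast
  obtain dj where dj: "\<And>j. 0 < dj j" "\<And>j x y. x \<in> K \<Longrightarrow> y \<in> K \<Longrightarrow> dist y x < dj j \<Longrightarrow> \<bar>g j y - g j x\<bar> \<le> \<eta>'"
    using unif[OF g[folded K_def]] by metis
  define d where "d = min d0 (min (dj 1) (dj 2))"
  have d: "0 < d" "d \<le> d0" "\<And>j. d \<le> dj j"
  proof -
    show "0 < d" "d \<le> d0" using d0 dj(1) by (auto simp: d_def)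
    show "d \<le> dj j" for j using exhaust_2[of j] by (auto simp: d_def)
  qed
  define t where "t = Min (insert d (\<rho> ` F)) / 2"
  have m: "0 < Min (insert d (\<rho> ` F))" using F \<rho> d by auto
  have t: "0 < t" "t \<le> d / 2" "\<And>p. p \<in> F \<Longrightarrow> t < \<rho> p"
  proof -
    show "0 < t" using m by (simp add: t_def)
    show "t \<le> d / 2" unfolding t_def using F by (intro divide_right_mono) auto
    fix p assume "p \<in> F"
    then have "Min (insert d (\<rho> ` F)) \<le> \<rho> p" using F by auto
    then show "t < \<rho> p" using m by (simp add: t_def)
  qed
  have "\<exists>\<epsilon>>0. (\<Union>y\<in>(\<lambda>x. x + t *\<^sub>R e p) ` (K \<inter> cball p (3/4 * \<rho> p)). ball y \<epsilon>) \<subseteq> \<Omega>" if p: "p \<in> F" for p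
  proof -
    have c1: "compact ((\<lambda>x. x + t *\<^sub>R e p) ` (K \<inter> cball p (3/4 * \<rho> p)))"
      by (intro compact_continuous_image compact_Int_closed K closed_cball) (intro continuous_intros)
    have c2: "(\<lambda>x. x + t *\<^sub>R e p) ` (K \<inter> cball p (3/4 * \<rho> p)) \<subseteq> \<Omega>"
    proof clarify
      fix x assume x: "x \<in> K" "x \<in> cball p (3/4 * \<rho> p)"
      have "0 < \<rho> p" using \<rho> p F by auto
      then have "x \<in> closure \<Omega> \<inter> ball p (\<rho> p)" using x by (simp add: K_def)
      then show "x + t *\<^sub>R e p \<in> \<Omega>" using inward[of p] p F t(1) t(3)[OF p] by (auto simp: inward_at_def)
    qed
    show ?thesis by (rule compact_subset_open_imp_ball_epsilon_subset[OF c1 \<Omega>(1) c2]) (rule exI, rule conjI)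
  qed
  then obtain \<epsilon> where \<epsilon>: "\<And>p. p \<in> F \<Longrightarrow> 0 < \<epsilon> p"
    "\<And>p. p \<in> F \<Longrightarrow> (\<Union>y\<in>(\<lambda>x. x + t *\<^sub>R e p) ` (K \<inter> cball p (3/4 * \<rho> p)). ball y (\<epsilon> p)) \<subseteq> \<Omega>" by metis
  \<comment> \<open>Four averages reach \<open>8 * k\<close> and an increment adds at most
    \<open>k\<close>. The total \<open>9 * k\<close> is below \<open>\<epsilon> p\<close>, so all
    points met lie in \<Omega>; with \<open>t \<le> d / 2\<close> they also stay within
    \<open>d\<close> of \<open>x\<close>.\<close>
  define k where "k = Min (insert d (\<epsilon> ` F)) / 20"
  have k: "0 < k" "k \<le> d / 20" "\<And>p. p \<in> F \<Longrightarrow> k \<le> \<epsilon> p / 20"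
    unfolding k_def using F \<epsilon>(1) d by (auto intro!: divide_right_mono)
  obtain B0 where "\<forall>y\<in>u ` K. norm y \<le> B0"
    using compact_imp_bounded[OF compact_continuous_image[OF u[folded K_def] K(1)]] unfolding bounded_iff by blast
  then have B0: "norm (u x) \<le> \<bar>B0\<bar>" if "x \<in> K" for x using that by force
  define B where "B = \<bar>B0\<bar>"
  have B: "0 \<le> B" "\<And>x. x \<in> K \<Longrightarrow> norm (u x) \<le> B" using B0 by (auto simp: B_def)
  \<comment> \<open>Only continuity is extended; derivatives of \<open>uh\<close> are taken inside
    \<Omega>, where the inward translation puts every point that is averaged.\<close>
  obtain uh where uh: "continuous_on UNIV uh" "\<And>x. x \<in> K \<Longrightarrow> uh x = u x" "\<And>x. norm (uh x) \<le> B"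
    by (rule Tietze[OF u[folded K_def], of UNIV B]) (use K(2) B in auto)
  have duh: "((\<lambda>s. uh (z + s *\<^sub>R axis j 1)) has_real_derivative g j (z + s *\<^sub>R axis j 1)) (at s)"
    if zs: "z + s *\<^sub>R axis j 1 \<in> \<Omega>" for z s j
  proof -
    obtain u' where u': "(u has_derivative u') (at (z + s *\<^sub>R axis j 1))" "u' (axis j 1) = g j (z + s *\<^sub>R axis j 1)"
      using du[OF zs] by blast
    have "(uh has_derivative u') (at (z + s *\<^sub>R axis j 1))"
      by (rule has_derivative_transform_within_open[OF u'(1) \<Omega>(1) zs]) (use uh(2) K in auto)
    moreover have "((\<lambda>s. z + s *\<^sub>R axis j 1) has_derivative (\<lambda>h. h *\<^sub>R axis j 1)) (at s)"
      by (auto intro!: derivative_eq_intros)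
    ultimately have "((\<lambda>s. uh (z + s *\<^sub>R axis j 1)) has_derivative (\<lambda>h. u' (h *\<^sub>R axis j 1))) (at s)"
      by (rule has_derivative_compose[rotated])
    moreover have "u' (h *\<^sub>R axis j 1) = g j (z + s *\<^sub>R axis j 1) * h" for h
      using linear_scale[OF has_derivative_linear[OF u'(1)], of h "axis j 1"] u'(2) by simp
    ultimately show ?thesis by (simp add: has_field_derivative_def)
  qed
  define S where "S = mol 4 k uh"
  have JS: "Jet 4 UNIV B (1 / k) S" unfolding S_def by (rule Jet_mol[OF k(1) uh(1)]) (use uh(3) in auto)
  have BS: "Cb 4 S" by (rule Jet_imp_Cb[OF JS]) (use B k in auto)
  have pS: "has_pd j S (pd j S)" for j using Cb_pd(1)[of 3 S] BS by (simp add: eval_nat_numeral)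
  have loc: "\<bar>S (x + t *\<^sub>R e p) - u x\<bar> \<le> \<eta>' \<and> (\<forall>j. \<bar>pd j S (x + t *\<^sub>R e p) - g j x\<bar> \<le> \<eta>')"
    if p: "p \<in> F" and x: "x \<in> K" "dist x p \<le> 3/4 * \<rho> p" for p x
  proof -
    let ?y = "x + t *\<^sub>R e p"
    have pt: "z \<in> \<Omega> \<and> dist z x < d" if "dist z ?y \<le> 9 * k" for z
    proof
      have "dist ?y z < \<epsilon> p" using that k(1,3) p by (fastforce simp: dist_commute)
      moreover have "?y \<in> (\<lambda>x. x + t *\<^sub>R e p) ` (K \<inter> cball p (3/4 * \<rho> p))"
        using x by (intro imageI) (simp add: dist_commute)
      ultimately show "z \<in> \<Omega>" using \<epsilon>(2)[OF p] by (meson UN_I mem_ball subset_iff)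
      have "dist ?y x \<le> t * 1" using \<rho>(2)[of p] p F t(1) by (auto simp: dist_norm intro!: mult_left_mono)
      then show "dist z x < d" using that dist_triangle[of z x ?y] t(2) k(1,2) by simp
    qed
    have "\<bar>S ?y - u x\<bar> \<le> \<eta>'"
      unfolding S_def
    proof (rule mol_approx[OF k(1) uh(1)])
      fix z assume "z \<in> cube ?y (real 4 * k)"
      then have "dist z ?y \<le> 9 * k" using cube_dist[of z ?y] k(1) by fastforce
      then have "z \<in> K" "dist z x < d0" using pt[of z] K(4) d(2) by auto
      then show "\<bar>uh z - u x\<bar> \<le> \<eta>'" using d0(2)[OF x(1)] uh(2) by simp
    qed
    moreover have "\<bar>pd j S ?y - g j x\<bar> \<le> \<eta>'" for j
    proof (rule pd_mol_approx[OF k(1) uh(1) k(1)])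
      show "has_pd j (mol 4 k uh) (pd j S)" using pS by (simp add: S_def)
      fix z h assume z: "z \<in> cube ?y (real 4 * k)" and h: "\<bar>h\<bar> \<le> k"
      have "z + s *\<^sub>R axis j 1 \<in> \<Omega> \<and> dist (z + s *\<^sub>R axis j 1) x < d" if "\<bar>s\<bar> \<le> \<bar>h\<bar>" for s
      proof (rule pt)
        have "dist (z + s *\<^sub>R axis j 1) z \<le> k" using that h by (simp add: dist_norm)
        moreover have "dist z ?y \<le> 8 * k" using cube_dist[OF z] by simp
        ultimately show "dist (z + s *\<^sub>R axis j 1) ?y \<le> 9 * k"
          using dist_triangle[of "z + s *\<^sub>R axis j 1" ?y z] by simp
      qed
      then have q: "z + s *\<^sub>R axis j 1 \<in> \<Omega>" "dist (z + s *\<^sub>R axis j 1) x < dj j" if "\<bar>s\<bar> \<le> \<bar>h\<bar>" for s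
        using that d(3)[of j] by (auto intro: less_le_trans)
      show "\<bar>uh (z + h *\<^sub>R axis j 1) - uh z - g j x * h\<bar> \<le> \<eta>' * \<bar>h\<bar>"
        by (rule axis_increment_bound[OF duh[OF q(1)] dj(2)[OF x(1) subsetD[OF K(4) q(1)] q(2)]])
    qed
    ultimately show ?thesis by blast
  qed
  define U where "U = (\<lambda>x. \<Sum>p\<in>F. \<theta> p x * S (x + t *\<^sub>R e p))"
  have p\<theta>: "has_pd j (\<theta> p) (pd j (\<theta> p))" if "p \<in> F" for j p
    using Cb_pd(1)[of 3 "\<theta> p"] \<theta>(1)[OF that] by (simp add: eval_nat_numeral)
  have "has_pd j U (\<lambda>x. \<Sum>p\<in>F. pd j (\<theta> p) x * S (x + t *\<^sub>R e p) + \<theta> p x * pd j S (x + t *\<^sub>R e p))" for j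
    unfolding U_def by (intro has_pd_sum has_pd_mult has_pd_shift pS p\<theta>)
  note pU = has_pd_imp_pd[OF this]
  have "\<bar>U x - u x\<bar> \<le> \<eta> \<and> (\<forall>j. \<bar>pd j U x - g j x\<bar> \<le> \<eta>)" if x: "x \<in> K" for x
  proof (intro conjI allI)
    have N\<eta>: "N * (1 / l * \<eta>' + \<eta>') \<le> \<eta>" using \<eta>' by simp
    have bs: "\<bar>\<Sum>p\<in>F. h p\<bar> \<le> \<eta>" if "\<And>p. p \<in> F \<Longrightarrow> \<bar>h p\<bar> \<le> 1 / l * \<eta>' + \<eta>'" for h :: "real^2 \<Rightarrow> real"
    proof -
      have "\<bar>\<Sum>p\<in>F. h p\<bar> \<le> (\<Sum>p\<in>F. \<bar>h p\<bar>)" by (rule sum_abs)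
      also have "\<dots> \<le> N * (1 / l * \<eta>' + \<eta>')" unfolding N_def by (rule sum_bounded_above[OF that])
      finally show ?thesis using N\<eta> by linarith
    qed
    have a: "\<bar>\<theta> p x * (S (x + t *\<^sub>R e p) - u x)\<bar> \<le> \<eta>'" "\<bar>\<theta> p x * (pd j S (x + t *\<^sub>R e p) - g j x)\<bar> \<le> \<eta>'"
      "\<bar>pd j (\<theta> p) x * (S (x + t *\<^sub>R e p) - u x)\<bar> \<le> 1 / l * \<eta>'" if p: "p \<in> F" for p j
    proof -
      have "\<bar>\<theta> p x * (S (x + t *\<^sub>R e p) - u x)\<bar> \<le> 1 * \<eta>' \<and> \<bar>\<theta> p x * (pd j S (x + t *\<^sub>R e p) - g j x)\<bar> \<le> 1 * \<eta>' \<and>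
        \<bar>pd j (\<theta> p) x * (S (x + t *\<^sub>R e p) - u x)\<bar> \<le> 1 / l * \<eta>'"
      proof (cases "dist x p \<le> 3/4 * \<rho> p")
        case True
        then show ?thesis using loc[OF p x True] \<theta>(2,3)[OF p] l unfolding abs_mult by (intro conjI mult_mono) auto
      next
        case False
        then show ?thesis using \<theta>(4,5)[OF p, of x] \<eta>'(1) l by simp
      qed
      then show "\<bar>\<theta> p x * (S (x + t *\<^sub>R e p) - u x)\<bar> \<le> \<eta>'" "\<bar>\<theta> p x * (pd j S (x + t *\<^sub>R e p) - g j x)\<bar> \<le> \<eta>'"
      "\<bar>pd j (\<theta> p) x * (S (x + t *\<^sub>R e p) - u x)\<bar> \<le> 1 / l * \<eta>'" by auto
    qed
    \<comment> \<open>The weights sum to 1 and their derivatives to 0, so \<open>u x\<close> may be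
      subtracted inside the sums: a derivative falling on a weight then meets a small
      factor.\<close>
    have "U x - u x = (\<Sum>p\<in>F. \<theta> p x * (S (x + t *\<^sub>R e p) - u x))"
      unfolding U_def using \<theta>(6)[OF x]
      by (simp add: right_diff_distrib sum_subtractf sum_distrib_right[symmetric])
    moreover have "\<bar>\<Sum>p\<in>F. \<theta> p x * (S (x + t *\<^sub>R e p) - u x)\<bar> \<le> \<eta>"
    proof (rule bs)
      show "\<bar>\<theta> p x * (S (x + t *\<^sub>R e p) - u x)\<bar> \<le> 1 / l * \<eta>' + \<eta>'" if "p \<in> F" for p
        using a(1)[OF that] \<eta>'(1) l by (simp add: add_increasing)
    qed
    ultimately show "\<bar>U x - u x\<bar> \<le> \<eta>" by simp
    fix j
    have "pd j U x - g j x = (\<Sum>p\<in>F. pd j (\<theta> p) x * (S (x + t *\<^sub>R e p) - u x) + \<theta> p x * (pd j S (x + t *\<^sub>R e p) - g j x))"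
      unfolding pU using \<theta>(6)[OF x] \<theta>(7)[OF x, of j]
      by (simp add: right_diff_distrib sum_subtractf sum.distrib sum_distrib_right[symmetric])
    moreover have "\<bar>\<Sum>p\<in>F. pd j (\<theta> p) x * (S (x + t *\<^sub>R e p) - u x) + \<theta> p x * (pd j S (x + t *\<^sub>R e p) - g j x)\<bar> \<le> \<eta>"
      by (rule bs) (use a in \<open>auto intro!: order_trans[OF abs_triangle_ineq] add_mono\<close>)
    ultimately show "\<bar>pd j U x - g j x\<bar> \<le> \<eta>" by simp
  qed
  moreover have "Cb 4 U" unfolding U_def by (intro Cb_sum F Cb_mult \<theta> Cb_shift BS)
  ultimately show ?thesis unfolding K_def by blast
qed

section \<open>Extension of the data to the plane\<close>

lemma global_solution:
  fixes A :: "2 \<Rightarrow> 2 \<Rightarrow> real^2 \<Rightarrow> real"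
  assumes \<alpha>: "0 < \<alpha>" "\<alpha> < 1/7" "\<alpha> < \<beta> / 2"
    and v: "Cb 4 v" and w: "\<And>j. Cb 4 (w j)" and H: "0 \<le> H"
    and A: "\<And>i j x y. \<bar>A i j x - A i j y\<bar> \<le> H * dist x y powr \<beta>" and bA: "\<And>i j x. \<bar>A i j x\<bar> \<le> HA"
    and \<kappa>: "0 < \<kappa>" and pos: "\<And>x y z. \<kappa> * (y^2 + z^2) \<le> (A 1 1 x - strain v w 1 1 x) * y^2
        + 2 * (A 1 2 x - strain v w 1 2 x) * y * z + (A 2 2 x - strain v w 2 2 x) * z^2"
    and \<epsilon>: "0 < \<epsilon>"
  shows "\<exists>v' w'. C1_Holder_pd \<alpha> v' \<and> (\<forall>j. C1_Holder_pd \<alpha> (w' j)) \<and> (\<forall>x. \<bar>v' x - v x\<bar> \<le> \<epsilon>) \<and>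
     (\<forall>j x. \<bar>w' j x - w j x\<bar> \<le> \<epsilon>) \<and> (\<forall>x. strain v' w' 1 2 x = A 1 2 x) \<and> (\<forall>k x. strain v' w' k k x = A k k x)"
proof -
  have \<beta>: "0 < \<beta>" and \<epsilon>2: "0 < \<epsilon> / 2" using \<alpha> \<epsilon> by auto
  obtain \<delta> v1 w1 where 1: "0 < \<delta>" "\<delta> \<le> 1" "Cb 3 v1" "\<forall>j. Cb 2 (w1 j)" "\<forall>x. \<bar>v1 x - v x\<bar> \<le> \<epsilon> / 2"
     "\<forall>j x. \<bar>w1 j x - w j x\<bar> \<le> \<epsilon> / 2" "deficit_near A v1 w1 \<delta>"
    using initial_stage[where w = w, OF v w H \<beta> A bA \<kappa> pos \<epsilon>2] by (elim exE conjE) (rule that; assumption)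
  have v1: "Cb 2 v1" using Cb_le[OF 1(3)] by simp
  have b1: "\<exists>G. \<forall>x. \<bar>pd j f x\<bar> \<le> G" if "Cb 2 f" for j f
    using Cb_bound[OF Cb_pd(2)[of 1 f j]] that by (auto simp: numeral_2_eq_2)
  obtain Mv where Mv: "C2fun Mv v1" using Cb_C2fun[OF v1] by blast
  have "\<exists>M. C2fun M (w1 j)" for j using Cb_C2fun 1(4) by blast
  then obtain Mw where Mw: "\<And>j. C2fun (Mw j) (w1 j)" by metis
  obtain Gv where Gv: "\<And>j x. \<bar>pd j v1 x\<bar> \<le> Gv j" using b1[OF v1] by metis
  have "\<forall>i j. \<exists>G. \<forall>x. \<bar>pd i (w1 j) x\<bar> \<le> G" using b1 1(4) by blast
  then obtain Gw where Gw: "\<And>i j x. \<bar>pd i (w1 j) x\<bar> \<le> Gw i j" by metis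
  define M0 where "M0 = max Mv (max (Mw 1) (Mw 2))"
  define G0 where "G0 = \<bar>Gv 1\<bar> + \<bar>Gv 2\<bar> + (\<bar>Gw 1 1\<bar> + \<bar>Gw 1 2\<bar> + \<bar>Gw 2 1\<bar> + \<bar>Gw 2 2\<bar>)"
  have M0: "C2fun M0 v1" "C2fun M0 (w1 j)" for j
  proof -
    show "C2fun M0 v1" by (rule C2fun_mono[OF Mv]) (simp add: M0_def)
    show "C2fun M0 (w1 j)" by (rule C2fun_mono[OF Mw]) (use exhaust_2[of j] in \<open>auto simp: M0_def\<close>)
  qed
  have G0v: "\<bar>pd j v1 x\<bar> \<le> G0" for j x
  proof -
    have "Gv j \<le> \<bar>Gv 1\<bar> + \<bar>Gv 2\<bar>" using exhaust_2[of j] by auto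
    then show ?thesis using Gv[of j x] unfolding G0_def by linarith
  qed
  have G0w: "\<bar>pd i (w1 j) x\<bar> \<le> G0" for i j x
  proof -
    have "Gw i j \<le> \<bar>Gw 1 1\<bar> + \<bar>Gw 1 2\<bar> + \<bar>Gw 2 1\<bar> + \<bar>Gw 2 2\<bar>" using exhaust_2[of j] exhaust_2[of i] by auto
    then show ?thesis using Gw[of i j x] unfolding G0_def by linarith
  qed
  obtain v2 w2 where 2: "C1_Holder_pd \<alpha> v2" "\<forall>j. C1_Holder_pd \<alpha> (w2 j)" "\<forall>x. \<bar>v2 x - v1 x\<bar> \<le> \<epsilon> / 2"
     "\<forall>j x. \<bar>w2 j x - w1 j x\<bar> \<le> \<epsilon> / 2" "\<forall>x. strain v2 w2 1 2 x = A 1 2 x" "\<forall>k x. strain v2 w2 k k x = A k k x"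
    using iteration[where w = w1, OF \<alpha> H A 1(1,2) M0 G0v G0w 1(7) \<epsilon>2] by (elim exE conjE) (rule that; assumption)
  have half: "\<bar>p - r\<bar> \<le> \<epsilon>" if "\<bar>p - q\<bar> \<le> \<epsilon> / 2" "\<bar>q - r\<bar> \<le> \<epsilon> / 2" for p q r
    using that by linarith
  show ?thesis
    using 2 half[OF 2(3)[rule_format] 1(5)[rule_format]] half[OF 2(4)[rule_format] 1(6)[rule_format]]
    by (intro exI[of _ v2] exI[of _ w2]) auto
qed

section \<open>Hoelder continuous extension\<close>

lemma powr_subadd:
  fixes a b :: real
  assumes "0 \<le> a" "0 \<le> b" "0 < \<beta>" "\<beta> \<le> 1"
  shows "(a + b) powr \<beta> \<le> a powr \<beta> + b powr \<beta>"
proof (cases "a + b = 0")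
  case False
  then have s: "0 < a + b" using assms by simp
  have le: "x \<le> x powr \<beta>" if "0 \<le> x" "x \<le> 1" for x :: real
  proof (cases "x = 0")
    case False
    then have "x powr 1 \<le> x powr \<beta>" using that assms by (intro powr_mono') auto
    then show ?thesis using that by simp
  qed simp
  \<comment> \<open>After division by \<open>a + b\<close> both ratios lie in [0, 1], where raising
    to the power \<beta> does not decrease, and they sum to 1.\<close>
  have "a / (a + b) \<le> (a / (a + b)) powr \<beta>" "b / (a + b) \<le> (b / (a + b)) powr \<beta>"
    using assms s by (auto intro!: le)
  moreover have "a / (a + b) + b / (a + b) = 1" using s by (simp add: add_divide_distrib[symmetric])
  ultimately have "1 \<le> (a / (a + b)) powr \<beta> + (b / (a + b)) powr \<beta>" by linarith
  also have "\<dots> = (a powr \<beta> + b powr \<beta>) / (a + b) powr \<beta>"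
    using assms s by (simp add: powr_divide add_divide_distrib)
  finally show ?thesis using s by (simp add: le_divide_eq)
qed (use assms in auto)

lemma powr_diff_le:
  fixes a b d :: real
  assumes "0 \<le> a" "0 \<le> b" "\<bar>a - b\<bar> \<le> d" "0 < \<beta>" "\<beta> \<le> 1"
  shows "\<bar>a powr \<beta> - b powr \<beta>\<bar> \<le> d powr \<beta>"
proof -
  have d: "0 \<le> d" using assms(3) by linarith
  have *: "x powr \<beta> \<le> y powr \<beta> + d powr \<beta>" if "0 \<le> x" "0 \<le> y" "x \<le> y + d" for x y
    using powr_mono2[of \<beta> x "y + d"] powr_subadd[of y d \<beta>] that assms d by linarith
  show ?thesis using *[of a b] *[of b a] assms by linarith
qed

text \<open>McShane's infimum formula for the metric \<open>dist x y powr \<beta>\<close>, a metric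
  by \<open>powr_subadd\<close>. Truncation to [-B, B] preserves both the Hoelder constant and the
  values on \<open>S\<close>.\<close>

lemma Holder_extension:
  fixes f :: "real^2 \<Rightarrow> real"
  assumes ne: "S \<noteq> {}" and \<beta>: "0 < \<beta>" "\<beta> \<le> 1" and c: "0 \<le> c"
    and f: "\<And>x y. x \<in> S \<Longrightarrow> y \<in> S \<Longrightarrow> \<bar>f x - f y\<bar> \<le> c * dist x y powr \<beta>" and B: "\<And>x. x \<in> S \<Longrightarrow> \<bar>f x\<bar> \<le> B"
  shows "\<exists>F. (\<forall>x\<in>S. F x = f x) \<and> (\<forall>x y. \<bar>F x - F y\<bar> \<le> c * dist x y powr \<beta>) \<and> (\<forall>x. \<bar>F x\<bar> \<le> B)"
proof -
  define E where "E = (\<lambda>x. INF y\<in>S. f y + c * dist x y powr \<beta>)"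
  have lb: "bdd_below ((\<lambda>y. f y + c * dist x y powr \<beta>) ` S)" for x
  proof (rule bdd_belowI2)
    fix y assume "y \<in> S"
    then show "- B \<le> f y + c * dist x y powr \<beta>" using B[of y] c by (smt (verit) mult_nonneg_nonneg powr_ge_zero)
  qed
  have E_le: "E x \<le> f y + c * dist x y powr \<beta>" if "y \<in> S" for x y
    unfolding E_def by (rule cINF_lower[OF lb that])
  have EE: "E x \<le> E x' + c * dist x x' powr \<beta>" for x x'
  proof -
    have "E x - c * dist x x' powr \<beta> \<le> f y + c * dist x' y powr \<beta>" if y: "y \<in> S" for y
    proof -
      have "dist x y powr \<beta> \<le> (dist x' y + dist x x') powr \<beta>"
        using dist_triangle[of x y x'] \<beta> by (intro powr_mono2) auto
      also have "\<dots> \<le> dist x' y powr \<beta> + dist x x' powr \<beta>" by (rule powr_subadd) (use \<beta> in auto)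
      finally have "c * dist x y powr \<beta> \<le> c * (dist x' y powr \<beta> + dist x x' powr \<beta>)" using c by (rule mult_left_mono)
      then show ?thesis using E_le[OF y, of x] by (simp add: distrib_left)
    qed
    then have "E x - c * dist x x' powr \<beta> \<le> (INF y\<in>S. f y + c * dist x' y powr \<beta>)"
      by (intro cINF_greatest ne)
    also have "\<dots> = E x'" by (simp add: E_def)
    finally show ?thesis by simp
  qed
  have ES: "E x = f x" if x: "x \<in> S" for x
  proof (rule antisym)
    show "E x \<le> f x" using E_le[OF x, of x] \<beta> by simp
    show "f x \<le> E x" unfolding E_def
    proof (rule cINF_greatest[OF ne])
      fix y assume "y \<in> S"
      then show "f x \<le> f y + c * dist x y powr \<beta>" using f[OF x \<open>y \<in> S\<close>] by linarith
    qed
  qed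
  have B0: "0 \<le> B" using B ne by (meson abs_ge_zero ex_in_conv order_trans)
  define F where "F = (\<lambda>x. max (- B) (min B (E x)))"
  have "\<bar>F x - F y\<bar> \<le> c * dist x y powr \<beta>" for x y
    using EE[of x y] EE[of y x] unfolding F_def by (simp add: dist_commute)
  moreover have "F x = f x" if "x \<in> S" for x using B[OF that] ES[OF that] by (auto simp: F_def abs_le_iff)
  moreover have "\<bar>F x\<bar> \<le> B" for x using B0 by (auto simp: F_def)
  ultimately show ?thesis by blast
qed

text \<open>Away from \<open>K\<close>, the extension of \<open>a\<close> is increased by a multiple of the unit matrix that grows like
  the \<open>\<beta>\<close>-th power of the distance from \<open>K\<close>; this compensates the possible loss of positivity.\<close>

lemma extend_deficit:
  fixes a :: "2 \<Rightarrow> 2 \<Rightarrow> real^2 \<Rightarrow> real"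
  assumes K: "compact K" "K \<noteq> {}" and \<beta>: "0 < \<beta>" "\<beta> \<le> 1" and c: "0 \<le> c"
    and a: "\<And>i j x y. x \<in> K \<Longrightarrow> y \<in> K \<Longrightarrow> \<bar>a i j x - a i j y\<bar> \<le> c * dist x y powr \<beta>"
    and B: "\<And>i j x. x \<in> K \<Longrightarrow> \<bar>a i j x\<bar> \<le> B"
    and v: "Cb 4 v" and w: "\<And>j. Cb 4 (w j)" and \<kappa>: "0 < \<kappa>"
    and pos: "\<And>x y z. x \<in> K \<Longrightarrow> \<kappa> * (y^2 + z^2) \<le> (a 1 1 x - strain v w 1 1 x) * y^2
        + 2 * (a 1 2 x - strain v w 1 2 x) * y * z + (a 2 2 x - strain v w 2 2 x) * z^2"
  shows "\<exists>A H HA. 0 \<le> H \<and> (\<forall>i j. \<forall>x\<in>K. A i j x = a i j x) \<and>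
     (\<forall>i j x y. \<bar>A i j x - A i j y\<bar> \<le> H * dist x y powr \<beta>) \<and> (\<forall>i j x. \<bar>A i j x\<bar> \<le> HA) \<and>
     (\<forall>x y z. \<kappa> * (y^2 + z^2) \<le> (A 1 1 x - strain v w 1 1 x) * y^2
        + 2 * (A 1 2 x - strain v w 1 2 x) * y * z + (A 2 2 x - strain v w 2 2 x) * z^2)"
proof -
  have "\<exists>F. (\<forall>x\<in>K. F x = a i j x) \<and> (\<forall>x y. \<bar>F x - F y\<bar> \<le> c * dist x y powr \<beta>) \<and> (\<forall>x. \<bar>F x\<bar> \<le> B)" for i j
    by (rule Holder_extension[OF K(2) \<beta> c a B])
  then obtain E where E: "\<And>i j x. x \<in> K \<Longrightarrow> E i j x = a i j x" "\<And>i j x y. \<bar>E i j x - E i j y\<bar> \<le> c * dist x y powr \<beta>"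
    "\<And>i j x. \<bar>E i j x\<bar> \<le> B" by metis
  have Bsq: "Cb (Suc 2) (strain v w i j)" for i j
    by (rule Cb_strain) (use v w in \<open>simp_all add: eval_nat_numeral\<close>)
  have "\<exists>C\<ge>0. \<forall>x y. \<bar>strain v w i j x\<bar> \<le> C \<and> \<bar>strain v w i j x - strain v w i j y\<bar> \<le> 2 * C * dist x y powr \<beta>" for i j
  proof -
    obtain C where C: "C \<ge> 0" "Jet (Suc 2) UNIV C 1 (strain v w i j)" using Bsq by (auto simp: Cb_def)
    have b: "\<bar>strain v w i j x\<bar> \<le> C" for x using Jet_bound[OF C(2)] by simp
    have l: "\<bar>strain v w i j x - strain v w i j y\<bar> \<le> 2 * C * dist x y" for x y
      by (rule has_pd_lipschitz[OF Jet_pd(1)[OF C(2)]]) (use Jet_bound[OF Jet_pd(2)[OF C(2)]] in auto)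
    have "\<bar>strain v w i j x - strain v w i j y\<bar> \<le> 2 * C * dist x y powr \<beta>" for x y
    \<comment> \<open>Lipschitz and bounded implies Hoelder: the Lipschitz bound is used at
      distances up to 1, the sup bound beyond.\<close>
    proof (cases "dist x y \<le> 1")
      case True
      have "dist x y \<le> dist x y powr \<beta>"
      proof (cases "dist x y = 0")
        case False
        then have "dist x y powr 1 \<le> dist x y powr \<beta>" using True \<beta> by (intro powr_mono') auto
        then show ?thesis by simp
      qed simp
      then have "2 * C * dist x y \<le> 2 * C * dist x y powr \<beta>" using C by (intro mult_left_mono) auto
      then show ?thesis using l[of x y] by linarith
    next
      case False
      then have "1 \<le> dist x y powr \<beta>" using \<beta> by (simp add: ge_one_powr_ge_zero)
      then have "2 * C * 1 \<le> 2 * C * dist x y powr \<beta>" using C by (intro mult_left_mono) auto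
      then show ?thesis using b[of x] b[of y] by linarith
    qed
    then show ?thesis using C(1) b by blast
  qed
  then obtain C0 where C0: "\<And>i j. 0 \<le> C0 i j" "\<And>i j x. \<bar>strain v w i j x\<bar> \<le> C0 i j"
    "\<And>i j x y. \<bar>strain v w i j x - strain v w i j y\<bar> \<le> 2 * C0 i j * dist x y powr \<beta>" by metis
  define C where "C = C0 1 1 + C0 1 2 + (C0 2 1 + C0 2 2)"
  have Cle: "C0 i j \<le> C" for i j using C0(1) exhaust_2[of i] exhaust_2[of j] by (auto simp: C_def)
  have sqb: "\<bar>strain v w i j x\<bar> \<le> C" for i j x using C0(2) Cle order_trans by blast
  have sqh: "\<bar>strain v w i j x - strain v w i j y\<bar> \<le> 2 * C * dist x y powr \<beta>" for i j x y
    by (rule order_trans[OF C0(3)]) (use Cle in \<open>auto intro!: mult_right_mono\<close>)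
  have C1: "0 \<le> C" using order_trans[OF abs_ge_zero sqb] .
  have B1: "0 \<le> B" using order_trans[OF abs_ge_zero E(3)] .
  define H' where "H' = c + 2 * C"
  define D where "D = (\<lambda>i j x. E i j x - strain v w i j x)"
  have Dh: "\<bar>D i j x - D i j y\<bar> \<le> H' * dist x y powr \<beta>" for i j x y
    using E(2)[of i j x y] sqh[of i j x y] unfolding D_def H'_def distrib_right by linarith
  have Db: "\<bar>D i j x\<bar> \<le> B + C" for i j x using E(3)[of i j x] sqb[of i j x] unfolding D_def by linarith
  \<comment> \<open>Between the nearest point of \<open>K\<close> and \<open>x\<close> the form of
    \<open>D\<close> loses at most twice the oscillation of its entries, which \<open>2 * H'\<close>
    compensates. The cap keeps \<open>th\<close> bounded; where it is attained, the form is at least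
    \<kappa> without reference to \<open>K\<close>.\<close>
  define th where "th = (\<lambda>x. min (2 * H' * infdist x K powr \<beta>) (2 * (B + C) + \<kappa>))"
  have H'0: "0 \<le> H'" using c C1 by (simp add: H'_def)
  have th0: "th x = 0" if "x \<in> K" for x using that B1 C1 \<kappa> \<beta> by (simp add: th_def)
  have thb: "0 \<le> th x" "th x \<le> 2 * (B + C) + \<kappa>" for x using H'0 B1 C1 \<kappa> by (auto simp: th_def)
  have thh: "\<bar>th x - th y\<bar> \<le> 2 * H' * dist x y powr \<beta>" for x y
  proof -
    have "\<bar>infdist x K - infdist y K\<bar> \<le> dist x y"
      using infdist_triangle[of x K y] infdist_triangle[of y K x] by (simp add: dist_commute)
    then have "\<bar>infdist x K powr \<beta> - infdist y K powr \<beta>\<bar> \<le> dist x y powr \<beta>"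
      by (intro powr_diff_le infdist_nonneg \<beta>)
    then have "2 * H' * \<bar>infdist x K powr \<beta> - infdist y K powr \<beta>\<bar> \<le> 2 * H' * dist x y powr \<beta>"
      using H'0 by (intro mult_left_mono) auto
    then have "\<bar>2 * H' * infdist x K powr \<beta> - 2 * H' * infdist y K powr \<beta>\<bar> \<le> 2 * H' * dist x y powr \<beta>"
      using H'0 by (simp add: right_diff_distrib[symmetric] abs_mult)
    then show ?thesis unfolding th_def by linarith
  qed
  define A where "A = (\<lambda>i j x. E i j x + (if i = j then th x else 0))"
  have "\<kappa> * (y^2 + z^2) \<le> (A 1 1 x - strain v w 1 1 x) * y^2
        + 2 * (A 1 2 x - strain v w 1 2 x) * y * z + (A 2 2 x - strain v w 2 2 x) * z^2" for x y z
  proof -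
    let ?n = "y^2 + z^2"
    have "(A 1 1 x - strain v w 1 1 x) * y^2 + 2 * (A 1 2 x - strain v w 1 2 x) * y * z + (A 2 2 x - strain v w 2 2 x) * z^2
      = (D 1 1 x * y^2 + 2 * D 1 2 x * y * z + D 2 2 x * z^2) + th x * ?n"
      by (simp add: A_def D_def algebra_simps)
    moreover have "\<kappa> * ?n \<le> (D 1 1 x * y^2 + 2 * D 1 2 x * y * z + D 2 2 x * z^2) + th x * ?n"
    proof (cases "2 * H' * infdist x K powr \<beta> \<le> 2 * (B + C) + \<kappa>")
      case True
      then have th: "th x = 2 * H' * infdist x K powr \<beta>" by (simp add: th_def)
      obtain q where q: "q \<in> K" "infdist x K = dist x q"
        using infdist_attains_inf[OF compact_imp_closed[OF K(1)] K(2)] by blast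
      have "- (2 * (H' * dist x q powr \<beta>) * ?n) \<le> (D 1 1 x - D 1 1 q) * y^2 + 2 * (D 1 2 x - D 1 2 q) * y * z + (D 2 2 x - D 2 2 q) * z^2"
        by (rule quadratic_perturbation[OF Dh Dh Dh])
      moreover have "\<kappa> * ?n \<le> D 1 1 q * y^2 + 2 * D 1 2 q * y * z + D 2 2 q * z^2"
        using pos[OF q(1), of y z] E(1)[OF q(1)] by (simp add: D_def)
      moreover have "th x * ?n = 2 * (H' * dist x q powr \<beta>) * ?n" unfolding th q(2) by simp
      moreover have "(D 1 1 x - D 1 1 q) * y^2 + 2 * (D 1 2 x - D 1 2 q) * y * z + (D 2 2 x - D 2 2 q) * z^2
        = (D 1 1 x * y^2 + 2 * D 1 2 x * y * z + D 2 2 x * z^2) - (D 1 1 q * y^2 + 2 * D 1 2 q * y * z + D 2 2 q * z^2)"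
        by (simp add: algebra_simps)
      ultimately show ?thesis by linarith
    next
      case False
      then have th: "th x = 2 * (B + C) + \<kappa>" by (simp add: th_def)
      have "- (2 * (B + C) * ?n) \<le> D 1 1 x * y^2 + 2 * D 1 2 x * y * z + D 2 2 x * z^2"
        by (rule quadratic_perturbation[OF Db Db Db])
      moreover have "th x * ?n = 2 * (B + C) * ?n + \<kappa> * ?n" unfolding th by (simp add: distrib_right)
      ultimately show ?thesis by linarith
    qed
    ultimately show ?thesis by simp
  qed
  moreover have "\<forall>i j. \<forall>x\<in>K. A i j x = a i j x" using E(1) th0 by (simp add: A_def)
  moreover have "\<bar>A i j x - A i j y\<bar> \<le> (c + 2 * H') * dist x y powr \<beta>" for i j x y
    using E(2)[of i j x y] thh[of x y] H'0 unfolding A_def distrib_right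
    by (smt (verit) mult_nonneg_nonneg powr_ge_zero)
  moreover have "\<bar>A i j x\<bar> \<le> B + (2 * (B + C) + \<kappa>)" for i j x
    using E(3)[of i j x] thb[of x] unfolding A_def by (smt (verit))
  moreover have "0 \<le> c + 2 * H'" using c H'0 by simp
  ultimately show ?thesis by (intro exI[of _ A] exI[of _ "c + 2 * H'"] exI[of _ "B + (2 * (B + C) + \<kappa>)"]) blast
qed

section \<open>Proof of the theorem\<close>

lemma C1_closure_derivative:
  assumes w: "C1_closure \<Omega> w"
  obtains g where "\<And>j. continuous_on (closure \<Omega>) (g j)"
    "\<And>x. x \<in> \<Omega> \<Longrightarrow> (w has_derivative frechet_derivative w (at x)) (at x)"
    "\<And>x j. x \<in> \<Omega> \<Longrightarrow> frechet_derivative w (at x) (axis j 1) = g j x"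
proof -
  have "\<exists>g. continuous_on (closure \<Omega>) g \<and> (\<forall>x\<in>\<Omega>. g x = partial_deriv j w x)" for j
    using w by (simp add: C1_closure_def)
  then obtain g where g: "\<And>j. continuous_on (closure \<Omega>) (g j)" "\<And>j. \<forall>x\<in>\<Omega>. g j x = partial_deriv j w x" by metis
  show ?thesis
    by (rule that[OF g(1)])
       (use w g(2) in \<open>auto simp: C1_closure_def partial_deriv_def frechet_derivative_works[symmetric]\<close>)
qed

lemma C1_Holder_pd_has_derivative:
  assumes "C1_Holder_pd \<alpha> F" "0 < \<alpha>"
  shows "continuous_on UNIV (pd j F)" "(F has_derivative (\<lambda>h. pd 1 F x * h $ 1 + pd 2 F x * h $ 2)) (at x)"
proof -
  have c: "continuous_on UNIV (pd j F)" for j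
  proof -
    obtain K where "\<And>x y. \<bar>pd j F x - pd j F y\<bar> \<le> K * dist x y powr \<alpha>" using assms(1) unfolding C1_Holder_pd_def by blast
    then show ?thesis by (rule Holder_imp_continuous) (rule assms)
  qed
  show "continuous_on UNIV (pd j F)" by (rule c)
  show "(F has_derivative (\<lambda>h. pd 1 F x * h $ 1 + pd 2 F x * h $ 2)) (at x)"
    by (rule has_pd_has_derivative[OF _ c]) (use assms(1) in \<open>auto simp: C1_Holder_pd_def\<close>)
qed

lemma C1_Holder_closureI:
  fixes f :: "real^2 \<Rightarrow> 'b::real_normed_vector"
  assumes d: "\<And>x. (f has_derivative f' x) (at x)" and c: "\<And>i. continuous_on UNIV (\<lambda>x. f' x (axis i 1))"
    and B: "\<And>i. \<exists>B. \<forall>x. norm (f' x (axis i 1)) \<le> B"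
    and H: "\<And>i. \<exists>K. \<forall>x y. norm (f' x (axis i 1) - f' y (axis i 1)) \<le> K * dist x y powr \<alpha>"
  shows "C1_Holder_closure \<alpha> \<Omega> f"
proof -
  have p: "partial_deriv i f x = f' x (axis i 1)" for i x
    unfolding partial_deriv_def using frechet_derivative_at[OF d] by metis
  have "continuous_on (closure \<Omega>) f"
    using d by (intro has_derivative_continuous_on) (rule has_derivative_at_withinI)
  moreover have "f differentiable (at x)" for x using d by (auto simp: differentiable_def)
  moreover have "bounded ((\<lambda>x. f' x (axis i 1)) ` closure \<Omega>)" for i
    using B[of i] unfolding bounded_iff by blast
  ultimately show ?thesis
    unfolding C1_Holder_closure_def C1_closure_def C0_Holder_def p
    using continuous_on_subset[OF c subset_UNIV] H
    by (intro conjI allI ballI exI[where x = "\<lambda>x. f' x (axis _ 1)"]) blast+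
qed

lemma norm_axis_sum: "norm (a *\<^sub>R axis 1 1 + b *\<^sub>R axis 2 1 :: real^2) \<le> \<bar>a\<bar> + \<bar>b\<bar>"
  by (rule order_trans[OF norm_triangle_ineq]) simp

lemma C0_norm_le:
  assumes "\<Omega> \<noteq> {}" "\<And>x. x \<in> \<Omega> \<Longrightarrow> norm (f x) \<le> B" shows "C0_norm \<Omega> f \<le> B"
  unfolding C0_norm_def by (rule cSUP_least[OF assms])

theorem corollary3p2:
  fixes \<Omega> :: "(real^2) set"
    and \<alpha> \<beta> c \<epsilon> :: real
    and A :: "real^2 \<Rightarrow> real^2^2"
    and v :: "real^2 \<Rightarrow> real"
    and w :: "real^2 \<Rightarrow> real^2"
  assumes "domain \<Omega>" and "bounded \<Omega>" and "simply_connected \<Omega>" and "smooth_boundary \<Omega>"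
    and "0 < \<beta>" and "\<beta> < 1"
    and "0 < \<alpha>" and "\<alpha> < min (1/7) (\<beta>/2)"
    and "C0_Holder \<beta> (closure \<Omega>) A"
    and "\<forall>x\<in>closure \<Omega>. transpose (A x) = A x"
    and "C1_closure \<Omega> v" and "C1_closure \<Omega> w"
    and "c > 0"
    and "\<forall>x\<in>\<Omega>. matrix_le (2 *\<^sub>R sym_gradient w x + tensor (gradient v x) (gradient v x))
                         (A x - c *\<^sub>R mat 1)"
    and "\<epsilon> > 0"
  shows "\<exists>(v' :: real^2 \<Rightarrow> real) (w' :: real^2 \<Rightarrow> real^2).
           C1_Holder_closure \<alpha> \<Omega> v' \<and> C1_Holder_closure \<alpha> \<Omega> w' \<and>
           C0_norm \<Omega> (\<lambda>x. w' x - w x) + C0_norm \<Omega> (\<lambda>x. v' x - v x) \<le> \<epsilon> \<and>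
           (\<forall>x\<in>\<Omega>. 2 *\<^sub>R sym_gradient w' x + tensor (gradient v' x) (gradient v' x) = A x)"
proof -
  define K where "K = closure \<Omega>"
  have \<Omega>: "open \<Omega>" "\<Omega> \<noteq> {}" using assms(1) by (auto simp: domain_def)
  have K: "compact K" "K \<noteq> {}" "\<Omega> \<subseteq> K" using assms(2) \<Omega> by (auto simp: K_def closure_subset)
  have \<alpha>: "0 < \<alpha>" "\<alpha> < 1/7" "\<alpha> < \<beta> / 2" using assms by auto
  obtain gv where gv: "\<And>j. continuous_on K (gv j)"
    "\<And>x. x \<in> \<Omega> \<Longrightarrow> (v has_derivative frechet_derivative v (at x)) (at x)"
    "\<And>x j. x \<in> \<Omega> \<Longrightarrow> frechet_derivative v (at x) (axis j 1) = gv j x"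
    using C1_closure_derivative[OF assms(11)] unfolding K_def by blast
  obtain gw where gw: "\<And>j. continuous_on K (gw j)"
    "\<And>x. x \<in> \<Omega> \<Longrightarrow> (w has_derivative frechet_derivative w (at x)) (at x)"
    "\<And>x j. x \<in> \<Omega> \<Longrightarrow> frechet_derivative w (at x) (axis j 1) = gw j x"
    using C1_closure_derivative[OF assms(12)] unfolding K_def by blast
  obtain KA where KA: "\<And>x y. x \<in> K \<Longrightarrow> y \<in> K \<Longrightarrow> norm (A x - A y) \<le> KA * dist x y powr \<beta>"
    and "bounded (A ` K)"
    using assms(9) unfolding C0_Holder_def K_def by blast
  then obtain BA where BA: "\<And>x. x \<in> K \<Longrightarrow> norm (A x) \<le> BA" unfolding bounded_iff by blast
  define a where "a = (\<lambda>i j x. A x $ i $ j)"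
  have entry: "\<bar>M $ i $ j\<bar> \<le> norm M" for M :: "real^2^2" and i j
    by (rule order_trans[OF component_le_norm_cart Finite_Cartesian_Product.norm_nth_le])
  have ah: "\<bar>a i j x - a i j y\<bar> \<le> \<bar>KA\<bar> * dist x y powr \<beta>" if "x \<in> K" "y \<in> K" for i j x y
  proof -
    have "\<bar>(A x - A y) $ i $ j\<bar> \<le> KA * dist x y powr \<beta>" by (rule order_trans[OF entry KA[OF that]])
    also have "\<dots> \<le> \<bar>KA\<bar> * dist x y powr \<beta>" by (rule mult_right_mono) auto
    finally show ?thesis by (simp add: a_def)
  qed
  have ab: "\<bar>a i j x\<bar> \<le> BA" if "x \<in> K" for i j x
    unfolding a_def by (rule order_trans[OF entry BA[OF that]])
  have asym: "a 2 1 x = a 1 2 x" if "x \<in> K" for x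
  proof -
    have "transpose (A x) $ 2 $ 1 = A x $ 1 $ 2" by (simp add: transpose_def)
    then show ?thesis using assms(10) that by (simp add: K_def a_def)
  qed
  have ac: "continuous_on K (a i j)" for i j
  proof -
    obtain F where F: "\<forall>x\<in>K. F x = a i j x" "\<forall>x y. \<bar>F x - F y\<bar> \<le> \<bar>KA\<bar> * dist x y powr \<beta>"
      using Holder_extension[OF K(2) assms(5) less_imp_le[OF assms(6)] abs_ge_zero ah ab] by blast
    have "continuous_on K F"
      by (rule continuous_on_subset[OF Holder_imp_continuous[OF F(2)[rule_format] assms(5)] subset_UNIV])
    then show ?thesis by (rule continuous_on_eq) (use F(1) in blast)
  qed
  define P where "P = (\<lambda>i j x. gw i x $ j + gw j x $ i + gv i x * gv j x)"
  have Pc: "continuous_on K (P i j)" for i j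
    unfolding P_def by (intro continuous_on_add continuous_on_mult continuous_on_component gv gw)
  have quad\<Omega>: "c * (y^2 + z^2) \<le> (a 1 1 x - P 1 1 x) * y^2 + 2 * (a 1 2 x - P 1 2 x) * y * z + (a 2 2 x - P 2 2 x) * z^2"
    if x: "x \<in> \<Omega>" for x y z
  proof -
    have e: "(2 *\<^sub>R sym_gradient w x + tensor (gradient v x) (gradient v x)) $ i $ j = P i j x" for i j
      by (simp add: sym_gradient_def tensor_def gradient_def partial_deriv_def jacobian_def matrix_def transpose_def
          gv(3)[OF x] gw(3)[OF x] P_def)
    have "0 \<le> vector [y, z] \<bullet> ((A x - c *\<^sub>R mat 1 - (2 *\<^sub>R sym_gradient w x + tensor (gradient v x) (gradient v x))) *v vector [y, z])"
      using assms(14) x unfolding matrix_le_def pos_semidef_def by blast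
    moreover have "\<dots> = (a 1 1 x - P 1 1 x) * y^2 + ((a 1 2 x - P 1 2 x) + (a 2 1 x - P 2 1 x)) * (y * z) + (a 2 2 x - P 2 2 x) * z^2
        - c * (y^2 + z^2)"
      by (simp add: inner_vec_def sum_2 matrix_vector_mult_def e mat_def del: vector_add_component)
        (simp add: a_def algebra_simps power2_eq_square)
    moreover have "a 2 1 x - P 2 1 x = a 1 2 x - P 1 2 x" using asym[of x] x K by (auto simp: P_def)
    ultimately show ?thesis by (simp add: algebra_simps)
  qed
  \<comment> \<open>By continuity of the extended derivatives the strict inequality reaches the
    boundary with the same \<open>c\<close>.\<close>
  have quadK: "c * (y^2 + z^2) \<le> (a 1 1 x - P 1 1 x) * y^2 + 2 * (a 1 2 x - P 1 2 x) * y * z + (a 2 2 x - P 2 2 x) * z^2"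
    if x: "x \<in> K" for x y z
    by (rule continuous_ge_on_closure[of \<Omega> "\<lambda>x. (a 1 1 x - P 1 1 x) * y^2 + 2 * (a 1 2 x - P 1 2 x) * y * z + (a 2 2 x - P 2 2 x) * z^2"])
       (use x quad\<Omega> ac Pc in \<open>auto simp: K_def[symmetric] intro!: continuous_intros\<close>)
  have "\<exists>G. \<forall>x\<in>K. \<bar>gv j x\<bar> \<le> G" for j
    using compact_imp_bounded[OF compact_continuous_image[OF gv(1) K(1)]] unfolding bounded_iff by auto
  then obtain Gv where Gv: "\<And>j x. x \<in> K \<Longrightarrow> \<bar>gv j x\<bar> \<le> Gv j" by metis
  define G where "G = \<bar>Gv 1\<bar> + \<bar>Gv 2\<bar>"
  have G: "\<bar>gv j x\<bar> \<le> G" if "x \<in> K" for j x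
    using Gv[OF that, of j] exhaust_2[of j] by (auto simp: G_def)
  have G0: "0 \<le> G" by (simp add: G_def)
  \<comment> \<open>An error \<eta> in the gradients changes an entry of the strain by at most
    \<open>\<eta> * (2 * G + 3)\<close>: \<open>2 * G + 1\<close> from the product, 2 from
    \<open>w\<close>. With the bound \<open>c / 4\<close> per entry the quadratic form loses at most
    \<open>c / 2\<close>, and \<open>c / 2\<close> remains.\<close>
  define \<eta> where "\<eta> = min (min 1 (\<epsilon> / 8)) (c / (4 * (2 * G + 3)))"
  have \<eta>: "0 < \<eta>" "\<eta> \<le> 1" "\<eta> \<le> \<epsilon> / 8" "\<eta> * (2 * G + 3) \<le> c / 4"
  proof -
    have g: "0 < 2 * G + 3" using G0 by simp
    then show "0 < \<eta>" using assms(13,15) by (simp add: \<eta>_def)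
    show "\<eta> \<le> 1" "\<eta> \<le> \<epsilon> / 8" unfolding \<eta>_def by (rule min.coboundedI1, rule min.cobounded1, rule min.coboundedI1, rule min.cobounded2)
    have "\<eta> \<le> c / (4 * (2 * G + 3))" unfolding \<eta>_def by (rule min.cobounded2)
    then have "\<eta> \<le> c / 4 / (2 * G + 3)" by (simp only: divide_divide_eq_left)
    then show "\<eta> * (2 * G + 3) \<le> c / 4" using g by (simp only: pos_le_divide_eq)
  qed
  have inw: "\<And>p. p \<in> closure \<Omega> \<Longrightarrow> \<exists>\<rho> e. inward_at \<Omega> p \<rho> e"
    by (rule smooth_boundary_inward[OF \<Omega>(1) assms(4)])
  have "\<exists>U. Cb 4 U \<and> (\<forall>x\<in>closure \<Omega>. \<bar>U x - v x\<bar> \<le> \<eta> \<and> (\<forall>j. \<bar>pd j U x - gv j x\<bar> \<le> \<eta>))"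
  proof (rule C1_approximation[OF \<Omega>(1) assms(2) \<Omega>(2) inw _ _ _ \<eta>(1)])
    show "continuous_on (closure \<Omega>) v" using assms(11) by (simp add: C1_closure_def)
    show "continuous_on (closure \<Omega>) (gv j)" for j using gv(1) by (simp add: K_def)
    show "\<exists>u'. (v has_derivative u') (at x) \<and> (\<forall>j. u' (axis j 1) = gv j x)" if "x \<in> \<Omega>" for x
      by (intro exI[of _ "frechet_derivative v (at x)"] conjI allI gv(2,3) that)
  qed
  then obtain V where V: "Cb 4 V" "\<forall>x\<in>K. \<bar>V x - v x\<bar> \<le> \<eta> \<and> (\<forall>j. \<bar>pd j V x - gv j x\<bar> \<le> \<eta>)" unfolding K_def by blast
  have "\<exists>U. Cb 4 U \<and> (\<forall>x\<in>closure \<Omega>. \<bar>U x - w x $ i\<bar> \<le> \<eta> \<and> (\<forall>j. \<bar>pd j U x - gw j x $ i\<bar> \<le> \<eta>))" for i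
  proof (rule C1_approximation[OF \<Omega>(1) assms(2) \<Omega>(2) inw _ _ _ \<eta>(1)])
    show "continuous_on (closure \<Omega>) (\<lambda>x. w x $ i)"
      using assms(12) by (intro continuous_on_component) (simp add: C1_closure_def)
    show "continuous_on (closure \<Omega>) (\<lambda>x. gw j x $ i)" for j
      using gw(1) by (intro continuous_on_component) (simp add: K_def)
    fix x assume x: "x \<in> \<Omega>"
    have "((\<lambda>x. w x $ i) has_derivative (\<lambda>h. frechet_derivative w (at x) h $ i)) (at x)"
      by (rule bounded_linear.has_derivative[OF bounded_linear_vec_nth gw(2)[OF x]])
    then show "\<exists>u'. ((\<lambda>x. w x $ i) has_derivative u') (at x) \<and> (\<forall>j. u' (axis j 1) = gw j x $ i)"
      using gw(3)[OF x] by auto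
  qed
  then obtain W where W: "\<And>i. Cb 4 (W i)" "\<And>i. \<forall>x\<in>K. \<bar>W i x - w x $ i\<bar> \<le> \<eta> \<and> (\<forall>j. \<bar>pd j (W i) x - gw j x $ i\<bar> \<le> \<eta>)"
    unfolding K_def by metis
  have sqP: "\<bar>P i j x - strain V W i j x\<bar> \<le> c / 4" if x: "x \<in> K" for i j x
  proof -
    have 1: "\<bar>pd k V x - gv k x\<bar> \<le> \<eta>" for k using V(2) x by blast
    have 2: "\<bar>pd k (W l) x - gw k x $ l\<bar> \<le> \<eta>" for k l using W(2) x by blast
    have "pd i V x * pd j V x - gv i x * gv j x
        = (pd i V x - gv i x) * (pd j V x - gv j x) + (pd i V x - gv i x) * gv j x + gv i x * (pd j V x - gv j x)"
      by (simp add: algebra_simps)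
    moreover have "\<bar>(pd i V x - gv i x) * (pd j V x - gv j x)\<bar> \<le> \<eta> * 1"
      unfolding abs_mult using 1 \<eta> order_trans by (intro mult_mono) (auto intro: order_trans[OF 1])
    moreover have "\<bar>(pd i V x - gv i x) * gv j x\<bar> \<le> \<eta> * G" "\<bar>gv i x * (pd j V x - gv j x)\<bar> \<le> G * \<eta>"
      unfolding abs_mult using 1 G[OF x] \<eta> G0 by (auto intro!: mult_mono)
    ultimately have "\<bar>pd i V x * pd j V x - gv i x * gv j x\<bar> \<le> \<eta> * 1 + \<eta> * G + G * \<eta>" by linarith
    moreover have "\<eta> * (2 * G + 3) = (\<eta> * 1 + \<eta> * G + G * \<eta>) + 2 * \<eta>" by (simp add: algebra_simps)
    ultimately show ?thesis
      using 2[of i j] 2[of j i] \<eta>(4) unfolding P_def strain_def by linarith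
  qed
  have pos: "c / 2 * (y^2 + z^2) \<le> (a 1 1 x - strain V W 1 1 x) * y^2
        + 2 * (a 1 2 x - strain V W 1 2 x) * y * z + (a 2 2 x - strain V W 2 2 x) * z^2" if x: "x \<in> K" for x y z
    using quadratic_perturbation[OF sqP[OF x, of 1 1] sqP[OF x, of 1 2] sqP[OF x, of 2 2], of y z] quadK[OF x, of y z]
    by (simp add: algebra_simps)
  have c2: "0 < c / 2" using assms(13) by simp
  obtain A' H HA where A': "0 \<le> H" "\<forall>i j. \<forall>x\<in>K. A' i j x = a i j x"
     "\<forall>i j x y. \<bar>A' i j x - A' i j y\<bar> \<le> H * dist x y powr \<beta>" "\<forall>i j x. \<bar>A' i j x\<bar> \<le> HA"
     "\<forall>x y z. c / 2 * (y^2 + z^2) \<le> (A' 1 1 x - strain V W 1 1 x) * y^2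
        + 2 * (A' 1 2 x - strain V W 1 2 x) * y * z + (A' 2 2 x - strain V W 2 2 x) * z^2"
  proof -
    have "\<exists>A' H HA. 0 \<le> H \<and> (\<forall>i j. \<forall>x\<in>K. A' i j x = a i j x) \<and>
     (\<forall>i j x y. \<bar>A' i j x - A' i j y\<bar> \<le> H * dist x y powr \<beta>) \<and> (\<forall>i j x. \<bar>A' i j x\<bar> \<le> HA) \<and>
     (\<forall>x y z. c / 2 * (y^2 + z^2) \<le> (A' 1 1 x - strain V W 1 1 x) * y^2
        + 2 * (A' 1 2 x - strain V W 1 2 x) * y * z + (A' 2 2 x - strain V W 2 2 x) * z^2)"
      by (rule extend_deficit[where a = a and w = W, OF K(1,2) assms(5) less_imp_le[OF assms(6)] abs_ge_zero ah ab V(1) W(1) c2 pos]; assumption)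
    then show ?thesis by (elim exE conjE) (rule that; assumption)
  qed
  \<comment> \<open>With \<eta> at most \<epsilon>/8, each scalar function moves by at most
    \<epsilon>/4. There are three, so the sum of the two norms is at most 3/4 of \<epsilon>.\<close>
  have \<epsilon>8: "0 < \<epsilon> / 8" using assms(15) by simp
  obtain v' u where s: "C1_Holder_pd \<alpha> v'" "\<forall>j. C1_Holder_pd \<alpha> (u j)" "\<forall>x. \<bar>v' x - V x\<bar> \<le> \<epsilon> / 8"
     "\<forall>j x. \<bar>u j x - W j x\<bar> \<le> \<epsilon> / 8" "\<forall>x. strain v' u 1 2 x = A' 1 2 x" "\<forall>k x. strain v' u k k x = A' k k x"
    using global_solution[where w = W and A = A', OF \<alpha> V(1) W(1) A'(1) A'(3)[rule_format] A'(4)[rule_format] c2 A'(5)[rule_format] \<epsilon>8]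
    by (elim exE conjE) (rule that; assumption)
  define w' where "w' = (\<lambda>x. u 1 x *\<^sub>R axis 1 1 + u 2 x *\<^sub>R axis 2 1 :: real^2)"
  define Du where "Du = (\<lambda>j x (h::real^2). pd 1 (u j) x * h $ 1 + pd 2 (u j) x * h $ 2)"
  have dv: "(v' has_derivative (\<lambda>h. pd 1 v' x * h $ 1 + pd 2 v' x * h $ 2)) (at x)" for x
    by (rule C1_Holder_pd_has_derivative[OF s(1) \<alpha>(1)])
  have du: "(u j has_derivative Du j x) (at x)" for j x
    unfolding Du_def by (rule C1_Holder_pd_has_derivative[OF s(2)[rule_format] \<alpha>(1)])
  have dw: "(w' has_derivative (\<lambda>h. Du 1 x h *\<^sub>R axis 1 1 + Du 2 x h *\<^sub>R axis 2 1)) (at x)" for x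
    unfolding w'_def by (intro has_derivative_add has_derivative_scaleR_left du)
  have ev: "pd 1 f x * axis i 1 $ 1 + pd 2 f x * axis i 1 $ 2 = pd i f x" for f :: "real^2 \<Rightarrow> real" and i x
    using exhaust_2[of i] by (auto simp: axis_def)
  have eu: "Du j x (axis i 1) = pd i (u j) x" for i j x unfolding Du_def by (rule ev)
  have hol: "continuous_on UNIV (pd i f)" "\<exists>B. \<forall>x. \<bar>pd i f x\<bar> \<le> B" "\<exists>K. \<forall>x y. \<bar>pd i f x - pd i f y\<bar> \<le> K * dist x y powr \<alpha>"
    if "C1_Holder_pd \<alpha> f" for f i
    using C1_Holder_pd_has_derivative(1)[OF that \<alpha>(1)] that by (auto simp: C1_Holder_pd_def)
  have 1: "C1_Holder_closure \<alpha> \<Omega> v'"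
    by (rule C1_Holder_closureI[OF dv], unfold ev real_norm_def)
       (rule hol(1)[OF s(1)], rule hol(2)[OF s(1)], rule hol(3)[OF s(1)])
  have 2: "C1_Holder_closure \<alpha> \<Omega> w'"
  proof (rule C1_Holder_closureI[OF dw], unfold eu)
    fix i
    have u: "C1_Holder_pd \<alpha> (u j)" for j using s(2) by blast
    show "continuous_on UNIV (\<lambda>x. pd i (u 1) x *\<^sub>R axis 1 1 + pd i (u 2) x *\<^sub>R axis 2 1 :: real^2)"
      by (intro continuous_on_add continuous_on_scaleR continuous_on_const hol(1) u)
    obtain B1 B2 where B: "\<And>x. \<bar>pd i (u 1) x\<bar> \<le> B1" "\<And>x. \<bar>pd i (u 2) x\<bar> \<le> B2" using hol(2)[OF u] by metis
    show "\<exists>B. \<forall>x. norm (pd i (u 1) x *\<^sub>R axis 1 1 + pd i (u 2) x *\<^sub>R axis 2 1 :: real^2) \<le> B"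
      by (intro exI[of _ "B1 + B2"] allI order_trans[OF norm_axis_sum] add_mono B)
    obtain K1 K2 where H: "\<And>x y. \<bar>pd i (u 1) x - pd i (u 1) y\<bar> \<le> K1 * dist x y powr \<alpha>"
      "\<And>x y. \<bar>pd i (u 2) x - pd i (u 2) y\<bar> \<le> K2 * dist x y powr \<alpha>" using hol(3)[OF u] by metis
    have "norm ((pd i (u 1) x *\<^sub>R axis 1 1 + pd i (u 2) x *\<^sub>R axis 2 1)
        - (pd i (u 1) y *\<^sub>R axis 1 1 + pd i (u 2) y *\<^sub>R axis 2 1 :: real^2)) \<le> (K1 + K2) * dist x y powr \<alpha>" for x y
    proof -
      have "(pd i (u 1) x *\<^sub>R axis 1 1 + pd i (u 2) x *\<^sub>R axis 2 1) - (pd i (u 1) y *\<^sub>R axis 1 1 + pd i (u 2) y *\<^sub>R axis 2 1 :: real^2)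
        = (pd i (u 1) x - pd i (u 1) y) *\<^sub>R axis 1 1 + (pd i (u 2) x - pd i (u 2) y) *\<^sub>R axis 2 1"
        by (simp add: scaleR_diff_left)
      then show ?thesis unfolding distrib_right
        by (simp only:) (rule order_trans[OF norm_axis_sum add_mono[OF H(1) H(2)]])
    qed
    then show "\<exists>K. \<forall>x y. norm ((pd i (u 1) x *\<^sub>R axis 1 1 + pd i (u 2) x *\<^sub>R axis 2 1)
        - (pd i (u 1) y *\<^sub>R axis 1 1 + pd i (u 2) y *\<^sub>R axis 2 1 :: real^2)) \<le> K * dist x y powr \<alpha>" by blast
  qed
  have nv: "norm (v' x - v x) \<le> \<epsilon> / 4" if "x \<in> \<Omega>" for x
  proof -
    have "\<bar>V x - v x\<bar> \<le> \<epsilon> / 8" using V(2) that K(3) \<eta>(3) by fastforce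
    then show ?thesis unfolding real_norm_def using s(3)[rule_format, of x] by linarith
  qed
  have nw: "norm (w' x - w x) \<le> \<epsilon> / 2" if "x \<in> \<Omega>" for x
  proof -
    have 1: "\<bar>u j x - w x $ j\<bar> \<le> \<epsilon> / 4" for j
    proof -
      have "\<bar>W j x - w x $ j\<bar> \<le> \<epsilon> / 8" using W(2)[of j] that K(3) \<eta>(3) by fastforce
      then show ?thesis using s(4)[rule_format, of j x] by linarith
    qed
    have "w' x - w x = (u 1 x - w x $ 1) *\<^sub>R axis 1 1 + (u 2 x - w x $ 2) *\<^sub>R axis 2 1"
      unfolding vec_eq_iff forall_2 by (simp add: axis_def w'_def)
    then show ?thesis using norm_axis_sum[of "u 1 x - w x $ 1" "u 2 x - w x $ 2"] 1[of 1] 1[of 2] by (simp only:)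
  qed
  have 3: "C0_norm \<Omega> (\<lambda>x. w' x - w x) + C0_norm \<Omega> (\<lambda>x. v' x - v x) \<le> \<epsilon>"
  proof -
    have "C0_norm \<Omega> (\<lambda>x. w' x - w x) \<le> \<epsilon> / 2" by (rule C0_norm_le[OF \<Omega>(2) nw])
    moreover have "C0_norm \<Omega> (\<lambda>x. v' x - v x) \<le> \<epsilon> / 4" by (rule C0_norm_le[OF \<Omega>(2) nv])
    ultimately show ?thesis using assms(15) by linarith
  qed
  have 4: "2 *\<^sub>R sym_gradient w' x + tensor (gradient v' x) (gradient v' x) = A x" if x: "x \<in> \<Omega>" for x
  proof -
    have fv: "frechet_derivative v' (at x) = (\<lambda>h. pd 1 v' x * h $ 1 + pd 2 v' x * h $ 2)"
      using frechet_derivative_at[OF dv] by simp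
    have fw: "frechet_derivative w' (at x) = (\<lambda>h. Du 1 x h *\<^sub>R axis 1 1 + Du 2 x h *\<^sub>R axis 2 1)"
      using frechet_derivative_at[OF dw] by simp
    have pick: "b 1 * axis 1 1 $ i + b 2 * axis 2 1 $ i = b i" for b :: "2 \<Rightarrow> real" and i
      using exhaust_2[of i] by (auto simp: axis_def)
    have e: "(2 *\<^sub>R sym_gradient w' x + tensor (gradient v' x) (gradient v' x)) $ i $ j = strain v' u i j x" for i j
      unfolding sym_gradient_def tensor_def gradient_def partial_deriv_def jacobian_def matrix_def transpose_def fv fw eu ev
      using pick[of "\<lambda>k. pd j (u k) x" i] pick[of "\<lambda>k. pd i (u k) x" j]
      by (simp add: strain_def)
    \<comment> \<open>The problem on the plane was solved for the entries (1,1), (1,2) and (2,2);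
      the entry (2,1) follows from the symmetry of \<open>strain\<close> and
      \<open>A\<close>.\<close>
    have ss: "strain v' u 2 1 x = strain v' u 1 2 x" by (simp add: strain_def)
    have xK: "x \<in> K" using x K by auto
    show ?thesis
      unfolding vec_eq_iff forall_2 e
      using s(5,6) A'(2) xK asym[OF xK] ss by (simp add: a_def)
  qed
  show ?thesis using 1 2 3 4 by blast
qed

end
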